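(* Let $F$ be a graph which is $r$-semi-bounded (with respect to a triple $(S,T,v^* )$) and which contains a cycle. Then there exists a constant $C>0$ such that for every $p=p(n)$ with \[n^{-1/m_2(F)}\le p\le \min\left\{n^{b(F)-1/m_2(F)},\ n^{1/r-1/m_2(F)}\right\}\] we have a.a.s. \[\mathrm{ex}(G_{n,p},F)\le n^{2-1/m_2(F)}(\log n)^C.\]
   Context: All graphs are finite and simple. Let $r\ge1$ be an integer. A bipartite graph $F$ is $r$-semi-bounded with respect to a triple $(S,T,v^* )$ if $S\cup T$ is a bipartition of $F$, $v^*\in T$ is adjacent to every vertex in $S$, and every $v\in T\setminus\{v^*\}$ has $\deg_F(v)\le r$. For $\nu\subseteq V(F)$ let $e(\nu):=e(F[\nu])$ be the number of edges of the induced subgraph $F[\nu]$, and if $e(\nu)\ge1$ let \[f(\nu):=|S\cap\nu|+\sum_{v\in T\cap\nu}\deg_F(v)-\max_{v\in T\cap\nu:\ \deg_{F[\nu]}(v)\ge1}\deg_F(v).\] The 2-density of $F$ is $m_2(F)=\max_{F'\subseteq F:\ v(F')\ge3}\frac{e(F')-1}{v(F')-2}$. Let $B_F$ be the set of (nonempty) $\nu\subseteq V(F)$ such that $F[\nu]$ has minimum degree $\delta(F[\nu])\ge1$ and $f(\nu)>e(\nu)$. For $\nu\in B_F$ let \[b(\nu)=\frac{|\nu|-2-(e(\nu)-1)/m_2(F)}{f(\nu)-e(\nu)},\qquad b(F)=\min_{\nu\in B_F}b(\nu).\] (The set $B_F$ is nonempty when $F$ contains a cycle.) $G_{n,p}$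 is the random graph on $n$ vertices in which each possible edge is included independently with probability $p$ (so $p\in[0,1]$), and $\mathrm{ex}(G_{n,p},F)$ is the maximum number of edges in an $F$-free subgraph of $G_{n,p}$. A sequence of events $A_n$ holds asymptotically almost surely (a.a.s.) if $\Pr[A_n]\to1$ as $n\to\infty$. *)

theory Defs
  imports "HOL-Probability.Probability" "HOL-Library.Ramsey"
begin

section \<open>Finite simple graphs\<close>

record 'a ugraph =
  verts :: "'a set"
  edges :: "'a set set"

definition simple_graph :: "'a ugraph \<Rightarrow> bool" where
  "simple_graph G \<longleftrightarrow> finite (verts G) \<and> edges G \<subseteq> nsets (verts G) 2"

definition degree :: "'a ugraph \<Rightarrow> 'a \<Rightarrow> nat" where
  "degree G v = card {e \<in> edges G. v \<in> e}"

definition induced :: "'a ugraph \<Rightarrow> 'a set \<Rightarrow> 'a ugraph" where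
  "induced G U = \<lparr>verts = verts G \<inter> U, edges = {e \<in> edges G. e \<subseteq> U}\<rparr>"

definition subgraph :: "'a ugraph \<Rightarrow> 'a ugraph \<Rightarrow> bool" where
  "subgraph H G \<longleftrightarrow> simple_graph H \<and> verts H \<subseteq> verts G \<and> edges H \<subseteq> edges G"

definition has_cycle :: "'a ugraph \<Rightarrow> bool" where
  "has_cycle G \<longleftrightarrow>
     (\<exists>xs. length xs \<ge> 3 \<and> distinct xs \<and>
        (\<forall>i<length xs. {xs ! i, xs ! (Suc i mod length xs)} \<in> edges G))"

text \<open>\<open>H\<close> contains a (not necessarily induced) copy of \<open>F\<close>.\<close>
definition contains_copy :: "'b ugraph \<Rightarrow> 'a ugraph \<Rightarrow> bool" where
  "contains_copy H F \<longleftrightarrow>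
     (\<exists>\<phi>. inj_on \<phi> (verts F) \<and> \<phi> ` verts F \<subseteq> verts H \<and> (\<forall>e\<in>edges F. \<phi> ` e \<in> edges H))"

definition extremal_number :: "'b ugraph \<Rightarrow> 'a ugraph \<Rightarrow> nat" where
  "extremal_number G F = Max {card (edges H) |H. subgraph H G \<and> \<not> contains_copy H F}"

section \<open>Semi-bounded graphs and the parameters $m_2$ and $b$\<close>

definition bipartition :: "'a ugraph \<Rightarrow> 'a set \<Rightarrow> 'a set \<Rightarrow> bool" where
  "bipartition F S T \<longleftrightarrow>
     S \<union> T = verts F \<and> S \<inter> T = {} \<and> (\<forall>e\<in>edges F. \<exists>x\<in>S. \<exists>y\<in>T. e = {x, y})"

definition semi_bounded :: "nat \<Rightarrow> 'a ugraph \<Rightarrow> 'a set \<Rightarrow> 'a set \<Rightarrow> 'a \<Rightarrow> bool" where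
  "semi_bounded r F S T v0 \<longleftrightarrow>
     bipartition F S T \<and> v0 \<in> T \<and> (\<forall>s\<in>S. {s, v0} \<in> edges F) \<and>
     (\<forall>v\<in>T - {v0}. degree F v \<le> r)"

definition two_density :: "'a ugraph \<Rightarrow> real" where
  "two_density F =
     Max {(real (card (edges F')) - 1) / (real (card (verts F')) - 2) |F'.
            subgraph F' F \<and> card (verts F') \<ge> 3}"

definition e_ind :: "'a ugraph \<Rightarrow> 'a set \<Rightarrow> nat" where
  "e_ind F \<nu> = card (edges (induced F \<nu>))"

text \<open>Integer-valued, so that the subtraction is not truncated. Only meaningful when
  \<open>e_ind F \<nu> \<ge> 1\<close>: otherwise \<open>Max\<close> is applied to the empty set. Note that the degrees being summed
  and maximised are those in \<open>F\<close>, while the maximum ranges over the vertices that are not isolated in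
  the induced subgraph.\<close>
definition f_val :: "'a ugraph \<Rightarrow> 'a set \<Rightarrow> 'a set \<Rightarrow> 'a set \<Rightarrow> int" where
  "f_val F S T \<nu> =
     int (card (S \<inter> \<nu>)) + (\<Sum>v\<in>T \<inter> \<nu>. int (degree F v))
       - int (Max {degree F v |v. v \<in> T \<inter> \<nu> \<and> degree (induced F \<nu>) v \<ge> 1})"

text \<open>Minimum degree at least 1 together with \<open>\<nu> \<noteq> {}\<close> forces \<open>e_ind F \<nu> \<ge> 1\<close>, so \<open>f_val\<close> is
  meaningful for all members.\<close>
definition B_set :: "'a ugraph \<Rightarrow> 'a set \<Rightarrow> 'a set \<Rightarrow> 'a set set" where
  "B_set F S T =
     {\<nu>. \<nu> \<noteq> {} \<and> \<nu> \<subseteq> verts F \<and> (\<forall>v\<in>\<nu>. degree (induced F \<nu>) v \<ge> 1) \<and>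
         f_val F S T \<nu> > int (e_ind F \<nu>)}"

definition b_val :: "'a ugraph \<Rightarrow> 'a set \<Rightarrow> 'a set \<Rightarrow> 'a set \<Rightarrow> real" where
  "b_val F S T \<nu> =
     (real (card \<nu>) - 2 - (real (e_ind F \<nu>) - 1) / two_density F)
       / of_int (f_val F S T \<nu> - int (e_ind F \<nu>))"

definition b_min :: "'a ugraph \<Rightarrow> 'a set \<Rightarrow> 'a set \<Rightarrow> real" where
  "b_min F S T = Min (b_val F S T ` B_set F S T)"

section \<open>The binomial random graph\<close>

text \<open>The vertex set is \<open>{..<n}\<close>; the indicators of the possible edges are independent Bernoulli
  variables with parameter \<open>p\<close>.\<close>
definition gnp :: "nat \<Rightarrow> real \<Rightarrow> nat ugraph pmf" where
  "gnp n p =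
     map_pmf (\<lambda>\<omega>. \<lparr>verts = {..<n}, edges = {e \<in> nsets {..<n} 2. \<omega> e}\<rparr>)
       (Pi_pmf (nsets {..<n} 2) False (\<lambda>_. bernoulli_pmf p))"

definition aas :: "(nat \<Rightarrow> 'a pmf) \<Rightarrow> (nat \<Rightarrow> 'a \<Rightarrow> bool) \<Rightarrow> bool" where
  "aas M A \<longleftrightarrow> (\<lambda>n. measure_pmf.prob (M n) {x. A n x}) \<longlonglongrightarrow> 1"

end

theory Submission
  imports Defs
begin

text \<open>
  Write \<open>m\<close> for the 2-density of \<open>F\<close> and \<open>m0 = n powr (2 - 1 / m)\<close>. An \<open>F\<close>-free graph on
  \<open>{..<n}\<close> is an independent set in the hypergraph whose vertices are the pairs of elements of
  \<open>{..<n}\<close> and whose hyperedges are the copies of \<open>F\<close>. The proof covers these independent sets by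
  few containers, each with at most \<open>2 * (ln n)^2 * m0 / p\<close> edges, and takes a union bound over the
  containers: the random graph contains a proportion of about \<open>p\<close> of the edges of each of them.

  Containers come from supersaturation (\<open>container_family\<close>, \<open>iterate_containers\<close>). Suppose that
  every edge set \<open>U\<close> with more than \<open>2 * (ln n)^2 * m0 / p\<close> elements carries a random copy of \<open>F\<close>
  inside \<open>U\<close> which is spread: any \<open>j \<ge> 1\<close> given edges lie in it with probability at most
  \<open>(K / card U) * (K * m0 / card U)^(j - 1)\<close>, where \<open>K\<close> is polylogarithmic in \<open>n\<close>. Then at most
  \<open>exp (K' * m0)\<close> subsets of \<open>U\<close> contain all \<open>F\<close>-free subsets of \<open>U\<close>, and each is smaller than \<open>U\<close> by
  a factor \<open>1 - 1 / K'\<close>, again with \<open>K'\<close> polylogarithmic. Iterating polylogarithmically often leaves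
  \<open>exp (polylog * m0)\<close> containers of the required size.

  The random copy is built by dependent random choice. Pass to a set \<open>B\<close> of vertices that have equally
  many neighbours in \<open>U\<close> (\<open>regular_part\<close>) and let \<open>\<delta>\<close> be the resulting edge density. Put \<open>v0\<close> on a
  uniform vertex of \<open>B\<close>, put the vertices of \<open>S\<close> independently on neighbours of it, and put each
  other \<open>v \<in> T\<close> on a uniform vertex of \<open>B\<close> among those adjacent to the images of all neighbours of
  \<open>v\<close>; isolated vertices, having no influence on the edges of the copy, are left out. With
  positive probability each of these last choices has at least about \<open>n * \<delta>^(degree v)\<close> options, and
  \<open>\<delta> \<ge> n powr (- 1 / r)\<close>, up to a logarithm, makes this number large, so that most of the resulting
  maps are injective.

  Let now the images of a vertex set \<open>\<nu>\<close> be prescribed. If \<open>\<nu>\<close> contains \<open>v0\<close>, the probability is at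
  most a constant times \<open>n^(- card \<nu>) * \<delta>^(- f \<nu>)\<close>: the image of \<open>v0\<close> has probability about
  \<open>1 / n\<close>, that of a vertex of \<open>S\<close> about \<open>1 / (\<delta> * n)\<close> and that of another vertex \<open>v\<close> of \<open>T\<close> at most
  about \<open>1 / (n * \<delta>^(degree v))\<close>. If \<open>\<nu>\<close> does not contain \<open>v0\<close>, the same bound holds since the
  construction is reversible: the law of the images of \<open>v0\<close>, of the neighbours of \<open>v\<close> and of \<open>v\<close> does not
  change if \<open>v0\<close> and \<open>v\<close> are swapped, so one may start from the vertex of \<open>T \<inter> \<nu>\<close> of largest degree
  (\<open>mass_fixed_mate_le\<close>). This is why \<open>f\<close> omits the largest degree.

  Comparing with the required spread leaves
  \<open>n powr (- (card \<nu> - 2 - (e \<nu> - 1) / m)) \<le> \<delta> powr (f \<nu> - e \<nu>)\<close> (\<open>spread_exponents\<close>). The exponent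
  of \<open>n\<close> is nonpositive by the definition of \<open>m\<close>, so nothing is left to show for \<open>f \<nu> \<le> e \<nu>\<close>. For
  \<open>f \<nu> > e \<nu>\<close> the inequality says \<open>\<delta> \<ge> n powr (- b \<nu>)\<close>, and the upper bound on \<open>p\<close> ensures that
  the edge sets \<open>U\<close> under consideration are that dense.
\<close>

section \<open>Hypergraph containers\<close>

definition weighted_degree :: "'v set \<Rightarrow> ('v set \<Rightarrow> real) \<Rightarrow> 'v set \<Rightarrow> real" where
  "weighted_degree U w \<sigma> = (\<Sum>E | E \<subseteq> U \<and> \<sigma> \<subseteq> E. w E)"

text \<open>
  The links of about \<open>\<tau> * card U\<close> vertices are combined into a weight \<open>g\<close> of total order \<open>\<tau>\<close>. The
  threshold is therefore \<open>\<tau>\<close> times the bound \<open>K / card U * \<tau>^(card \<sigma> - 1)\<close> that spreadness imposes on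
  the degrees of a weight of total 1.
\<close>

definition saturated :: "'v set \<Rightarrow> real \<Rightarrow> real \<Rightarrow> ('v set \<Rightarrow> real) \<Rightarrow> 'v set \<Rightarrow> bool" where
  "saturated U K \<tau> g \<sigma> \<longleftrightarrow> \<sigma> \<noteq> {} \<and> \<sigma> \<subseteq> U \<and> weighted_degree U g \<sigma> \<ge> K / card U * \<tau> ^ card \<sigma>"

definition surviving ::
  "'v set \<Rightarrow> real \<Rightarrow> real \<Rightarrow> ('v set \<Rightarrow> real) \<Rightarrow> ('v set \<Rightarrow> real) \<Rightarrow> 'v set \<Rightarrow> real" where
  "surviving U K \<tau> w g E = (if \<exists>\<sigma>\<subseteq>E. saturated U K \<tau> g \<sigma> then 0 else w E)"

text \<open>
  The vertices of the list are processed from its end to its front, and each adds its link. Hyperedges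
  over a set that is already saturated are left out; this keeps all degrees bounded although many
  vertices contribute.
\<close>

fun link_weight ::
  "'v set \<Rightarrow> real \<Rightarrow> real \<Rightarrow> ('v set \<Rightarrow> real) \<Rightarrow> 'v list \<Rightarrow> 'v set \<Rightarrow> real" where
  "link_weight U K \<tau> w [] = (\<lambda>E. 0)"
| "link_weight U K \<tau> w (v # xs) =
     (\<lambda>E. link_weight U K \<tau> w xs E +
          (if v \<in> E then 0 else surviving U K \<tau> w (link_weight U K \<tau> w xs) (insert v E)))"

lemma sum_UNION_le:
  fixes h :: "'b \<Rightarrow> real"
  assumes "finite I" "\<And>i. i \<in> I \<Longrightarrow> finite (B i)" "\<And>x. h x \<ge> 0"
  shows "sum h (\<Union>i\<in>I. B i) \<le> (\<Sum>i\<in>I. sum h (B i))"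
  using assms(1,2)
proof (induction I rule: finite_induct)
  case (insert i I)
  have "sum h (B i \<union> (\<Union>j\<in>I. B j)) \<le> sum h (B i) + sum h (\<Union>j\<in>I. B j)"
    by (subst sum_Un) (use insert assms(3) in \<open>auto intro!: sum_nonneg\<close>)
  then show ?case using insert by auto
qed simp

lemma weighted_degree_empty: "weighted_degree U w {} = sum w (Pow U)"
  by (simp add: weighted_degree_def Pow_def)

lemma weighted_degree_mono:
  assumes "\<And>E. E \<subseteq> U \<Longrightarrow> w E \<le> w' E"
  shows "weighted_degree U w \<sigma> \<le> weighted_degree U w' \<sigma>"
  unfolding weighted_degree_def by (rule sum_mono) (use assms in auto)

lemma weighted_degree_scale: "weighted_degree U (\<lambda>E. c * w E) \<sigma> = c * weighted_degree U w \<sigma>"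
  by (simp add: weighted_degree_def sum_distrib_left)

lemma weighted_degree_nonneg: "(\<And>E. w E \<ge> 0) \<Longrightarrow> weighted_degree U w \<sigma> \<ge> 0"
  unfolding weighted_degree_def by (rule sum_nonneg) auto

lemma surviving_bounds:
  assumes "\<And>E. w E \<ge> 0"
  shows "surviving U K \<tau> w g E \<ge> 0" "surviving U K \<tau> w g E \<le> w E"
  using assms by (auto simp: surviving_def)

lemma link_weight_nonneg:
  assumes "\<And>E. w E \<ge> 0"
  shows "link_weight U K \<tau> w xs E \<ge> 0"
proof (induction xs arbitrary: E)
  case (Cons v xs)
  then show ?case
    using surviving_bounds(1)[where w = w, OF assms] by simp
qed simp

lemma link_weight_uniform:
  assumes supp: "\<And>E. w E \<noteq> 0 \<Longrightarrow> E \<subseteq> U \<and> card E = Suc k" and fin: "finite U"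
  shows "link_weight U K \<tau> w xs E \<noteq> 0 \<Longrightarrow> E \<subseteq> U \<and> card E = k"
proof (induction xs arbitrary: E)
  case (Cons v xs)
  show ?case
  proof (cases "link_weight U K \<tau> w xs E = 0")
    case True
    then have *: "v \<notin> E" "w (insert v E) \<noteq> 0"
      using Cons.prems by (auto simp: surviving_def split: if_splits)
    note ins = supp[OF *(2)]
    have sub: "E \<subseteq> U" using conjunct1[OF ins] by blast
    then have "finite E" using fin by (rule finite_subset)
    then show ?thesis using conjunct2[OF ins] sub *(1) by simp
  next
    case False
    then show ?thesis by (rule Cons.IH)
  qed
qed simp

text \<open>
  A link edge \<open>E \<subseteq> I\<close> would come from a hyperedge \<open>insert v E\<close> with \<open>v \<in> I\<close>, all of it inside \<open>I\<close>.
\<close>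

lemma link_weight_independent:
  assumes "set xs \<subseteq> I" "\<And>E. E \<subseteq> I \<Longrightarrow> w E = 0" "E \<subseteq> I"
  shows "link_weight U K \<tau> w xs E = 0"
  using assms(1)
proof (induction xs)
  case (Cons v xs)
  then have "w (insert v E) = 0" using assms by auto
  then show ?case using Cons by (auto simp: surviving_def)
qed simp

lemma sum_link:
  fixes h :: "'v set \<Rightarrow> real"
  assumes fin: "finite U" and v: "v \<in> U"
  shows "(\<Sum>E | E \<subseteq> U \<and> \<sigma> \<subseteq> E. if v \<in> E then 0 else h (insert v E)) =
         (if v \<in> \<sigma> then 0 else weighted_degree U h (insert v \<sigma>))"
proof (cases "v \<in> \<sigma>")
  case True
  then show ?thesis by (auto intro!: sum.neutral)
next
  case False
  have fin': "finite {E. E \<subseteq> U \<and> \<sigma> \<subseteq> E}" using fin by simp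
  have "(\<Sum>E | E \<subseteq> U \<and> \<sigma> \<subseteq> E. if v \<in> E then 0 else h (insert v E)) =
        (\<Sum>E | E \<subseteq> U \<and> \<sigma> \<subseteq> E \<and> v \<notin> E. h (insert v E))"
    by (rule sum.mono_neutral_cong_right) (use fin' in auto)
  also have "\<dots> = (\<Sum>E | E \<subseteq> U \<and> insert v \<sigma> \<subseteq> E. h E)"
    by (rule sum.reindex_bij_witness[where i = "\<lambda>E. E - {v}" and j = "insert v"])
       (use v False in auto)
  finally show ?thesis using False by (simp add: weighted_degree_def)
qed

lemma weighted_degree_link_weight_Cons:
  assumes "finite U" "v \<in> U"
  shows "weighted_degree U (link_weight U K \<tau> w (v # xs)) \<sigma> = weighted_degree U (link_weight U K \<tau> w xs) \<sigma> +
     (if v \<in> \<sigma> then 0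
      else weighted_degree U (surviving U K \<tau> w (link_weight U K \<tau> w xs)) (insert v \<sigma>))"
  using sum_link[OF assms, of "surviving U K \<tau> w (link_weight U K \<tau> w xs)" \<sigma>]
  by (simp add: weighted_degree_def sum.distrib)

lemma weighted_degree_surviving_saturated:
  assumes "saturated U K \<tau> g \<sigma>" "\<sigma> \<subseteq> \<sigma>'"
  shows "weighted_degree U (surviving U K \<tau> w g) \<sigma>' = 0"
  unfolding weighted_degree_def using assms by (intro sum.neutral) (auto simp: surviving_def)

text \<open>
  A set gains no weight after it has become saturated, and the vertex that makes it saturated adds no
  more than the threshold itself. Hence the factor 2.
\<close>

lemma weighted_degree_link_weight_le:
  assumes fin: "finite U" and pos: "K \<ge> 0" "\<tau> \<ge> 0" and nn: "\<And>E. w E \<ge> 0"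
    and spread: "\<And>\<sigma>. \<sigma> \<subseteq> U \<Longrightarrow> \<sigma> \<noteq> {} \<Longrightarrow> weighted_degree U w \<sigma> \<le> K / card U * \<tau> ^ (card \<sigma> - 1)"
    and xs: "set xs \<subseteq> U" and \<sigma>: "\<sigma> \<subseteq> U" "\<sigma> \<noteq> {}"
  shows "weighted_degree U (link_weight U K \<tau> w xs) \<sigma> \<le> 2 * K / card U * \<tau> ^ card \<sigma>"
  using xs
proof (induction xs)
  case Nil
  show ?case using pos by (simp add: weighted_degree_def)
next
  case (Cons v xs)
  let ?g = "link_weight U K \<tau> w xs"
  have v: "v \<in> U" and IH: "weighted_degree U ?g \<sigma> \<le> 2 * K / card U * \<tau> ^ card \<sigma>"
    using Cons by auto
  have fs: "finite \<sigma>" using \<sigma> fin finite_subset by blast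
  show ?case
  proof (cases "v \<in> \<sigma> \<or> saturated U K \<tau> ?g \<sigma>")
    case True
    then show ?thesis
      using IH weighted_degree_surviving_saturated[of U K \<tau> ?g \<sigma> "insert v \<sigma>" w]
      by (auto simp: weighted_degree_link_weight_Cons[OF fin v] subset_insertI simp del: link_weight.simps)
  next
    case False
    have "weighted_degree U (surviving U K \<tau> w ?g) (insert v \<sigma>) \<le> weighted_degree U w (insert v \<sigma>)"
      by (rule weighted_degree_mono) (rule surviving_bounds[OF nn])
    also have "\<dots> \<le> K / card U * \<tau> ^ card \<sigma>"
      using spread[of "insert v \<sigma>"] False v \<sigma> fs by auto
    finally show ?thesis
      using False \<sigma>
      by (auto simp: weighted_degree_link_weight_Cons[OF fin v] saturated_def simp del: link_weight.simps)
  qed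
qed

lemma sum_weighted_degree_subsets:
  assumes fin: "finite U" and supp: "\<And>E. g E \<noteq> 0 \<Longrightarrow> E \<subseteq> U \<and> card E = k"
  shows "(\<Sum>\<sigma>\<in>Pow U. weighted_degree U g \<sigma>) = 2 ^ k * sum g (Pow U)"
proof -
  have "(\<Sum>\<sigma>\<in>Pow U. weighted_degree U g \<sigma>) = (\<Sum>\<sigma>\<in>Pow U. \<Sum>E\<in>Pow U. if \<sigma> \<subseteq> E then g E else 0)"
    unfolding weighted_degree_def
    by (intro sum.cong refl sum.mono_neutral_cong_left) (use fin in auto)
  also have "\<dots> = (\<Sum>E\<in>Pow U. \<Sum>\<sigma>\<in>Pow U. if \<sigma> \<subseteq> E then g E else 0)"
    by (rule sum.swap)
  also have "\<dots> = (\<Sum>E\<in>Pow U. 2 ^ k * g E)"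
  proof (intro sum.cong refl)
    fix E assume E: "E \<in> Pow U"
    have "(\<Sum>\<sigma>\<in>Pow U. if \<sigma> \<subseteq> E then g E else 0) = (\<Sum>\<sigma>\<in>Pow E. g E)"
      by (rule sum.mono_neutral_cong_right) (use fin E in auto)
    also have "\<dots> = 2 ^ card E * g E"
      using finite_subset[of E U] E fin by (simp add: card_Pow)
    also have "\<dots> = 2 ^ k * g E" using supp[of E] by (cases "g E = 0") auto
    finally show "(\<Sum>\<sigma>\<in>Pow U. if \<sigma> \<subseteq> E then g E else 0) = 2 ^ k * g E" .
  qed
  finally show ?thesis by (simp add: sum_distrib_left)
qed

text \<open>
  Each saturated set has degree in \<open>g\<close> at least \<open>\<tau>\<close> times the weight of the hyperedges that it
  removes, and a set of \<open>k\<close> elements contributes to the degrees of only \<open>2 ^ k\<close> sets. So as long as \<open>g\<close> is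
  light, few hyperedges are removed.
\<close>

lemma surviving_total:
  assumes fin: "finite U" and pos: "K \<ge> 0" "\<tau> > 0" and nn: "\<And>E. w E \<ge> 0"
    and gnn: "\<And>E. g E \<ge> 0" and gsupp: "\<And>E. g E \<noteq> 0 \<Longrightarrow> E \<subseteq> U \<and> card E = k"
    and spread: "\<And>\<sigma>. \<sigma> \<subseteq> U \<Longrightarrow> \<sigma> \<noteq> {} \<Longrightarrow> weighted_degree U w \<sigma> \<le> K / card U * \<tau> ^ (card \<sigma> - 1)"
  shows "sum w (Pow U) - 2 ^ k * sum g (Pow U) / \<tau> \<le> sum (surviving U K \<tau> w g) (Pow U)"
proof -
  let ?Sat = "{\<sigma> \<in> Pow U. saturated U K \<tau> g \<sigma>}"
  let ?Kill = "{E \<in> Pow U. \<exists>\<sigma>\<subseteq>E. saturated U K \<tau> g \<sigma>}"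
  have finSat: "finite ?Sat" using fin by simp
  have "sum w ?Kill \<le> sum w (\<Union>\<sigma>\<in>?Sat. {E. E \<subseteq> U \<and> \<sigma> \<subseteq> E})"
    by (rule sum_mono2) (use fin nn in auto)
  also have "\<dots> \<le> (\<Sum>\<sigma>\<in>?Sat. weighted_degree U w \<sigma>)"
    unfolding weighted_degree_def by (rule sum_UNION_le) (use fin finSat nn in auto)
  also have "\<dots> \<le> (\<Sum>\<sigma>\<in>?Sat. weighted_degree U g \<sigma> / \<tau>)"
  proof (rule sum_mono)
    fix \<sigma> assume "\<sigma> \<in> ?Sat"
    then have \<sigma>: "\<sigma> \<subseteq> U" "\<sigma> \<noteq> {}" "K / card U * \<tau> ^ card \<sigma> \<le> weighted_degree U g \<sigma>"
      by (auto simp: saturated_def)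
    then have "card \<sigma> > 0" using fin finite_subset by (metis card_gt_0_iff)
    then have "K / card U * \<tau> ^ (card \<sigma> - 1) = K / card U * \<tau> ^ card \<sigma> / \<tau>"
      using pos by (cases "card \<sigma>") auto
    also have "\<dots> \<le> weighted_degree U g \<sigma> / \<tau>"
      by (rule divide_right_mono) (use \<sigma> pos in auto)
    finally show "weighted_degree U w \<sigma> \<le> weighted_degree U g \<sigma> / \<tau>" using spread[OF \<sigma>(1,2)] by linarith
  qed
  also have "\<dots> \<le> (\<Sum>\<sigma>\<in>Pow U. weighted_degree U g \<sigma> / \<tau>)"
    by (rule sum_mono2) (use fin weighted_degree_nonneg[where w = g, OF gnn] pos in auto)
  also have "\<dots> = 2 ^ k * sum g (Pow U) / \<tau>"
    using sum_weighted_degree_subsets[OF fin gsupp] by (simp add: sum_divide_distrib[symmetric])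
  finally have kill: "sum w ?Kill \<le> 2 ^ k * sum g (Pow U) / \<tau>" .
  have "sum w (Pow U) = sum w (Pow U - ?Kill) + sum w ?Kill"
    by (rule sum.subset_diff) (use fin in auto)
  moreover have "sum (surviving U K \<tau> w g) (Pow U) = sum w (Pow U - ?Kill)"
    by (rule sum.mono_neutral_cong_right) (use fin in \<open>auto simp: surviving_def\<close>)
  ultimately show ?thesis using kill by linarith
qed

text \<open>
  The vertices of small degree account for at most \<open>1 / 4\<close> of the total weight. The others have degree
  at most \<open>K / card U\<close> and account for the rest, so there are at least \<open>card U / (4 * K)\<close> of them.
\<close>

lemma many_large_degrees:
  assumes fin: "finite U" "U \<noteq> {}" and K: "K > 0" and nn: "\<And>E. w E \<ge> 0"
    and supp: "w {} = 0" and total: "sum w (Pow U) \<ge> 1 / 2"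
    and deg: "\<And>v. v \<in> U \<Longrightarrow> weighted_degree U w {v} \<le> K / card U"
  shows "real (card {v \<in> U. weighted_degree U w {v} < 1 / (4 * card U)}) \<le> (1 - 1 / (4 * K)) * card U"
proof -
  let ?X = "{v \<in> U. weighted_degree U w {v} \<ge> 1 / (4 * card U)}"
  let ?Y = "{v \<in> U. weighted_degree U w {v} < 1 / (4 * card U)}"
  have u: "real (card U) > 0" using fin by (simp add: card_gt_0_iff)
  have "sum w (Pow U) \<le> sum w (\<Union>v\<in>U. {E. E \<subseteq> U \<and> {v} \<subseteq> E})"
  proof -
    have "sum w (Pow U) = sum w (\<Union>v\<in>U. {E. E \<subseteq> U \<and> {v} \<subseteq> E})"
    proof (rule sum.mono_neutral_right)
      show "\<forall>E\<in>Pow U - (\<Union>v\<in>U. {E. E \<subseteq> U \<and> {v} \<subseteq> E}). w E = 0"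
      proof
        fix E assume "E \<in> Pow U - (\<Union>v\<in>U. {E. E \<subseteq> U \<and> {v} \<subseteq> E})"
        then have "E = {}" by blast
        then show "w E = 0" using supp by simp
      qed
    qed (use fin in auto)
    then show ?thesis by simp
  qed
  also have "\<dots> \<le> (\<Sum>v\<in>U. weighted_degree U w {v})"
    unfolding weighted_degree_def by (rule sum_UNION_le) (use fin nn in auto)
  also have "\<dots> = (\<Sum>v\<in>?X. weighted_degree U w {v}) + (\<Sum>v\<in>?Y. weighted_degree U w {v})"
  proof -
    have "?X \<union> ?Y = U" "?X \<inter> ?Y = {}" by auto
    then show ?thesis using sum.union_disjoint[of ?X ?Y "\<lambda>v. weighted_degree U w {v}"] fin by simp
  qed
  also have "\<dots> \<le> (\<Sum>v\<in>?X. K / card U) + (\<Sum>v\<in>?Y. 1 / (4 * card U))"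
    by (intro add_mono sum_mono) (use deg in auto)
  also have "\<dots> \<le> card ?X * (K / card U) + card U * (1 / (4 * card U))"
  proof -
    have "real (card ?Y) * (1 / (4 * card U)) \<le> card U * (1 / (4 * card U))"
      by (intro mult_right_mono) (use fin in \<open>auto intro: card_mono\<close>)
    then show ?thesis by simp
  qed
  also have "card U * (1 / (4 * card U)) = 1 / 4" using u by simp
  finally have "1 / 4 \<le> card ?X * (K / card U)" using total by linarith
  then have X: "card U / (4 * K) \<le> card ?X" using K u by (simp add: field_simps)
  have "card U = card ?X + card ?Y"
  proof -
    have "?X \<union> ?Y = U" "?X \<inter> ?Y = {}" by auto
    then show ?thesis using card_Un_disjoint[of ?X ?Y] fin by simp
  qed
  then show ?thesis using X by (simp add: algebra_simps)
qed

lemma sum_powers_le: "(\<Sum>i\<le>s. u ^ i) \<le> (u + 1) ^ s" for u :: nat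
proof (induction s)
  case (Suc s)
  have "u * u ^ s \<le> u * (u + 1) ^ s" by (intro mult_left_mono power_mono) auto
  then have "(\<Sum>i\<le>s. u ^ i) + u * u ^ s \<le> (u + 1) ^ s + u * (u + 1) ^ s"
    using Suc by (rule add_mono[rotated])
  then show ?case by simp
qed simp

text \<open>
  As long as \<open>I\<close> has a vertex of large surviving degree, add it to the list. Every such step increases
  the total link weight by at least \<open>1 / (4 * card U)\<close>, so \<open>s\<close> steps suffice to make it heavy. In both
  outcomes the information about \<open>I\<close> is expressed by the list alone.
\<close>

lemma greedy_fingerprint:
  fixes K \<tau> :: real
  assumes fin: "finite U" "U \<noteq> {}" and I: "I \<subseteq> U" and s: "real s \<ge> \<tau> * card U"
  shows "\<exists>xs. set xs \<subseteq> I \<and> length xs \<le> s \<and>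
    (sum (link_weight U K \<tau> w xs) (Pow U) \<ge> \<tau> / 4 \<or>
     I \<subseteq> {v \<in> U. weighted_degree U (surviving U K \<tau> w (link_weight U K \<tau> w xs)) {v} < 1 / (4 * card U)})"
proof (rule ccontr)
  assume contr: "\<not> ?thesis"
  have u: "real (card U) > 0" using fin by (simp add: card_gt_0_iff)
  have "\<exists>xs. set xs \<subseteq> I \<and> length xs = j \<and> sum (link_weight U K \<tau> w xs) (Pow U) \<ge> j / (4 * card U)"
    if "j \<le> s" for j
    using that
  proof (induction j)
    case (Suc j)
    then obtain xs where xs: "set xs \<subseteq> I" "length xs = j"
      "sum (link_weight U K \<tau> w xs) (Pow U) \<ge> j / (4 * card U)" by auto
    let ?h = "surviving U K \<tau> w (link_weight U K \<tau> w xs)"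
    have "\<not> (set xs \<subseteq> I \<and> length xs \<le> s \<and> (sum (link_weight U K \<tau> w xs) (Pow U) \<ge> \<tau> / 4 \<or>
      I \<subseteq> {v \<in> U. weighted_degree U ?h {v} < 1 / (4 * card U)}))"
      using contr by blast
    then obtain v where v: "v \<in> I" "weighted_degree U ?h {v} \<ge> 1 / (4 * card U)"
      using xs Suc.prems I by fastforce
    have "sum (link_weight U K \<tau> w (v # xs)) (Pow U) =
          sum (link_weight U K \<tau> w xs) (Pow U) + weighted_degree U ?h {v}"
      using weighted_degree_link_weight_Cons[OF fin(1), of v K \<tau> w xs "{}"] v I
      by (auto simp: weighted_degree_empty simp del: link_weight.simps)
    then have "sum (link_weight U K \<tau> w (v # xs)) (Pow U) \<ge> Suc j / (4 * card U)"
      using xs v by (simp add: add_divide_distrib del: link_weight.simps)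
    then show ?case using xs v by (intro exI[of _ "v # xs"]) (auto simp del: link_weight.simps)
  qed (auto intro!: exI[of _ "[]"])
  then obtain xs where xs: "set xs \<subseteq> I" "length xs = s"
    "sum (link_weight U K \<tau> w xs) (Pow U) \<ge> s / (4 * card U)" by auto
  have "\<tau> / 4 \<le> s / (4 * card U)" using s u by (simp add: field_simps)
  then show False using xs contr by fastforce
qed

text \<open>
  Induction on the uniformity \<open>k\<close>. Given an independent set \<open>I\<close>, take the list from
  \<open>greedy_fingerprint\<close>. If the link weight is heavy, it can be rescaled to total weight 1 and is then
  \<open>(k - 1)\<close>-uniform and spread with \<open>2 ^ (k + 1) * K\<close> in place of \<open>K\<close>; since \<open>I\<close> is also independent
  for it, the induction hypothesis supplies the containers. If it is light, most of \<open>w\<close> survives, and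
  \<open>I\<close> lies in the set of vertices of small surviving degree, which misses a positive proportion of \<open>U\<close>.
  There are at most \<open>(card U + 1) ^ s\<close> lists.
\<close>

theorem container_family:
  fixes w :: "'v set \<Rightarrow> real" and K \<tau> :: real
  assumes "k \<ge> 1" and fin: "finite U" "U \<noteq> {}" and \<tau>: "\<tau> > 0" and s: "real s \<ge> \<tau> * card U"
    and "K > 0" "\<And>E. w E \<ge> 0" "\<And>E. w E \<noteq> 0 \<Longrightarrow> E \<subseteq> U \<and> card E = k" "sum w (Pow U) \<ge> 1"
    and "\<And>\<sigma>. \<sigma> \<subseteq> U \<Longrightarrow> \<sigma> \<noteq> {} \<Longrightarrow> weighted_degree U w \<sigma> \<le> K / card U * \<tau> ^ (card \<sigma> - 1)"
  shows "\<exists>\<C>. finite \<C> \<and> card \<C> \<le> (card U + 1) ^ (s * k) \<and>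
    (\<forall>C\<in>\<C>. C \<subseteq> U \<and> real (card C) \<le> (1 - 1 / (4 * 2 ^ (k * (k + 1)) * K)) * card U) \<and>
    (\<forall>I\<subseteq>U. (\<forall>E\<subseteq>I. w E = 0) \<longrightarrow> (\<exists>C\<in>\<C>. I \<subseteq> C))"
  using assms(1,6-)
proof (induction k arbitrary: w K rule: nat_induct_at_least)
  case base
  let ?C = "{v \<in> U. weighted_degree U w {v} < 1 / (4 * card U)}"
  have "real (card ?C) \<le> (1 - 1 / (4 * K)) * card U"
  proof (rule many_large_degrees[where w = w and K = K])
    show "w {} = 0" using base.prems(3)[of "{}"] by auto
    show "weighted_degree U w {v} \<le> K / card U" if "v \<in> U" for v using base.prems(5)[of "{v}"] that by simp
  qed (use fin base.prems in auto)
  also have "\<dots> \<le> (1 - 1 / (4 * 2 ^ (1 * (1 + 1)) * K)) * card U"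
    using base.prems(1) by (intro mult_right_mono) (auto simp: field_simps)
  finally have 1: "real (card ?C) \<le> (1 - 1 / (4 * 2 ^ (1 * (1 + 1)) * K)) * card U" .
  have 2: "I \<subseteq> ?C" if I: "I \<subseteq> U" "\<forall>E\<subseteq>I. w E = 0" for I
  proof
    fix v assume v: "v \<in> I"
    have "w E = 0" if "v \<in> E" for E
    proof (rule ccontr)
      assume "w E \<noteq> 0"
      then have "card E = 1" using base.prems(3) by blast
      then have "E = {v}" using that by (auto simp: card_1_singleton_iff)
      then show False using I v \<open>w E \<noteq> 0\<close> by auto
    qed
    then have "weighted_degree U w {v} = 0" by (auto simp: weighted_degree_def intro!: sum.neutral)
    then show "v \<in> ?C" using v I fin by (auto simp: card_gt_0_iff)
  qed
  show ?case by (rule exI[of _ "{?C}"]) (use 1 2 in auto)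
next
  case (Suc k)
  let ?G = "link_weight U K \<tau> w"
  let ?h = "\<lambda>xs. surviving U K \<tau> w (?G xs)"
  let ?thr = "\<tau> / 2 ^ Suc k"
  let ?\<L> = "{xs. set xs \<subseteq> U \<and> length xs \<le> s}"
  let ?small = "\<lambda>C. C \<subseteq> U \<and>
     real (card C) \<le> (1 - 1 / (4 * 2 ^ (Suc k * (Suc k + 1)) * K)) * card U"
  \<comment> \<open>As \<open>k \<ge> 1\<close>, a list with link weight at least \<open>\<tau> / 4\<close> is heavy enough for the induction hypothesis.\<close>
  have thr4: "?thr \<le> \<tau> / 4"
  proof -
    have "(2::real) ^ 2 \<le> 2 ^ Suc k" using Suc.hyps by (intro power_increasing) auto
    then show ?thesis using \<tau> by (intro divide_left_mono) auto
  qed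
  have ex: "\<exists>\<D>. finite \<D> \<and> card \<D> \<le> (card U + 1) ^ (s * k) \<and> (\<forall>C\<in>\<D>. ?small C) \<and>
     (\<forall>I\<subseteq>U. (\<forall>E\<subseteq>I. w E = 0) \<and> set xs \<subseteq> I \<and> (sum (?G xs) (Pow U) \<ge> \<tau> / 4 \<or>
          I \<subseteq> {v \<in> U. weighted_degree U (?h xs) {v} < 1 / (4 * card U)}) \<longrightarrow> (\<exists>C\<in>\<D>. I \<subseteq> C))"
    if xs: "xs \<in> ?\<L>" for xs
  proof (cases "sum (?G xs) (Pow U) \<ge> ?thr")
    case True
    let ?w = "\<lambda>E. 2 ^ Suc k / \<tau> * ?G xs E"
    have "\<exists>\<C>. finite \<C> \<and> card \<C> \<le> (card U + 1) ^ (s * k) \<and>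
      (\<forall>C\<in>\<C>. C \<subseteq> U \<and> real (card C) \<le> (1 - 1 / (4 * 2 ^ (k * (k + 1)) * (2 ^ (k + 2) * K))) * card U) \<and>
      (\<forall>I\<subseteq>U. (\<forall>E\<subseteq>I. ?w E = 0) \<longrightarrow> (\<exists>C\<in>\<C>. I \<subseteq> C))"
    proof (rule Suc.IH[where w = ?w and K = "2 ^ (k + 2) * K"])
      show "0 < 2 ^ (k + 2) * K" using Suc.prems by simp
      show "?w E \<ge> 0" for E
        using link_weight_nonneg[where w = w, OF Suc.prems(2)] \<tau> by simp
      show "E \<subseteq> U \<and> card E = k" if "?w E \<noteq> 0" for E
      proof (rule link_weight_uniform[where w = w, OF Suc.prems(3) fin(1)])
        show "?G xs E \<noteq> 0" using that by auto
      qed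
      show "sum ?w (Pow U) \<ge> 1"
      proof -
        have "1 = 2 ^ Suc k / \<tau> * ?thr" using \<tau> by simp
        also have "\<dots> \<le> 2 ^ Suc k / \<tau> * sum (?G xs) (Pow U)"
          by (rule mult_left_mono[OF True]) (use \<tau> in simp)
        also have "\<dots> = sum ?w (Pow U)" by (simp add: sum_distrib_left)
        finally show ?thesis .
      qed
      show "weighted_degree U ?w \<sigma> \<le> 2 ^ (k + 2) * K / card U * \<tau> ^ (card \<sigma> - 1)"
        if \<sigma>: "\<sigma> \<subseteq> U" "\<sigma> \<noteq> {}" for \<sigma>
      proof -
        have c: "card \<sigma> > 0"
          using \<sigma>(2) finite_subset[OF \<sigma>(1) fin(1)] by (simp add: card_gt_0_iff)
        have "weighted_degree U ?w \<sigma> = 2 ^ Suc k / \<tau> * weighted_degree U (?G xs) \<sigma>" by (rule weighted_degree_scale)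
        also have "\<dots> \<le> 2 ^ Suc k / \<tau> * (2 * K / card U * \<tau> ^ card \<sigma>)"
        proof (rule mult_left_mono)
          show "weighted_degree U (?G xs) \<sigma> \<le> 2 * K / card U * \<tau> ^ card \<sigma>"
            by (rule weighted_degree_link_weight_le[where w = w and K = K])
               (use fin Suc.prems \<tau> xs \<sigma> in auto)
        qed (use \<tau> in simp)
        also have "\<dots> = 2 ^ (k + 2) * K / card U * \<tau> ^ (card \<sigma> - 1)"
          using c \<tau> by (cases "card \<sigma>") (auto simp: field_simps)
        finally show ?thesis .
      qed
    qed
    then obtain \<C> where \<C>: "finite \<C>" "card \<C> \<le> (card U + 1) ^ (s * k)"
      "\<forall>C\<in>\<C>. C \<subseteq> U \<and> real (card C) \<le> (1 - 1 / (4 * 2 ^ (k * (k + 1)) * (2 ^ (k + 2) * K))) * card U"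
      "\<forall>I\<subseteq>U. (\<forall>E\<subseteq>I. ?w E = 0) \<longrightarrow> (\<exists>C\<in>\<C>. I \<subseteq> C)"
      by (elim exE conjE) (rule that; assumption)
    have "4 * 2 ^ (k * (k + 1)) * (2 ^ (k + 2) * K) \<le> 4 * 2 ^ (Suc k * (Suc k + 1)) * K"
    proof -
      have "(2::real) ^ (k * (k + 1)) * 2 ^ (k + 2) \<le> 2 ^ (Suc k * (Suc k + 1))"
        unfolding power_add[symmetric] by (intro power_increasing) auto
      then show ?thesis using Suc.prems(1) by simp
    qed
    then have le: "(1 - 1 / (4 * 2 ^ (k * (k + 1)) * (2 ^ (k + 2) * K))) * card U
        \<le> (1 - 1 / (4 * 2 ^ (Suc k * (Suc k + 1)) * K)) * card U"
      using Suc.prems(1) by (intro mult_right_mono diff_left_mono divide_left_mono) auto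
    show ?thesis
    proof (intro exI[of _ \<C>] conjI ballI allI impI)
      fix I
      assume I: "I \<subseteq> U" and "(\<forall>E\<subseteq>I. w E = 0) \<and> set xs \<subseteq> I \<and> (sum (?G xs) (Pow U) \<ge> \<tau> / 4 \<or>
          I \<subseteq> {v \<in> U. weighted_degree U (?h xs) {v} < 1 / (4 * card U)})"
      then have ind: "\<And>E. E \<subseteq> I \<Longrightarrow> w E = 0" and sub: "set xs \<subseteq> I" by simp_all
      show "\<exists>C\<in>\<C>. I \<subseteq> C"
      proof (rule \<C>(4)[rule_format, OF I])
        fix E assume "E \<subseteq> I"
        then have "?G xs E = 0"
          by (rule link_weight_independent[where w = w and I = I, rotated 2]) (fact sub, rule ind)
        then show "?w E = 0" by simp
      qed
    next
      fix C assume "C \<in> \<C>"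
      then have C: "C \<subseteq> U \<and> real (card C) \<le> (1 - 1 / (4 * 2 ^ (k * (k + 1)) * (2 ^ (k + 2) * K))) * card U"
        by (rule bspec[OF \<C>(3)])
      show "C \<subseteq> U" using C by (rule conjunct1)
      show "real (card C) \<le> (1 - 1 / (4 * 2 ^ (Suc k * (Suc k + 1)) * K)) * card U"
        using conjunct2[OF C] le by (rule order_trans)
    qed (fact \<C>)+
  next
    case False
    let ?C = "{v \<in> U. weighted_degree U (?h xs) {v} < 1 / (4 * card U)}"
    have "real (card ?C) \<le> (1 - 1 / (4 * K)) * card U"
    proof (rule many_large_degrees[where w = "?h xs" and K = K])
      show "?h xs E \<ge> 0" for E by (rule surviving_bounds) (rule Suc.prems)
      show "?h xs {} = 0" using Suc.prems(3)[of "{}"] by (auto simp: surviving_def)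
      show "weighted_degree U (?h xs) {v} \<le> K / card U" if "v \<in> U" for v
      proof -
        have "weighted_degree U (?h xs) {v} \<le> weighted_degree U w {v}"
          by (rule weighted_degree_mono) (rule surviving_bounds, rule Suc.prems)
        then show ?thesis using Suc.prems(5)[of "{v}"] that by simp
      qed
      have "2 ^ k * sum (?G xs) (Pow U) / \<tau> \<le> 1 / 2"
        using False \<tau> by (simp add: field_simps)
      moreover have "sum w (Pow U) - 2 ^ k * sum (?G xs) (Pow U) / \<tau> \<le> sum (?h xs) (Pow U)"
        by (rule surviving_total[where w = w and K = K])
           (use fin \<tau> Suc.prems link_weight_nonneg[where w = w, OF Suc.prems(2)]
             link_weight_uniform[where w = w, OF Suc.prems(3) fin(1)] in auto)
      ultimately show "sum (?h xs) (Pow U) \<ge> 1 / 2" using Suc.prems(4) by linarith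
    qed (use fin Suc.prems in auto)
    also have "\<dots> \<le> (1 - 1 / (4 * 2 ^ (Suc k * (Suc k + 1)) * K)) * card U"
    proof -
      have "1 * K \<le> 2 ^ (Suc k * (Suc k + 1)) * K"
        by (intro mult_right_mono one_le_power) (use Suc.prems(1) in auto)
      then show ?thesis
        using Suc.prems(1) by (intro mult_right_mono diff_left_mono divide_left_mono) auto
    qed
    finally have small: "real (card ?C) \<le> (1 - 1 / (4 * 2 ^ (Suc k * (Suc k + 1)) * K)) * card U" .
    have light: "\<not> \<tau> / 4 \<le> sum (?G xs) (Pow U)" using False thr4 by linarith
    show ?thesis
    proof (intro exI[of _ "{?C}"] conjI ballI allI impI)
      fix I
      assume "(\<forall>E\<subseteq>I. w E = 0) \<and> set xs \<subseteq> I \<and> (sum (?G xs) (Pow U) \<ge> \<tau> / 4 \<or> I \<subseteq> ?C)"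
      then have "I \<subseteq> ?C" using light by blast
      then show "\<exists>C\<in>{?C}. I \<subseteq> C" by blast
    next
      fix C assume "C \<in> {?C}"
      then have C: "C = ?C" by (rule singletonD)
      show "C \<subseteq> U" unfolding C by (rule Collect_restrict)
      show "real (card C) \<le> (1 - 1 / (4 * 2 ^ (Suc k * (Suc k + 1)) * K)) * card U"
        unfolding C by (rule small)
    qed simp_all
  qed
  obtain \<D> where "\<forall>xs\<in>?\<L>. finite (\<D> xs) \<and> card (\<D> xs) \<le> (card U + 1) ^ (s * k) \<and>
     (\<forall>C\<in>\<D> xs. ?small C) \<and>
     (\<forall>I\<subseteq>U. (\<forall>E\<subseteq>I. w E = 0) \<and> set xs \<subseteq> I \<and> (sum (?G xs) (Pow U) \<ge> \<tau> / 4 \<or>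
          I \<subseteq> {v \<in> U. weighted_degree U (?h xs) {v} < 1 / (4 * card U)}) \<longrightarrow> (\<exists>C\<in>\<D> xs. I \<subseteq> C))"
    by (rule exE[OF bchoice]) (rule ballI, rule ex, assumption)
  note \<D> = bspec[OF this]
  have fL: "finite ?\<L>" using fin by (rule_tac finite_lists_length_le)
  let ?\<C> = "\<Union>xs\<in>?\<L>. \<D> xs"
  have "card ?\<C> \<le> (\<Sum>xs\<in>?\<L>. card (\<D> xs))" by (rule card_UN_le[OF fL])
  also have "\<dots> \<le> (\<Sum>xs\<in>?\<L>. (card U + 1) ^ (s * k))"
    by (rule sum_mono) (rule conjunct1[OF conjunct2[OF \<D>]])
  also have "\<dots> = (\<Sum>i\<le>s. card U ^ i) * (card U + 1) ^ (s * k)"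
    using card_lists_length_le[OF fin(1)] by simp
  also have "\<dots> \<le> (card U + 1) ^ s * (card U + 1) ^ (s * k)"
    by (rule mult_right_mono[OF sum_powers_le]) simp
  also have "\<dots> = (card U + 1) ^ (s * Suc k)" by (simp add: power_add[symmetric])
  finally have card: "card ?\<C> \<le> (card U + 1) ^ (s * Suc k)" .
  have cover: "\<exists>C\<in>?\<C>. I \<subseteq> C" if I: "I \<subseteq> U" "\<forall>E\<subseteq>I. w E = 0" for I
  proof -
    obtain xs where xs: "set xs \<subseteq> I" "length xs \<le> s" "sum (?G xs) (Pow U) \<ge> \<tau> / 4 \<or>
          I \<subseteq> {v \<in> U. weighted_degree U (?h xs) {v} < 1 / (4 * card U)}"
      using greedy_fingerprint[OF fin I(1) s, of K w]
      by (elim exE conjE) (rule that; assumption)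
    have mem: "xs \<in> ?\<L>" using order_trans[OF xs(1) I(1)] xs(2) by (rule_tac CollectI conjI)+
    have "\<exists>C\<in>\<D> xs. I \<subseteq> C"
      by (rule mp[OF mp[OF spec[OF conjunct2[OF conjunct2[OF conjunct2[OF \<D>[OF mem]]]]] I(1)]])
         (intro conjI I(2) xs(1) xs(3))
    then obtain C where "C \<in> \<D> xs" "I \<subseteq> C" by (rule bexE)
    then show ?thesis using mem by (intro bexI[of _ C] UN_I)
  qed
  show ?case
  proof (intro exI[of _ ?\<C>] conjI)
    show "finite ?\<C>" by (rule finite_UN_I[OF fL]) (rule conjunct1[OF \<D>])
    show "\<forall>C\<in>?\<C>. ?small C"
    proof
      fix C assume "C \<in> ?\<C>"
      then obtain xs where "xs \<in> ?\<L>" "C \<in> \<D> xs" by (rule UN_E)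
      then show "?small C"
        by (rule bspec[OF conjunct1[OF conjunct2[OF conjunct2[OF \<D>]]]])
    qed
    show "card ?\<C> \<le> (card U + 1) ^ (s * Suc k)" by (rule card)
    show "\<forall>I\<subseteq>U. (\<forall>E\<subseteq>I. w E = 0) \<longrightarrow> (\<exists>C\<in>?\<C>. I \<subseteq> C)"
      by (intro allI impI) (rule cover)
  qed
qed

lemma iterate_containers:
  fixes Ind :: "'v set set" and \<rho> M :: real
  assumes fin: "finite V" and \<rho>: "0 \<le> \<rho>" and Q: "Q \<ge> 1"
    and step: "\<And>U. U \<subseteq> V \<Longrightarrow> real (card U) > M \<Longrightarrow>
      \<exists>\<C>. finite \<C> \<and> card \<C> \<le> Q \<and> (\<forall>C\<in>\<C>. C \<subseteq> U \<and> real (card C) \<le> \<rho> * card U) \<and>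
          (\<forall>I\<in>Ind. I \<subseteq> U \<longrightarrow> (\<exists>C\<in>\<C>. I \<subseteq> C))"
  shows "\<exists>\<C>. finite \<C> \<and> card \<C> \<le> Q ^ J \<and>
      (\<forall>C\<in>\<C>. C \<subseteq> V \<and> real (card C) \<le> max M (\<rho> ^ J * card V)) \<and>
      (\<forall>I\<in>Ind. I \<subseteq> V \<longrightarrow> (\<exists>C\<in>\<C>. I \<subseteq> C))"
proof (induction J)
  case 0
  show ?case by (rule exI[of _ "{V}"]) auto
next
  case (Suc J)
  then obtain \<C> where \<C>': "finite \<C>" "card \<C> \<le> Q ^ J"
    "\<forall>C\<in>\<C>. C \<subseteq> V \<and> real (card C) \<le> max M (\<rho> ^ J * card V)"
    "\<forall>I\<in>Ind. I \<subseteq> V \<longrightarrow> (\<exists>C\<in>\<C>. I \<subseteq> C)"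
    by (elim exE conjE) (rule that; assumption)
  note \<C> = \<C>'(1,2) bspec[OF \<C>'(3)] bspec[OF \<C>'(4), rule_format]
  have ex: "\<exists>\<D>. finite \<D> \<and> card \<D> \<le> Q \<and>
      (\<forall>D\<in>\<D>. D \<subseteq> V \<and> real (card D) \<le> max M (\<rho> ^ Suc J * card V)) \<and>
      (\<forall>I\<in>Ind. I \<subseteq> U \<longrightarrow> (\<exists>D\<in>\<D>. I \<subseteq> D))" if U: "U \<in> \<C>" for U
  proof (cases "real (card U) > M")
    case True
    have UV: "U \<subseteq> V" and Ucard: "real (card U) \<le> \<rho> ^ J * card V"
      using \<C>(3)[OF U] True by auto
    obtain \<D> where \<D>: "finite \<D>" "card \<D> \<le> Q"
      "\<forall>D\<in>\<D>. D \<subseteq> U \<and> real (card D) \<le> \<rho> * card U"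
      "\<forall>I\<in>Ind. I \<subseteq> U \<longrightarrow> (\<exists>D\<in>\<D>. I \<subseteq> D)"
      using step[OF UV True] by (elim exE conjE) (rule that; assumption)
    have "D \<subseteq> V \<and> real (card D) \<le> max M (\<rho> ^ Suc J * card V)" if "D \<in> \<D>" for D
    proof -
      have "real (card D) \<le> \<rho> * card U" using \<D>(3) that by blast
      also have "\<dots> \<le> \<rho> * (\<rho> ^ J * card V)" by (rule mult_left_mono[OF Ucard \<rho>])
      finally show ?thesis using \<D>(3) that UV by (auto simp: mult.assoc)
    qed
    then show ?thesis using \<D>(1,2,4) by blast
  next
    case False
    show ?thesis by (rule exI[of _ "{U}"]) (use False Q \<C>(3)[OF U] in auto)
  qed
  obtain \<D> where "\<forall>U\<in>\<C>. finite (\<D> U) \<and> card (\<D> U) \<le> Q \<and>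
      (\<forall>D\<in>\<D> U. D \<subseteq> V \<and> real (card D) \<le> max M (\<rho> ^ Suc J * card V)) \<and>
      (\<forall>I\<in>Ind. I \<subseteq> U \<longrightarrow> (\<exists>D\<in>\<D> U. I \<subseteq> D))"
    by (rule exE[OF bchoice]) (rule ballI, rule ex, assumption)
  note \<D> = bspec[OF this]
  have "card (\<Union>U\<in>\<C>. \<D> U) \<le> (\<Sum>U\<in>\<C>. card (\<D> U))" by (rule card_UN_le[OF \<C>(1)])
  also have "\<dots> \<le> (\<Sum>U\<in>\<C>. Q)" by (rule sum_mono) (rule conjunct1[OF conjunct2[OF \<D>]])
  also have "\<dots> \<le> Q ^ Suc J" using \<C>(2) by simp
  finally have card: "card (\<Union>U\<in>\<C>. \<D> U) \<le> Q ^ Suc J" .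
  show ?case
  proof (intro exI[of _ "\<Union>U\<in>\<C>. \<D> U"] conjI)
    show "finite (\<Union>U\<in>\<C>. \<D> U)" by (rule finite_UN_I[OF \<C>(1)]) (rule conjunct1[OF \<D>])
    show "\<forall>C\<in>\<Union>U\<in>\<C>. \<D> U. C \<subseteq> V \<and> real (card C) \<le> max M (\<rho> ^ Suc J * card V)"
    proof
      fix C assume "C \<in> (\<Union>U\<in>\<C>. \<D> U)"
      then obtain U where "U \<in> \<C>" "C \<in> \<D> U" by (rule UN_E)
      then show "C \<subseteq> V \<and> real (card C) \<le> max M (\<rho> ^ Suc J * card V)"
        by (rule bspec[OF conjunct1[OF conjunct2[OF conjunct2[OF \<D>]]]])
    qed
    show "\<forall>I\<in>Ind. I \<subseteq> V \<longrightarrow> (\<exists>C\<in>\<Union>U\<in>\<C>. \<D> U. I \<subseteq> C)"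
    proof (intro ballI impI)
      fix I assume I: "I \<in> Ind" "I \<subseteq> V"
      then obtain U where U: "U \<in> \<C>" "I \<subseteq> U" using \<C>(4) by blast
      have "\<exists>D\<in>\<D> U. I \<subseteq> D"
        by (rule mp[OF bspec[OF conjunct2[OF conjunct2[OF conjunct2[OF \<D>[OF U(1)]]]] I(1)] U(2)])
      then show "\<exists>C\<in>\<Union>U\<in>\<C>. \<D> U. I \<subseteq> C" using U(1) by blast
    qed
  qed (rule card)
qed

section \<open>Weighted embeddings of a star with attached vertices\<close>

lemma card_PiE_fixed_le:
  assumes "finite I" "J \<subseteq> I" "\<And>i. i \<in> I \<Longrightarrow> finite (R i)"
  shows "card {g \<in> PiE I R. \<forall>i\<in>J. g i = \<psi> i} \<le> (\<Prod>i\<in>I - J. card (R i))"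
proof -
  let ?X = "{g \<in> PiE I R. \<forall>i\<in>J. g i = \<psi> i}"
  have inj: "inj_on (\<lambda>g. restrict g (I - J)) ?X"
  proof (rule inj_onI)
    fix g h assume g: "g \<in> ?X" and h: "h \<in> ?X"
      and eq: "restrict g (I - J) = restrict h (I - J)"
    show "g = h"
    proof
      fix i
      consider "i \<in> J" | "i \<in> I - J" | "i \<notin> I" by blast
      then show "g i = h i"
      proof cases
        case 2
        then show ?thesis using fun_cong[OF eq, of i] by simp
      next
        case 3
        then show ?thesis using g h by (auto simp: PiE_def extensional_def)
      qed (use g h in auto)
    qed
  qed
  have img: "(\<lambda>g. restrict g (I - J)) ` ?X \<subseteq> PiE (I - J) R" by auto
  have "finite (PiE (I - J) R)" using assms by (intro finite_PiE) auto
  then have "card ?X \<le> card (PiE (I - J) R)" by (rule card_inj_on_le[OF inj img])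
  also have "\<dots> = (\<Prod>i\<in>I - J. card (R i))" using assms by (intro card_PiE) auto
  finally show ?thesis .
qed

lemma card_PiE_determined_le:
  assumes "finite I" "v \<in> I" "\<And>i. i \<in> I \<Longrightarrow> finite (R i)"
  shows "card {g \<in> PiE I R. g v = h (restrict g (I - {v}))} \<le> (\<Prod>i\<in>I - {v}. card (R i))"
proof -
  let ?X = "{g \<in> PiE I R. g v = h (restrict g (I - {v}))}"
  have inj: "inj_on (\<lambda>g. restrict g (I - {v})) ?X"
  proof (rule inj_onI)
    fix g g' assume g: "g \<in> ?X" and g': "g' \<in> ?X"
      and eq: "restrict g (I - {v}) = restrict g' (I - {v})"
    show "g = g'"
    proof
      fix i
      consider "i = v" | "i \<in> I - {v}" | "i \<notin> I" using assms(2) by blast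
      then show "g i = g' i"
      proof cases
        case 1
        then show ?thesis using g g' eq by simp
      next
        case 2
        then show ?thesis using fun_cong[OF eq, of i] by simp
      next
        case 3
        then show ?thesis using g g' by (auto simp: PiE_def extensional_def)
      qed
    qed
  qed
  have img: "(\<lambda>g. restrict g (I - {v})) ` ?X \<subseteq> PiE (I - {v}) R"
    by (auto dest: PiE_mem split: if_splits)
  have "finite (PiE (I - {v}) R)" using assms by (intro finite_PiE) auto
  then have "card ?X \<le> card (PiE (I - {v}) R)" by (rule card_inj_on_le[OF inj img])
  also have "\<dots> = (\<Prod>i\<in>I - {v}. card (R i))" using assms by (intro card_PiE) auto
  finally show ?thesis .
qed

text \<open>
  Each coincidence \<open>g v = g u\<close> or \<open>g v = x\<close> determines the value at \<open>v\<close> from the other ones and so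
  costs a factor \<open>card (R v)\<close>; there are at most \<open>card X + card I\<close> coincidences at each \<open>v\<close>.
\<close>

lemma card_PiE_noninjective_le:
  fixes q :: real
  assumes fin: "finite I" "finite X" "\<And>i. i \<in> I \<Longrightarrow> finite (R i)" and q: "q > 0"
    and large: "\<And>i. i \<in> I \<Longrightarrow> real (card (R i)) \<ge> q * card I * (card X + card I)"
  shows "real (card {g \<in> PiE I R. \<not> (inj_on g I \<and> g ` I \<inter> X = {})}) \<le> (\<Prod>i\<in>I. card (R i)) / q"
proof (cases "I = {}")
  case True
  then have none: "{g \<in> PiE I R. \<not> (inj_on g I \<and> g ` I \<inter> X = {})} = {}" by auto
  show ?thesis unfolding none using q by (simp add: prod_nonneg)
next
  case False
  let ?hit = "\<lambda>v x. {g \<in> PiE I R. g v = x}"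
  let ?same = "\<lambda>v u. {g \<in> PiE I R. g v = g u}"
  let ?P = "\<lambda>v. \<Prod>i\<in>I - {v}. card (R i)"
  have fPi: "finite (PiE I R)" using fin by (intro finite_PiE) auto
  have hit: "card (?hit v x) \<le> ?P v" if "v \<in> I" for v x
    using card_PiE_determined_le[of I v R "\<lambda>_. x"] fin that by simp
  have same: "card (?same v u) \<le> ?P v" if "v \<in> I" "u \<in> I - {v}" for v u
  proof -
    have "?same v u = {g \<in> PiE I R. g v = restrict g (I - {v}) u}" using that by auto
    then show ?thesis using card_PiE_determined_le[of I v R "\<lambda>g. g u"] fin that by simp
  qed
  have I0: "card I > 0" using False fin by (simp add: card_gt_0_iff)
  have "card {g \<in> PiE I R. \<not> (inj_on g I \<and> g ` I \<inter> X = {})} \<le>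
        card (\<Union>v\<in>I. (\<Union>x\<in>X. ?hit v x) \<union> (\<Union>u\<in>I - {v}. ?same v u))"
    by (rule card_mono) (use fin fPi in \<open>auto simp: inj_on_def\<close>)
  also have "\<dots> \<le> (\<Sum>v\<in>I. card ((\<Union>x\<in>X. ?hit v x) \<union> (\<Union>u\<in>I - {v}. ?same v u)))"
    by (rule card_UN_le) (use fin in auto)
  also have "\<dots> \<le> (\<Sum>v\<in>I. (card X + card I) * ?P v)"
  proof (rule sum_mono)
    fix v assume v: "v \<in> I"
    have "card ((\<Union>x\<in>X. ?hit v x) \<union> (\<Union>u\<in>I - {v}. ?same v u))
        \<le> card (\<Union>x\<in>X. ?hit v x) + card (\<Union>u\<in>I - {v}. ?same v u)" by (rule card_Un_le)
    also have "\<dots> \<le> (\<Sum>x\<in>X. card (?hit v x)) + (\<Sum>u\<in>I - {v}. card (?same v u))"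
      by (intro add_mono card_UN_le) (use fin in auto)
    also have "\<dots> \<le> (\<Sum>x\<in>X. ?P v) + (\<Sum>u\<in>I - {v}. ?P v)"
      by (intro add_mono sum_mono) (use hit same v in auto)
    also have "\<dots> = (card X + card (I - {v})) * ?P v" by (simp add: algebra_simps)
    also have "\<dots> \<le> (card X + card I) * ?P v"
      by (intro mult_right_mono add_left_mono card_mono) (use fin in auto)
    finally show "card ((\<Union>x\<in>X. ?hit v x) \<union> (\<Union>u\<in>I - {v}. ?same v u)) \<le> (card X + card I) * ?P v" .
  qed
  finally have "real (card {g \<in> PiE I R. \<not> (inj_on g I \<and> g ` I \<inter> X = {})})
      \<le> real (\<Sum>v\<in>I. (card X + card I) * ?P v)" by (rule of_nat_mono)
  also have "\<dots> = (\<Sum>v\<in>I. real (card X + card I) * ?P v)" by simp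
  also have "\<dots> \<le> (\<Sum>v\<in>I. (\<Prod>i\<in>I. card (R i)) / (q * card I))"
  proof (rule sum_mono)
    fix v assume v: "v \<in> I"
    have "(\<Prod>i\<in>I. card (R i)) = card (R v) * ?P v"
      using fin v by (simp add: prod.remove)
    then have "real (\<Prod>i\<in>I. card (R i)) = real (card (R v)) * ?P v" by simp
    also have "\<dots> \<ge> (q * card I * (card X + card I)) * ?P v"
      by (rule mult_right_mono[OF large[OF v]]) (rule of_nat_0_le_iff)
    finally have "(q * card I) * (real (card X + card I) * ?P v) \<le> real (\<Prod>i\<in>I. card (R i))"
      by (simp add: algebra_simps)
    then show "real (card X + card I) * ?P v \<le> (\<Prod>i\<in>I. card (R i)) / (q * card I)"
      using q I0 by (simp add: field_simps)
  qed
  also have "\<dots> = (\<Prod>i\<in>I. card (R i)) / q" using I0 by (simp add: field_simps)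
  finally show ?thesis .
qed

text \<open>
  The centre of a star is mapped to a vertex \<open>b \<in> B\<close>, its leaves \<open>S\<close> to elements of \<open>N b\<close>, and every
  further vertex \<open>v \<in> T\<close>, which is joined to the leaves \<open>Nb v\<close>, to a vertex of \<open>B\<close> whose neighbourhood
  contains their images. Injectivity is imposed only at the end, so that all choices are independent and
  masses are products. The thresholds \<open>\<theta>\<close> bound the number of options for each \<open>v\<close> from below.
\<close>

locale star_embeddings =
  fixes S T :: "'a set" and Nb :: "'a \<Rightarrow> 'a set"
    and A B :: "'v set" and N :: "'v \<Rightarrow> 'v set" and D :: nat and \<theta> :: "'a \<Rightarrow> real"
  assumes finS: "finite S" and finT: "finite T" and Nb: "\<And>v. v \<in> T \<Longrightarrow> Nb v \<subseteq> S"
    and finA: "finite A" and finB: "finite B"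
    and NA: "\<And>b. b \<in> B \<Longrightarrow> N b \<subseteq> A" and cardN: "\<And>b. b \<in> B \<Longrightarrow> card (N b) = D"
    and \<theta>: "\<And>v. v \<in> T \<Longrightarrow> \<theta> v > 0"
begin

definition links :: "'v set \<Rightarrow> 'v set" where
  "links X = {b \<in> B. X \<subseteq> N b}"

definition rich :: "('a \<Rightarrow> 'v) \<Rightarrow> bool" where
  "rich f \<longleftrightarrow> (\<forall>v\<in>T. \<theta> v \<le> card (links (f ` Nb v)))"

definition mates :: "('a \<Rightarrow> 'v) \<Rightarrow> ('a \<Rightarrow> 'v) set" where
  "mates f = PiE T (\<lambda>v. links (f ` Nb v))"

text \<open>
  The probability of any particular choice of mates if they are chosen uniformly.
\<close>

definition weight :: "('a \<Rightarrow> 'v) \<Rightarrow> real" where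
  "weight f = (\<Prod>v\<in>T. 1 / card (links (f ` Nb v)))"

definition stars :: "('v \<times> ('a \<Rightarrow> 'v)) set" where
  "stars = (SIGMA b:B. S \<rightarrow>\<^sub>E N b)"

definition embeddings :: "('v \<times> ('a \<Rightarrow> 'v) \<times> ('a \<Rightarrow> 'v)) set" where
  "embeddings = {(b, f, g). (b, f) \<in> stars \<and> rich f \<and> g \<in> mates f}"

lemma finN: "b \<in> B \<Longrightarrow> finite (N b)" using NA finA finite_subset by metis

lemma fin_links: "finite (links X)" using finB by (simp add: links_def)

lemma fin_stars: "finite stars"
  unfolding stars_def using finB finS finN by (intro finite_SigmaI finite_PiE) auto

lemma fin_mates: "finite (mates f)"
  unfolding mates_def using finT fin_links by (intro finite_PiE) auto

lemma card_stars: "card stars = card B * D ^ card S"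
proof -
  have "card stars = (\<Sum>b\<in>B. card (S \<rightarrow>\<^sub>E N b))"
    unfolding stars_def using finB finS finN by (intro card_SigmaI) (auto intro!: finite_PiE)
  also have "\<dots> = (\<Sum>b\<in>B. D ^ card S)"
    using finS cardN by (intro sum.cong refl) (simp add: card_PiE)
  finally show ?thesis by simp
qed

lemma rich_links_pos: "rich f \<Longrightarrow> v \<in> T \<Longrightarrow> card (links (f ` Nb v)) > 0"
  using \<theta>[of v] unfolding rich_def by fastforce

lemma weight_nonneg: "weight f \<ge> 0"
  unfolding weight_def by (rule prod_nonneg) auto

lemma fin_embeddings: "finite embeddings"
proof -
  have "embeddings \<subseteq> (\<lambda>((b, f), g). (b, f, g)) ` (SIGMA x:stars. mates (snd x)) "
    by (force simp: embeddings_def)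
  then show ?thesis
    by (rule finite_subset) (intro finite_imageI finite_SigmaI fin_stars fin_mates)
qed

lemma card_fixed_leaves_le:
  assumes "b \<in> B" "J \<subseteq> S"
  shows "card {f \<in> S \<rightarrow>\<^sub>E N b. \<forall>s\<in>J. f s = \<psi> s} \<le> D ^ card (S - J)"
  using card_PiE_fixed_le[of S J "\<lambda>_. N b" \<psi>] finS finN assms cardN by simp

lemma card_stars_restricted_le:
  assumes W: "W \<subseteq> S" and J: "J \<subseteq> S"
  shows "card {(b, f) \<in> stars. restrict f W = f1 \<and> (\<forall>s\<in>J. f s = \<psi> s)}
         \<le> card (links (f1 ` W)) * D ^ card (S - W - J)"
proof -
  let ?\<chi> = "\<lambda>s. if s \<in> W then f1 s else \<psi> s"
  have "{(b, f) \<in> stars. restrict f W = f1 \<and> (\<forall>s\<in>J. f s = \<psi> s)} \<subseteq>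
        (SIGMA b:links (f1 ` W). {f \<in> S \<rightarrow>\<^sub>E N b. \<forall>s\<in>W \<union> J. f s = ?\<chi> s})" (is "?L \<subseteq> ?R")
  proof
    fix x assume "x \<in> ?L"
    then obtain b f where x: "x = (b, f)" and b: "b \<in> B" and f: "f \<in> S \<rightarrow>\<^sub>E N b"
      and f1: "f1 = restrict f W" and \<psi>: "\<forall>s\<in>J. f s = \<psi> s"
      by (auto simp: stars_def)
    have "f1 ` W \<subseteq> N b" using f f1 W by auto
    then show "x \<in> ?R" using x b f f1 \<psi> by (auto simp: links_def)
  qed
  moreover have finE: "finite {f \<in> S \<rightarrow>\<^sub>E N b. \<forall>s\<in>W \<union> J. f s = ?\<chi> s}" if "b \<in> B" for b
    by (rule finite_subset[of _ "S \<rightarrow>\<^sub>E N b"]) (use finS finN[OF that] in \<open>auto intro: finite_PiE\<close>)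
  moreover have fR: "finite ?R"
    by (intro finite_SigmaI fin_links finE) (auto simp: links_def)
  ultimately have "card ?L \<le> card ?R" by (intro card_mono) auto
  also have "\<dots> = (\<Sum>b\<in>links (f1 ` W). card {f \<in> S \<rightarrow>\<^sub>E N b. \<forall>s\<in>W \<union> J. f s = ?\<chi> s})"
    by (rule card_SigmaI[OF fin_links]) (use finE in \<open>auto simp: links_def\<close>)
  also have "\<dots> \<le> (\<Sum>b\<in>links (f1 ` W). D ^ card (S - (W \<union> J)))"
    by (intro sum_mono card_fixed_leaves_le) (use W J in \<open>auto simp: links_def\<close>)
  finally show ?thesis by (simp add: Diff_Un[symmetric] Diff_eq Int_assoc)
qed

text \<open>
  The mates are independent: a prescribed one contributes its probability, a free one contributes 1.
\<close>

lemma mates_mass_le: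
  assumes rich: "rich f" and J: "J \<subseteq> T"
  shows "(\<Sum>g | g \<in> mates f \<and> (\<forall>v\<in>J. g v = \<psi> v). weight f)
     \<le> (\<Prod>v\<in>J. (if \<psi> v \<in> links (f ` Nb v) then 1 / card (links (f ` Nb v)) else 0))"
proof (cases "\<forall>v\<in>J. \<psi> v \<in> links (f ` Nb v)")
  case True
  let ?c = "\<lambda>v. real (card (links (f ` Nb v)))"
  have finJ: "finite J" using J finT finite_subset by blast
  have "real (card {g \<in> mates f. \<forall>v\<in>J. g v = \<psi> v}) \<le> real (\<Prod>v\<in>T - J. card (links (f ` Nb v)))"
    unfolding mates_def by (intro of_nat_mono card_PiE_fixed_le finT J fin_links)
  then have "(\<Sum>g | g \<in> mates f \<and> (\<forall>v\<in>J. g v = \<psi> v). weight f) \<le> (\<Prod>v\<in>T - J. ?c v) * weight f"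
    using weight_nonneg[of f] by (simp add: mult_right_mono)
  also have "(\<Prod>v\<in>T - J. ?c v) * weight f =
      (\<Prod>v\<in>T - J. ?c v * (1 / ?c v)) * (\<Prod>v\<in>J. 1 / ?c v)"
    unfolding weight_def prod.subset_diff[OF J finT] by (simp only: prod.distrib mult.assoc)
  also have "(\<Prod>v\<in>T - J. ?c v * (1 / ?c v)) = 1"
    by (rule prod.neutral) (use rich_links_pos[OF rich] in auto)
  finally show ?thesis using True by simp
next
  case False
  then obtain v where v: "v \<in> J" "\<psi> v \<notin> links (f ` Nb v)" by blast
  have none: "{g. g \<in> mates f \<and> (\<forall>v\<in>J. g v = \<psi> v)} = {}"
    using v J by (force simp: mates_def PiE_def Pi_def)
  show ?thesis unfolding none by (simp add: prod_nonneg)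
qed

lemma embeddings_mass_Sigma:
  "(\<Sum>(b, f, g) | (b, f, g) \<in> embeddings \<and> P b f \<and> Q b f g. weight f) =
   (\<Sum>(b, f) | (b, f) \<in> stars \<and> rich f \<and> P b f. \<Sum>g | g \<in> mates f \<and> Q b f g. weight f)"
proof -
  let ?X = "{(b, f). (b, f) \<in> stars \<and> rich f \<and> P b f}"
  let ?Y = "\<lambda>x. {g \<in> mates (snd x). Q (fst x) (snd x) g}"
  have finX: "finite ?X" by (rule finite_subset[OF _ fin_stars]) auto
  have "(\<Sum>x\<in>?X. \<Sum>g\<in>?Y x. weight (snd x)) = (\<Sum>(x, g)\<in>Sigma ?X ?Y. weight (snd x))"
    by (rule sum.Sigma[OF finX]) (simp add: fin_mates)
  also have "\<dots> = (\<Sum>(b, f, g) | (b, f, g) \<in> embeddings \<and> P b f \<and> Q b f g. weight f)"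
    by (rule sum.reindex_bij_witness[where i = "\<lambda>(b, f, g). ((b, f), g)" and j = "\<lambda>((b, f), g). (b, f, g)"])
       (auto simp: embeddings_def)
  finally show ?thesis by (simp add: case_prod_unfold)
qed

lemma mass_fixed_centre_le:
  assumes JS: "JS \<subseteq> S" and JT: "JT \<subseteq> T"
  shows "(\<Sum>(b, f, g) | (b, f, g) \<in> embeddings \<and> (b = b0 \<and> (\<forall>s\<in>JS. f s = \<psi> s)) \<and> (\<forall>v\<in>JT. g v = \<psi> v). weight f)
     \<le> D ^ card (S - JS) * (\<Prod>v\<in>JT. 1 / \<theta> v)"
proof -
  let ?X = "{(b, f). (b, f) \<in> stars \<and> rich f \<and> (b = b0 \<and> (\<forall>s\<in>JS. f s = \<psi> s))}"
  have pos: "(\<Prod>v\<in>JT. 1 / \<theta> v) \<ge> 0" using JT \<theta> by (intro prod_nonneg) (auto simp: less_imp_le)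
  have "(\<Sum>(b, f, g) | (b, f, g) \<in> embeddings \<and> (b = b0 \<and> (\<forall>s\<in>JS. f s = \<psi> s)) \<and> (\<forall>v\<in>JT. g v = \<psi> v). weight f)
     = (\<Sum>(b, f)\<in>?X. \<Sum>g | g \<in> mates f \<and> (\<forall>v\<in>JT. g v = \<psi> v). weight f)"
    by (rule embeddings_mass_Sigma)
  also have "\<dots> \<le> (\<Sum>x\<in>?X. \<Prod>v\<in>JT. 1 / \<theta> v)"
  proof (rule sum_mono, clarify)
    fix b f assume f: "rich f"
    have "(\<Sum>g | g \<in> mates f \<and> (\<forall>v\<in>JT. g v = \<psi> v). weight f)
       \<le> (\<Prod>v\<in>JT. (if \<psi> v \<in> links (f ` Nb v) then 1 / card (links (f ` Nb v)) else 0))"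
      by (rule mates_mass_le[OF f JT])
    also have "\<dots> \<le> (\<Prod>v\<in>JT. 1 / \<theta> v)"
    proof (rule prod_mono)
      fix v assume "v \<in> JT"
      then have "v \<in> T" "\<theta> v > 0" "\<theta> v \<le> card (links (f ` Nb v))"
        using JT \<theta> f by (auto simp: rich_def)
      then show "0 \<le> (if \<psi> v \<in> links (f ` Nb v) then 1 / card (links (f ` Nb v)) else 0) \<and>
         (if \<psi> v \<in> links (f ` Nb v) then 1 / card (links (f ` Nb v)) else 0) \<le> 1 / \<theta> v"
        by (auto intro!: divide_left_mono simp: less_imp_le)
    qed
    finally show "(\<Sum>g | g \<in> mates f \<and> (\<forall>v\<in>JT. g v = \<psi> v). weight f) \<le> (\<Prod>v\<in>JT. 1 / \<theta> v)" .
  qed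
  also have "\<dots> = card ?X * (\<Prod>v\<in>JT. 1 / \<theta> v)" by simp
  also have "\<dots> \<le> D ^ card (S - JS) * (\<Prod>v\<in>JT. 1 / \<theta> v)"
  proof (rule mult_right_mono[OF _ pos])
    have "card ?X \<le> D ^ card (S - JS)"
    proof (cases "b0 \<in> B")
      case True
      have "?X \<subseteq> Pair b0 ` {f \<in> S \<rightarrow>\<^sub>E N b0. \<forall>s\<in>JS. f s = \<psi> s}" by (auto simp: stars_def)
      moreover have "finite {f \<in> S \<rightarrow>\<^sub>E N b0. \<forall>s\<in>JS. f s = \<psi> s}"
        using finS finN[OF True] by (auto intro!: finite_PiE)
      ultimately have "card ?X \<le> card {f \<in> S \<rightarrow>\<^sub>E N b0. \<forall>s\<in>JS. f s = \<psi> s}"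
        by (rule surj_card_le[rotated])
      then show ?thesis using card_fixed_leaves_le[OF True JS, of \<psi>] by linarith
    next
      case False
      then have none: "?X = {}" by (auto simp: stars_def)
      show ?thesis unfolding none by simp
    qed
    then show "real (card ?X) \<le> D ^ card (S - JS)"
      unfolding of_nat_power[symmetric] by (rule of_nat_mono)
  qed
  finally show ?thesis .
qed

text \<open>
  Here the image of the centre is not prescribed. Given the images of \<open>Nb v1\<close>, the centre and the mate
  of \<open>v1\<close> range over the same set of common links, and the factor \<open>1 / card (links (f ` Nb v1))\<close> of the
  weight can be attributed to either of them. Attributing it to the centre means to choose the image of
  \<open>v1\<close> first, then its neighbours inside \<open>N (\<psi> v1)\<close>, then the centre uniformly among their links and
  finally the other leaves. The prescribed \<open>v1\<close> thus takes over the role of the centre, and its factor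
  \<open>1 / \<theta> v1\<close> disappears.
\<close>

lemma mass_fixed_mate_le:
  assumes JS: "JS \<subseteq> S" and JT: "JT \<subseteq> T" and v1: "v1 \<in> JT"
  shows "(\<Sum>(b, f, g) | (b, f, g) \<in> embeddings \<and> (\<forall>s\<in>JS. f s = \<psi> s) \<and> (\<forall>v\<in>JT. g v = \<psi> v). weight f)
     \<le> D ^ card (S - JS) * (\<Prod>v\<in>JT - {v1}. 1 / \<theta> v)"
proof -
  let ?W = "Nb v1"
  let ?X = "{(b, f). (b, f) \<in> stars \<and> rich f \<and> (\<forall>s\<in>JS. f s = \<psi> s)}"
  let ?X1 = "{(b, f) \<in> ?X. \<psi> v1 \<in> links (f ` ?W)}"
  let ?c = "\<lambda>f. real (card (links (f ` ?W)))"
  let ?Q = "\<Prod>v\<in>JT - {v1}. 1 / \<theta> v"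
  have W: "?W \<subseteq> S" and v1T: "v1 \<in> T" using Nb v1 JT by auto
  have finJT: "finite JT" using JT finT finite_subset by blast
  have pos: "?Q \<ge> 0" using JT \<theta> by (intro prod_nonneg) (auto simp: less_imp_le)
  have finX: "finite ?X" by (rule finite_subset[OF _ fin_stars]) auto
  then have finX1: "finite ?X1" by (rule rev_finite_subset) auto
  have "(\<Sum>(b, f, g) | (b, f, g) \<in> embeddings \<and> (\<forall>s\<in>JS. f s = \<psi> s) \<and> (\<forall>v\<in>JT. g v = \<psi> v). weight f)
     = (\<Sum>(b, f)\<in>?X. \<Sum>g | g \<in> mates f \<and> (\<forall>v\<in>JT. g v = \<psi> v). weight f)"
    by (rule embeddings_mass_Sigma)
  also have "\<dots> \<le> (\<Sum>(b, f)\<in>?X. if \<psi> v1 \<in> links (f ` ?W) then 1 / ?c f * ?Q else 0)"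
  proof (rule sum_mono, clarify)
    fix b f assume f: "rich f"
    let ?h = "\<lambda>v. if \<psi> v \<in> links (f ` Nb v) then 1 / card (links (f ` Nb v)) else 0"
    have "(\<Sum>g | g \<in> mates f \<and> (\<forall>v\<in>JT. g v = \<psi> v). weight f) \<le> (\<Prod>v\<in>JT. ?h v)"
      by (rule mates_mass_le[OF f JT])
    also have "\<dots> = ?h v1 * (\<Prod>v\<in>JT - {v1}. ?h v)" by (rule prod.remove[OF finJT v1])
    also have "\<dots> \<le> ?h v1 * ?Q"
    proof (intro mult_left_mono prod_mono)
      fix v assume "v \<in> JT - {v1}"
      then have "v \<in> T" "\<theta> v > 0" "\<theta> v \<le> card (links (f ` Nb v))"
        using JT \<theta> f by (auto simp: rich_def)
      then show "0 \<le> ?h v \<and> ?h v \<le> 1 / \<theta> v"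
        by (auto intro!: divide_left_mono simp: less_imp_le)
    qed auto
    finally show "(\<Sum>g | g \<in> mates f \<and> (\<forall>v\<in>JT. g v = \<psi> v). weight f)
      \<le> (if \<psi> v1 \<in> links (f ` ?W) then 1 / ?c f * ?Q else 0)"
      by (simp split: if_splits)
  qed
  also have "\<dots> = (\<Sum>(b, f)\<in>?X1. 1 / ?c f * ?Q)"
    by (rule sum.mono_neutral_cong_right) (use finX in \<open>auto split: if_splits\<close>)
  also have "\<dots> = (\<Sum>(b, f)\<in>?X1. 1 / ?c f) * ?Q"
    by (simp add: sum_distrib_right case_prod_unfold)
  also have "(\<Sum>(b, f)\<in>?X1. 1 / ?c f) \<le> D ^ card (S - JS)"
  proof (cases "\<psi> v1 \<in> B")
    case True
    \<comment> \<open>Group the stars by the images of the leaves in \<open>Nb v1\<close>.\<close>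
    let ?F = "{f1 \<in> ?W \<rightarrow>\<^sub>E N (\<psi> v1). \<forall>s\<in>JS \<inter> ?W. f1 s = \<psi> s}"
    have finF: "finite ?F"
      using finite_subset[OF W finS] finN[OF True] by (auto intro!: finite_PiE)
    have img: "(\<lambda>(b, f). restrict f ?W) ` ?X1 \<subseteq> ?F"
      by (auto simp: links_def)
    have "(\<Sum>(b, f)\<in>?X1. 1 / ?c f) =
        (\<Sum>f1\<in>?F. \<Sum>(b, f) | (b, f) \<in> ?X1 \<and> (case (b, f) of (b, f) \<Rightarrow> restrict f ?W) = f1. 1 / ?c f)"
      using sum.group[OF finX1 finF img, of "\<lambda>(b, f). 1 / ?c f"] by (simp add: case_prod_unfold)
    also have "\<dots> \<le> (\<Sum>f1\<in>?F. real (D ^ card (S - ?W - JS)))"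
    proof (rule sum_mono)
      fix f1 assume "f1 \<in> ?F"
      let ?Y = "{(b, f). (b, f) \<in> ?X1 \<and> restrict f ?W = f1}"
      let ?Y' = "{(b, f) \<in> stars. restrict f ?W = f1 \<and> (\<forall>s\<in>JS. f s = \<psi> s)}"
      have "?Y' \<subseteq> stars" by auto
      then have fin': "finite ?Y'" using fin_stars by (rule finite_subset)
      have sub: "?Y \<subseteq> ?Y'" by auto
      have "card ?Y \<le> card ?Y'" by (rule card_mono[OF fin' sub])
      also have "\<dots> \<le> card (links (f1 ` ?W)) * D ^ card (S - ?W - JS)"
        by (rule card_stars_restricted_le[OF W JS])
      finally have Y: "card ?Y \<le> card (links (f1 ` ?W)) * D ^ card (S - ?W - JS)" .
      have im: "f ` ?W = f1 ` ?W" if "restrict f ?W = f1" for f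
        unfolding that[symmetric] by simp
      have "(\<Sum>(b, f) | (b, f) \<in> ?X1 \<and> (case (b, f) of (b, f) \<Rightarrow> restrict f ?W) = f1. 1 / ?c f)
          = (\<Sum>x\<in>?Y. 1 / ?c f1)"
      proof (rule sum.cong)
        fix x assume "x \<in> ?Y"
        then obtain b f where x: "x = (b, f)" and f: "restrict f ?W = f1" by blast
        show "(case x of (b, f) \<Rightarrow> 1 / ?c f) = 1 / ?c f1" by (simp add: x im[OF f])
      qed simp
      also have "\<dots> = card ?Y / ?c f1" by simp
      also have "\<dots> \<le> D ^ card (S - ?W - JS)"
      proof (cases "?c f1 = 0")
        case False
        have "real (card ?Y) \<le> ?c f1 * D ^ card (S - ?W - JS)"
          using of_nat_mono[OF Y, where 'a = real] by simp
        then show ?thesis using False by (simp add: field_simps)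
      qed simp
      finally show "(\<Sum>(b, f) | (b, f) \<in> ?X1 \<and> (case (b, f) of (b, f) \<Rightarrow> restrict f ?W) = f1. 1 / ?c f)
         \<le> D ^ card (S - ?W - JS)" .
    qed
    also have "\<dots> = card ?F * D ^ card (S - ?W - JS)" by simp
    also have "\<dots> \<le> D ^ card (?W - JS) * D ^ card (S - ?W - JS)"
    proof -
      have "card ?F \<le> D ^ card (?W - JS \<inter> ?W)"
        using card_PiE_fixed_le[of ?W "JS \<inter> ?W" "\<lambda>_. N (\<psi> v1)" \<psi>]
          finite_subset[OF W finS] finN[OF True] cardN[OF True] by simp
      also have "?W - JS \<inter> ?W = ?W - JS" by blast
      finally show ?thesis by (intro of_nat_mono mult_right_mono) auto
    qed
    also have "D ^ card (?W - JS) * D ^ card (S - ?W - JS) = D ^ card (S - JS)"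
    proof -
      have "S - JS = (?W - JS) \<union> (S - ?W - JS)" using W by blast
      then have "card (S - JS) = card (?W - JS) + card (S - ?W - JS)"
        using finite_subset[OF W finS] finS
          card_Un_disjoint[of "?W - JS" "S - ?W - JS"] by auto
      then show ?thesis by (simp add: power_add)
    qed
    finally show ?thesis by simp
  next
    case False
    then have "?X1 = {}" by (auto simp: links_def)
    then show ?thesis by (simp only: sum.empty)
  qed
  finally show ?thesis using pos by (simp add: mult_right_mono)
qed

text \<open>
  A pattern of images of \<open>Nb v\<close> with fewer than \<open>\<theta> v\<close> links occurs, by definition, in the stars of few
  centres. This is the counting behind dependent random choice.
\<close>

lemma card_poor_stars_le:
  assumes v: "v \<in> T"
  shows "real (card {(b, f) \<in> stars. card (links (f ` Nb v)) < \<theta> v})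
     \<le> card A ^ card (Nb v) * \<theta> v * D ^ (card S - card (Nb v))"
proof -
  let ?W = "Nb v"
  let ?X = "{(b, f) \<in> stars. card (links (f ` ?W)) < \<theta> v}"
  let ?F = "?W \<rightarrow>\<^sub>E A"
  have W: "?W \<subseteq> S" and finW: "finite ?W" using Nb[OF v] finS finite_subset by auto
  have "?X \<subseteq> stars" by auto
  then have finX: "finite ?X" using fin_stars by (rule finite_subset)
  have finF: "finite ?F" using finW finA by (intro finite_PiE) auto
  have img: "(\<lambda>(b, f). restrict f ?W) ` ?X \<subseteq> ?F"
  proof clarify
    fix b f assume "(b, f) \<in> stars"
    then have "f \<in> S \<rightarrow>\<^sub>E N b" "N b \<subseteq> A" using NA by (auto simp: stars_def)
    then have "f s \<in> A" if "s \<in> ?W" for s using that W by (meson PiE_mem subsetD)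
    then show "restrict f ?W \<in> ?F" by auto
  qed
  have "real (card ?X) = (\<Sum>x\<in>?X. 1)" by simp
  also have "\<dots> = (\<Sum>f1\<in>?F. \<Sum>x | x \<in> ?X \<and> (case x of (b, f) \<Rightarrow> restrict f ?W) = f1. 1)"
    by (rule sum.group[OF finX finF img, symmetric])
  also have "\<dots> \<le> (\<Sum>f1\<in>?F. \<theta> v * D ^ card (S - ?W))"
  proof (rule sum_mono)
    fix f1
    let ?Y = "{x. x \<in> ?X \<and> (case x of (b, f) \<Rightarrow> restrict f ?W) = f1}"
    \<comment> \<open>The vacuous condition makes \<open>card_stars_restricted_le\<close> applicable with no prescribed leaves.\<close>
    let ?Y' = "{(b, f) \<in> stars. restrict f ?W = f1 \<and> (\<forall>s\<in>{}. f s = undefined)}"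
    have "real (card ?Y) \<le> \<theta> v * D ^ card (S - ?W)"
    proof (cases "?Y = {}")
      case True
      show ?thesis unfolding True using \<theta>[OF v] by simp
    next
      case False
      then obtain x where x: "x \<in> ?Y" by (meson ex_in_conv)
      obtain b f where "x = (b, f)" by (rule prod.exhaust)
      then have "(b, f) \<in> ?X" and f1: "restrict f ?W = f1" using x by auto
      then have "card (links (f ` ?W)) < \<theta> v" by simp
      moreover have "f ` ?W = f1 ` ?W" unfolding f1[symmetric] by simp
      ultimately have poor: "real (card (links (f1 ` ?W))) \<le> \<theta> v" by simp
      have "?Y' \<subseteq> stars" by auto
      then have "finite ?Y'" using fin_stars by (rule finite_subset)
      then have "card ?Y \<le> card ?Y'" by (rule card_mono) auto
      also have "\<dots> \<le> card (links (f1 ` ?W)) * D ^ card (S - ?W - {})"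
        by (rule card_stars_restricted_le[OF W empty_subsetI])
      finally have "real (card ?Y) \<le> real (card (links (f1 ` ?W)) * D ^ card (S - ?W))"
        by (intro of_nat_mono) simp
      also have "\<dots> \<le> \<theta> v * D ^ card (S - ?W)"
        using mult_right_mono[OF poor, of "real (D ^ card (S - ?W))"] by simp
      finally show ?thesis .
    qed
    then show "(\<Sum>x\<in>?Y. 1) \<le> \<theta> v * D ^ card (S - ?W)" by simp
  qed
  also have "\<dots> = card A ^ card ?W * \<theta> v * D ^ (card S - card ?W)"
    using finW card_Diff_subset[OF finW W] by (simp add: card_PiE)
  finally show ?thesis .
qed

lemma weight_card_mates: "rich f \<Longrightarrow> weight f * card (mates f) = 1"
proof -
  assume f: "rich f"
  have "weight f * card (mates f) = (\<Prod>v\<in>T. 1 / card (links (f ` Nb v)) * card (links (f ` Nb v)))"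
    unfolding weight_def mates_def card_PiE[OF finT] of_nat_prod by (simp only: prod.distrib)
  also have "\<dots> = 1" by (rule prod.neutral) (use rich_links_pos[OF f] in auto)
  finally show ?thesis .
qed

lemma injective_mates_mass_ge:
  assumes f: "rich f" and b: "(b, f) \<in> stars"
    and large: "\<And>v. v \<in> T \<Longrightarrow> \<theta> v \<ge> 2 * card T * (card S + 1 + card T)"
  shows "(\<Sum>g | g \<in> mates f \<and> (inj_on g T \<and> g ` T \<inter> insert b (f ` S) = {}). weight f) \<ge> 1 / 2"
proof -
  let ?Y = "insert b (f ` S)"
  let ?good = "{g \<in> mates f. inj_on g T \<and> g ` T \<inter> ?Y = {}}"
  let ?bad = "{g \<in> mates f. \<not> (inj_on g T \<and> g ` T \<inter> ?Y = {})}"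
  have Y: "card ?Y \<le> card S + 1"
    using card_image_le[OF finS, of f] finS by (simp add: card_insert_if)
  have "real (card ?bad) \<le> (\<Prod>v\<in>T. card (links (f ` Nb v))) / 2"
    unfolding mates_def
  proof (rule card_PiE_noninjective_le)
    fix v assume v: "v \<in> T"
    have "2 * real (card T) * real (card ?Y + card T) \<le> 2 * real (card T) * real (card S + 1 + card T)"
      by (intro mult_left_mono of_nat_mono) (use Y in auto)
    also have "\<dots> \<le> \<theta> v" using large[OF v] by (simp add: algebra_simps)
    also have "\<dots> \<le> card (links (f ` Nb v))" using f v by (simp add: rich_def)
    finally show "2 * real (card T) * real (card ?Y + card T) \<le> card (links (f ` Nb v))" .
  qed (use finT finS fin_links in auto)
  also have "(\<Prod>v\<in>T. card (links (f ` Nb v))) = card (mates f)"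
    unfolding mates_def by (rule card_PiE[OF finT, symmetric])
  finally have bad: "real (card ?bad) \<le> card (mates f) / 2" .
  have un: "mates f = ?good \<union> ?bad" by auto
  have "card (mates f) = card ?good + card ?bad"
    using fin_mates by (subst un, subst card_Un_disjoint) auto
  then have "real (card ?good) \<ge> card (mates f) / 2" using bad by simp
  then have "weight f * (card (mates f) / 2) \<le> weight f * card ?good"
    by (rule mult_left_mono[OF _ weight_nonneg])
  then show ?thesis using weight_card_mates[OF f] by (simp add: mult.commute)
qed

lemma card_rich_injective_stars_ge:
  assumes D: "real D \<ge> 4 * card S * card S"
    and poor: "(\<Sum>v\<in>T. card A ^ card (Nb v) * \<theta> v * D ^ (card S - card (Nb v))) \<le> card B * D ^ card S / 4"
  shows "real (card {(b, f). (b, f) \<in> stars \<and> rich f \<and> inj_on f S}) \<ge> card B * D ^ card S / 2"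
proof -
  let ?X = "{(b, f). (b, f) \<in> stars \<and> rich f \<and> inj_on f S}"
  let ?noninj = "SIGMA b:B. {f \<in> S \<rightarrow>\<^sub>E N b. \<not> (inj_on f S \<and> f ` S \<inter> {} = {})}"
  let ?poor = "\<Union>v\<in>T. {(b, f) \<in> stars. card (links (f ` Nb v)) < \<theta> v}"
  have finni: "finite {f \<in> S \<rightarrow>\<^sub>E N b. \<not> (inj_on f S \<and> f ` S \<inter> {} = {})}" if "b \<in> B" for b
    by (rule finite_subset[of _ "S \<rightarrow>\<^sub>E N b"]) (use finS finN[OF that] in \<open>auto intro: finite_PiE\<close>)
  have "real (card ?noninj) = (\<Sum>b\<in>B. real (card {f \<in> S \<rightarrow>\<^sub>E N b. \<not> (inj_on f S \<and> f ` S \<inter> {} = {})}))"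
    by (subst card_SigmaI[OF finB]) (use finni in auto)
  also have "\<dots> \<le> (\<Sum>b\<in>B. D ^ card S / 4)"
  proof (rule sum_mono)
    fix b assume b: "b \<in> B"
    have "real (card {f \<in> S \<rightarrow>\<^sub>E N b. \<not> (inj_on f S \<and> f ` S \<inter> {} = {})}) \<le> (\<Prod>s\<in>S. card (N b)) / 4"
      by (rule card_PiE_noninjective_le) (use finS finN[OF b] cardN[OF b] D in auto)
    then show "real (card {f \<in> S \<rightarrow>\<^sub>E N b. \<not> (inj_on f S \<and> f ` S \<inter> {} = {})}) \<le> D ^ card S / 4"
      using cardN[OF b] by simp
  qed
  finally have ni: "real (card ?noninj) \<le> card B * D ^ card S / 4" by simp
  have "real (card ?poor) \<le> (\<Sum>v\<in>T. real (card {(b, f) \<in> stars. card (links (f ` Nb v)) < \<theta> v}))"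
    using of_nat_mono[OF card_UN_le[OF finT]] by simp
  also have "\<dots> \<le> (\<Sum>v\<in>T. card A ^ card (Nb v) * \<theta> v * D ^ (card S - card (Nb v)))"
    by (rule sum_mono) (rule card_poor_stars_le)
  also note poor
  finally have po: "real (card ?poor) \<le> card B * D ^ card S / 4" .
  have finX: "finite ?X" by (rule finite_subset[OF _ fin_stars]) auto
  have finno: "finite ?noninj" using finB finni by (rule finite_SigmaI)
  have finpo: "finite ?poor" by (rule finite_subset[OF _ fin_stars]) auto
  have "stars \<subseteq> (?X \<union> ?noninj) \<union> ?poor"
    by (auto simp: rich_def stars_def not_le)
  then have "card stars \<le> card ((?X \<union> ?noninj) \<union> ?poor)"
    using finX finno finpo by (intro card_mono) auto
  also have "\<dots> \<le> card (?X \<union> ?noninj) + card ?poor" by (rule card_Un_le)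
  also have "\<dots> \<le> card ?X + card ?noninj + card ?poor" by (rule add_right_mono[OF card_Un_le])
  finally have "real (card B * D ^ card S) \<le> card ?X + card ?noninj + card ?poor"
    unfolding card_stars by (rule of_nat_mono)
  then show ?thesis using ni po by simp
qed

lemma mass_injective_ge:
  assumes D: "real D \<ge> 4 * card S * card S"
    and poor: "(\<Sum>v\<in>T. card A ^ card (Nb v) * \<theta> v * D ^ (card S - card (Nb v))) \<le> card B * D ^ card S / 4"
    and large: "\<And>v. v \<in> T \<Longrightarrow> \<theta> v \<ge> 2 * card T * (card S + 1 + card T)"
  shows "(\<Sum>(b, f, g) | (b, f, g) \<in> embeddings \<and> inj_on f S \<and> (inj_on g T \<and> g ` T \<inter> insert b (f ` S) = {}).
     weight f) \<ge> card B * D ^ card S / 4"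
proof -
  let ?X = "{(b, f). (b, f) \<in> stars \<and> rich f \<and> inj_on f S}"
  have "card B * D ^ card S / 4 \<le> (\<Sum>x\<in>?X. 1 / 2)"
    using card_rich_injective_stars_ge[OF D poor] by simp
  also have "\<dots> \<le> (\<Sum>(b, f)\<in>?X. \<Sum>g | g \<in> mates f \<and> (inj_on g T \<and> g ` T \<inter> insert b (f ` S) = {}). weight f)"
  proof (rule sum_mono)
    fix x assume "x \<in> ?X"
    then obtain b f where x: "x = (b, f)" and f: "rich f" "(b, f) \<in> stars" by blast
    show "1 / 2 \<le> (case x of (b, f) \<Rightarrow>
      \<Sum>g | g \<in> mates f \<and> (inj_on g T \<and> g ` T \<inter> insert b (f ` S) = {}). weight f)"
      unfolding x prod.case by (rule injective_mates_mass_ge[OF f large])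
  qed
  also have "\<dots> = (\<Sum>(b, f, g) | (b, f, g) \<in> embeddings \<and> inj_on f S \<and>
     (inj_on g T \<and> g ` T \<inter> insert b (f ` S) = {}). weight f)"
    by (rule embeddings_mass_Sigma[symmetric])
  finally show ?thesis .
qed

end

section \<open>Semi-bounded graphs\<close>

locale semi_bounded_graph =
  fixes F :: "'a ugraph" and S T :: "'a set" and v0 :: 'a and r :: nat
  assumes simple: "simple_graph F" and semi_bounded: "semi_bounded r F S T v0"
    and has_edge: "edges F \<noteq> {}"
begin

text \<open>
  Isolated vertices of \<open>F\<close> are left out: they do not influence edge sets, and a copy of the other
  vertices extends to them whenever the host has enough vertices.
\<close>

definition mate_verts :: "'a set" where
  "mate_verts = {v \<in> T - {v0}. degree F v \<ge> 1}"

definition nbhd :: "'a \<Rightarrow> 'a set" where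
  "nbhd v = {s \<in> S. {s, v} \<in> edges F}"

lemma bipartition: "S \<union> T = verts F" "S \<inter> T = {}" "e \<in> edges F \<Longrightarrow> \<exists>x\<in>S. \<exists>y\<in>T. e = {x, y}"
  using semi_bounded by (auto simp: semi_bounded_def bipartition_def)

lemma v0: "v0 \<in> T" "v0 \<notin> S" and v0_edge: "s \<in> S \<Longrightarrow> {s, v0} \<in> edges F"
  using semi_bounded bipartition(2) by (auto simp: semi_bounded_def)

lemma finite_verts: "finite (verts F)" "finite S" "finite T" "finite mate_verts"
  using simple bipartition(1) by (auto simp: simple_graph_def mate_verts_def intro: finite_subset)

lemma finite_edges: "finite (edges F)"
  using simple finite_imp_finite_nsets finite_subset unfolding simple_graph_def by metis

lemma nbhd_v0: "nbhd v0 = S" using v0_edge by (auto simp: nbhd_def)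

lemma nbhd_subset: "nbhd v \<subseteq> S" by (auto simp: nbhd_def)

lemma card_nbhd:
  assumes "v \<in> T"
  shows "card (nbhd v) = degree F v"
proof -
  have "{e \<in> edges F. v \<in> e} = (\<lambda>s. {s, v}) ` nbhd v"
    using bipartition(2,3) assms by (fastforce simp: nbhd_def)
  moreover have "inj_on (\<lambda>s. {s, v}) (nbhd v)" by (auto simp: inj_on_def doubleton_eq_iff)
  ultimately show ?thesis by (simp add: degree_def card_image)
qed

lemma degree_le_v0: "v \<in> T \<Longrightarrow> degree F v \<le> degree F v0"
  using card_nbhd[of v] card_nbhd[OF v0(1)] card_mono[OF finite_verts(2) nbhd_subset[of v]]
  by (simp add: nbhd_v0)

lemma degree_mate: "v \<in> mate_verts \<Longrightarrow> 1 \<le> degree F v \<and> degree F v \<le> r"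
  using semi_bounded by (auto simp: mate_verts_def semi_bounded_def)

lemma edge_cases:
  assumes "e \<in> edges F"
  obtains s v where "s \<in> S" "s \<in> nbhd v" "v \<in> insert v0 mate_verts" "e = {s, v}"
proof -
  obtain s v where sv: "s \<in> S" "v \<in> T" "e = {s, v}" using bipartition(3)[OF assms] by blast
  then have s: "s \<in> nbhd v" using assms by (simp add: nbhd_def)
  have "v \<in> insert v0 mate_verts"
  proof (cases "v = v0")
    case False
    have "finite (nbhd v)" by (rule finite_subset[OF nbhd_subset finite_verts(2)])
    then have "card (nbhd v) > 0" using s by (auto simp: card_gt_0_iff)
    then show ?thesis using False sv(2) card_nbhd[OF sv(2)] by (simp add: mate_verts_def)
  qed simp
  then show ?thesis using that sv s by blast
qed

lemma Union_edges: "\<Union>(edges F) \<subseteq> S \<union> insert v0 mate_verts"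
  by (auto elim!: edge_cases)

lemma mate_verts_T: "mate_verts \<subseteq> T" by (auto simp: mate_verts_def)

lemma card_parts: "card S + 1 + card mate_verts \<le> card (verts F)"
proof -
  have "S \<union> insert v0 mate_verts \<subseteq> verts F" using bipartition(1) v0(1) mate_verts_T by auto
  then have "card (S \<union> insert v0 mate_verts) \<le> card (verts F)" by (rule card_mono[OF finite_verts(1)])
  moreover have "card (S \<union> insert v0 mate_verts) = card S + card (insert v0 mate_verts)"
    using bipartition(2) v0 mate_verts_T finite_verts by (intro card_Un_disjoint) auto
  moreover have "card (insert v0 mate_verts) = 1 + card mate_verts"
    using finite_verts(4) by (simp add: mate_verts_def)
  ultimately show ?thesis by simp
qed

lemma spanned_degree:
  assumes "\<sigma> \<subseteq> edges F" "v \<in> \<Union>\<sigma>"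
  shows "degree (induced F (\<Union>\<sigma>)) v \<ge> 1"
proof -
  have fin: "finite {e \<in> edges (induced F (\<Union>\<sigma>)). v \<in> e}"
    using finite_edges by (simp add: induced_def)
  obtain e where "e \<in> \<sigma>" "v \<in> e" using assms(2) by blast
  then have "e \<in> {e \<in> edges (induced F (\<Union>\<sigma>)). v \<in> e}" using assms(1) by (auto simp: induced_def)
  then show ?thesis using fin unfolding degree_def by (metis One_nat_def Suc_leI card_gt_0_iff empty_iff)
qed

lemma spanned_e_ind:
  assumes "\<sigma> \<subseteq> edges F"
  shows "card \<sigma> \<le> e_ind F (\<Union>\<sigma>)"
  unfolding e_ind_def by (rule card_mono) (use finite_edges assms in \<open>auto simp: induced_def\<close>)

lemma spanned_subset: "\<sigma> \<subseteq> edges F \<Longrightarrow> \<Union>\<sigma> \<subseteq> verts F"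
  using simple by (auto simp: simple_graph_def nsets_def)

lemma card_spanned:
  assumes "\<sigma> \<subseteq> edges F" "\<sigma> \<noteq> {}"
  shows "S \<inter> \<Union>\<sigma> \<noteq> {}" "T \<inter> \<Union>\<sigma> \<noteq> {}" "card (\<Union>\<sigma>) = card (S \<inter> \<Union>\<sigma>) + card (T \<inter> \<Union>\<sigma>)"
proof -
  obtain e where "e \<in> \<sigma>" "e \<in> edges F" using assms by blast
  then obtain x y where "x \<in> S" "y \<in> T" "e = {x, y}" using bipartition(3) by blast
  then show "S \<inter> \<Union>\<sigma> \<noteq> {}" "T \<inter> \<Union>\<sigma> \<noteq> {}" using \<open>e \<in> \<sigma>\<close> by auto
  have "\<Union>\<sigma> = (S \<inter> \<Union>\<sigma>) \<union> (T \<inter> \<Union>\<sigma>)" using spanned_subset[OF assms(1)] bipartition(1) by blast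
  then show "card (\<Union>\<sigma>) = card (S \<inter> \<Union>\<sigma>) + card (T \<inter> \<Union>\<sigma>)"
    using card_Un_disjoint[of "S \<inter> \<Union>\<sigma>" "T \<inter> \<Union>\<sigma>"] finite_verts bipartition(2) by fastforce
qed

lemma spanned_mates: "\<sigma> \<subseteq> edges F \<Longrightarrow> T \<inter> \<Union>\<sigma> \<subseteq> insert v0 mate_verts"
  using Union_edges bipartition(2) by blast

text \<open>
  Since \<open>v0\<close> is adjacent to all of \<open>S\<close>, no vertex of \<open>T\<close> has a larger degree. So the maximum in
  \<open>f_val\<close> can be taken at \<open>v0\<close> whenever \<open>v0\<close> is covered by \<open>\<sigma>\<close>.
\<close>

lemma f_val_spanned:
  assumes \<sigma>: "\<sigma> \<subseteq> edges F" "\<sigma> \<noteq> {}"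
  obtains v1 where "v1 \<in> T \<inter> \<Union>\<sigma>" "v0 \<in> \<Union>\<sigma> \<longrightarrow> v1 = v0"
    "f_val F S T (\<Union>\<sigma>) = int (card (S \<inter> \<Union>\<sigma>) + (\<Sum>v\<in>T \<inter> \<Union>\<sigma> - {v1}. degree F v))"
proof -
  let ?\<nu> = "\<Union>\<sigma>"
  let ?M = "{degree F v |v. v \<in> T \<inter> ?\<nu> \<and> degree (induced F ?\<nu>) v \<ge> 1}"
  have M: "?M = degree F ` (T \<inter> ?\<nu>)" using spanned_degree[OF \<sigma>(1)] by blast
  have fin: "finite (T \<inter> ?\<nu>)" and ne: "T \<inter> ?\<nu> \<noteq> {}"
    using finite_verts(3) card_spanned(2)[OF \<sigma>] by auto
  have "\<exists>v1. v1 \<in> T \<inter> ?\<nu> \<and> (v0 \<in> ?\<nu> \<longrightarrow> v1 = v0) \<and> Max ?M = degree F v1"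
  proof (cases "v0 \<in> ?\<nu>")
    case True
    have "Max ?M = degree F v0"
      unfolding M by (rule Max_eqI) (use fin True v0 degree_le_v0 in auto)
    then show ?thesis using True v0 by blast
  next
    case False
    have "Max ?M \<in> ?M" unfolding M using fin ne by (intro Max_in) auto
    then show ?thesis using False by auto
  qed
  then obtain v1 where v1: "v1 \<in> T \<inter> ?\<nu>" "v0 \<in> ?\<nu> \<longrightarrow> v1 = v0" "Max ?M = degree F v1" by blast
  have "(\<Sum>v\<in>T \<inter> ?\<nu>. int (degree F v)) = int (degree F v1) + (\<Sum>v\<in>T \<inter> ?\<nu> - {v1}. int (degree F v))"
    by (rule sum.remove[OF fin v1(1)])
  then have "f_val F S T ?\<nu> = int (card (S \<inter> ?\<nu>) + (\<Sum>v\<in>T \<inter> ?\<nu> - {v1}. degree F v))"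
    unfolding f_val_def v1(3) by simp
  then show ?thesis using that v1 by blast
qed

lemma finite_densities:
  "finite {(real (card (edges F')) - 1) / (real (card (verts F')) - 2) |F'.
            subgraph F' F \<and> card (verts F') \<ge> 3}" (is "finite ?A")
proof -
  have "?A \<subseteq> (\<lambda>(V, E). (real (card E) - 1) / (real (card V) - 2)) ` (Pow (verts F) \<times> Pow (edges F))"
    by (force simp: subgraph_def)
  then show ?thesis by (rule finite_subset) (use finite_verts finite_edges in simp)
qed

lemma two_density_ge:
  assumes "subgraph F' F" "card (verts F') \<ge> 3"
  shows "(real (card (edges F')) - 1) / (real (card (verts F')) - 2) \<le> two_density F"
  unfolding two_density_def by (rule Max_ge[OF finite_densities]) (use assms in blast)

lemma subgraph_induced: "subgraph (induced F \<nu>) F"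
  using simple by (auto simp: subgraph_def induced_def simple_graph_def nsets_def intro: finite_subset)

text \<open>
  This is the definition of the 2-density, except that a single edge, which has only two vertices, is
  not covered by it and gives equality.
\<close>

lemma spanned_density:
  assumes \<sigma>: "\<sigma> \<subseteq> edges F" "\<sigma> \<noteq> {}" and m: "two_density F > 0"
  shows "(real (e_ind F (\<Union>\<sigma>)) - 1) / two_density F \<le> real (card (\<Union>\<sigma>)) - 2"
proof -
  let ?\<nu> = "\<Union>\<sigma>"
  have V: "verts (induced F ?\<nu>) = ?\<nu>" using spanned_subset[OF \<sigma>(1)] by (auto simp: induced_def)
  have fin: "finite ?\<nu>" using spanned_subset[OF \<sigma>(1)] finite_verts(1) finite_subset by blast
  have "finite (S \<inter> ?\<nu>)" "finite (T \<inter> ?\<nu>)" using finite_verts by auto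
  then have "card (S \<inter> ?\<nu>) \<ge> 1" "card (T \<inter> ?\<nu>) \<ge> 1"
    using card_spanned(1,2)[OF \<sigma>] by (auto simp: Suc_le_eq card_gt_0_iff)
  then consider "card ?\<nu> = 2" | "card ?\<nu> \<ge> 3" using card_spanned(3)[OF \<sigma>] by linarith
  then show ?thesis
  proof cases
    case 1
    have "edges (induced F ?\<nu>) \<subseteq> {?\<nu>}"
    proof
      fix e assume "e \<in> edges (induced F ?\<nu>)"
      then have "e \<subseteq> ?\<nu>" "card e = 2" using simple by (auto simp: induced_def simple_graph_def nsets_def)
      then have "e = ?\<nu>" using card_subset_eq[OF fin] 1 by simp
      then show "e \<in> {?\<nu>}" by simp
    qed
    then have "card (edges (induced F ?\<nu>)) \<le> card {?\<nu>}" by (intro card_mono) auto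
    then have "e_ind F ?\<nu> \<le> 1" by (simp add: e_ind_def)
    then show ?thesis using 1 m by (simp add: divide_nonpos_pos)
  next
    case 2
    have "(real (e_ind F ?\<nu>) - 1) / (real (card ?\<nu>) - 2) \<le> two_density F"
      using two_density_ge[OF subgraph_induced, of ?\<nu>] V 2 by (simp add: e_ind_def)
    then show ?thesis using 2 m by (simp add: field_simps)
  qed
qed

lemma b_min_le:
  assumes "\<nu> \<in> B_set F S T"
  shows "b_min F S T \<le> b_val F S T \<nu>"
proof -
  have "B_set F S T \<subseteq> Pow (verts F)" by (auto simp: B_set_def)
  then have "finite (B_set F S T)" using finite_verts(1) by (simp add: finite_subset)
  then show ?thesis unfolding b_min_def using assms by (intro Min_le) auto
qed

lemma spanned_in_B_set:
  assumes \<sigma>: "\<sigma> \<subseteq> edges F" "\<sigma> \<noteq> {}" and f: "f_val F S T (\<Union>\<sigma>) > int (e_ind F (\<Union>\<sigma>))"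
  shows "\<Union>\<sigma> \<in> B_set F S T"
  unfolding B_set_def
  using spanned_subset[OF \<sigma>(1)] card_spanned(1)[OF \<sigma>] spanned_degree[OF \<sigma>(1)] f by auto

end

text \<open>
  Two consecutive edges of a cycle form a path on three vertices, whose density is 1.
\<close>

lemma two_density_ge_1:
  assumes simple: "simple_graph F" and cyc: "has_cycle F"
  shows "two_density F \<ge> 1"
proof -
  obtain xs where xs: "length xs \<ge> 3" "distinct xs"
    "\<And>i. i < length xs \<Longrightarrow> {xs ! i, xs ! (Suc i mod length xs)} \<in> edges F"
    using cyc by (auto simp: has_cycle_def)
  let ?a = "xs ! 0" and ?b = "xs ! 1" and ?c = "xs ! 2"
  have len: "0 < length xs" "1 < length xs" "2 < length xs" using xs(1) by linarith+
  have d: "?a \<noteq> ?b" "?b \<noteq> ?c" "?a \<noteq> ?c"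
    using xs(1) len nth_eq_iff_index_eq[OF xs(2), of 0 1] nth_eq_iff_index_eq[OF xs(2), of 1 2]
      nth_eq_iff_index_eq[OF xs(2), of 0 2] by (simp_all only: simp_thms)
  have "{xs ! 0, xs ! (Suc 0 mod length xs)} \<in> edges F" "{xs ! 1, xs ! (Suc 1 mod length xs)} \<in> edges F"
    using xs(3)[OF len(1)] xs(3)[OF len(2)] by simp_all
  moreover have "Suc 0 mod length xs = 1" "Suc 1 mod length xs = 2" using xs(1) by auto
  ultimately have e: "{?a, ?b} \<in> edges F" "{?b, ?c} \<in> edges F" by (simp_all del: One_nat_def)
  let ?P = "\<lparr>verts = {?a, ?b, ?c}, edges = {{?a, ?b}, {?b, ?c}}\<rparr>"
  have "e \<subseteq> verts F" if "e \<in> edges F" for e using simple that by (auto simp: simple_graph_def nsets_def)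
  then have "subgraph ?P F" using e d by (auto simp: subgraph_def simple_graph_def)
  moreover have "card {?a, ?b, ?c} = 3" using d by simp
  moreover have "card {{?a, ?b}, {?b, ?c}} = 2" using d by (simp add: doubleton_eq_iff)
  ultimately have mem: "1 \<in> {(real (card (edges F')) - 1) / (real (card (verts F')) - 2) |F'.
            subgraph F' F \<and> card (verts F') \<ge> 3}" (is "_ \<in> ?A")
    by (intro CollectI exI[of _ ?P]) auto
  have finV: "finite (verts F)" and finE: "finite (edges F)"
    using simple finite_imp_finite_nsets finite_subset by (auto simp: simple_graph_def)
  have "?A \<subseteq> (\<lambda>(V, E). (real (card E) - 1) / (real (card V) - 2)) ` (Pow (verts F) \<times> Pow (edges F))"
    by (force simp: subgraph_def)
  then have "finite ?A" by (rule finite_subset) (use finV finE in simp)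
  then show ?thesis unfolding two_density_def using mem by (rule Max_ge)
qed

section \<open>Balanced supersaturation\<close>

text \<open>
  For a fixed number of edges, stars with \<open>d\<close> leaves are fewest if all \<open>N\<close> vertices have the same relative
  degree \<open>\<delta>\<close>; having \<open>B\<close> centres of the larger relative degree \<open>x\<close> only creates more of them.
\<close>

lemma density_power_le:
  fixes N \<delta> x B :: real
  assumes "0 \<le> \<delta>" "\<delta> \<le> x" "\<delta> * N = B * x" "B \<ge> 0" "d \<ge> 1"
  shows "N * \<delta> ^ d \<le> B * x ^ d"
proof -
  obtain d' where d: "d = Suc d'" using assms(5) by (cases d) auto
  have "N * \<delta> ^ d = B * x * \<delta> ^ d'" using assms(3) by (simp add: d mult.commute mult.left_commute)
  also have "\<dots> \<le> B * x * x ^ d'" using assms by (intro mult_left_mono power_mono) auto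
  finally show ?thesis by (simp add: d mult.assoc)
qed

text \<open>
  The claim is equivalent to \<open>N powr (- g) \<le> \<delta> powr (f - e)\<close>. For \<open>f \<le> e\<close> the left side is at most 1
  and the right side at least 1; for \<open>f > e\<close> it is the assumed lower bound on \<open>\<delta>\<close>.
\<close>

lemma spread_exponents:
  fixes N \<delta> m :: real and c e f :: nat
  assumes N: "N \<ge> 1" and \<delta>: "0 < \<delta>" "\<delta> \<le> 1" and e: "e \<ge> 1"
    and g: "g = real c - 2 - (real e - 1) / m" "g \<ge> 0"
    and big: "f > e \<Longrightarrow> N powr (- (g / (real f - real e))) \<le> \<delta>"
  shows "1 / (N ^ c * \<delta> ^ f) \<le> 1 / (\<delta> * N ^ 2) * (N powr (- 1 / m) / \<delta>) ^ (e - 1)"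
proof -
  have core: "N powr (- g) \<le> \<delta> powr (real f - real e)"
  proof (cases "f > e")
    case True
    have "N powr (- g) = (N powr (- (g / (real f - real e)))) powr (real f - real e)"
      using True by (simp add: powr_powr)
    also have "\<dots> \<le> \<delta> powr (real f - real e)"
      using big[OF True] True by (intro powr_mono2) auto
    finally show ?thesis .
  next
    case False
    have "N powr (- g) \<le> 1" using N g(2) by (simp add: powr_le_one_le powr_mono[of "- g" 0 N, simplified])
    also have "\<dots> \<le> \<delta> powr (real f - real e)"
      using False \<delta> powr_mono'[of "real f - real e" 0 \<delta>] by simp
    finally show ?thesis .
  qed
  have "1 / (N ^ c * \<delta> ^ f) = N powr (- real c) * \<delta> powr (- real f)"
    using N \<delta> by (simp add: powr_minus powr_realpow divide_simps)
  also have "- real c = - g + (- 2 - (real e - 1) / m)" using g(1) by simp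
  also have "N powr (- g + (- 2 - (real e - 1) / m)) * \<delta> powr (- real f) =
      N powr (- g) * (N powr (- 2 - (real e - 1) / m) * \<delta> powr (- real f))"
    by (simp only: powr_add mult.assoc)
  also have "\<dots> \<le> \<delta> powr (real f - real e) * (N powr (- 2 - (real e - 1) / m) * \<delta> powr (- real f))"
    by (rule mult_right_mono[OF core]) simp
  also have "\<dots> = N powr (- 2 - (real e - 1) / m) * (\<delta> powr (real f - real e) * \<delta> powr (- real f))"
    by simp
  also have "\<delta> powr (real f - real e) * \<delta> powr (- real f) = \<delta> powr (- real e)"
    by (simp add: powr_add[symmetric])
  also have "N powr (- 2 - (real e - 1) / m) * \<delta> powr (- real e) =
     1 / (\<delta> * N ^ 2) * (N powr (- 1 / m) / \<delta>) ^ (e - 1)"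
  proof -
    have "(N powr (- 1 / m)) ^ (e - 1) = N powr (- (real e - 1) / m)"
    proof -
      have "(N powr (- 1 / m)) ^ (e - 1) = (N powr (- 1 / m)) powr real (e - 1)"
        by (rule powr_realpow[symmetric]) (use N in simp)
      also have "\<dots> = N powr (- 1 / m * real (e - 1))" by (rule powr_powr)
      also have "- 1 / m * real (e - 1) = - (real e - 1) / m"
        using e by (simp add: of_nat_diff diff_divide_distrib)
      finally show ?thesis .
    qed
    moreover have "N powr (- 2 - (real e - 1) / m) = N powr (- 2) * N powr (- (real e - 1) / m)"
      unfolding powr_add[symmetric]
      by (rule arg_cong[where f = "(powr) N"]) (simp add: diff_divide_distrib)
    moreover have "N powr (- 2) = 1 / N ^ 2" using N by (simp add: powr_minus divide_inverse)
    moreover have "\<delta> powr (- real e) = 1 / (\<delta> * \<delta> ^ (e - 1))"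
    proof -
      have "\<delta> powr (- real e) = 1 / \<delta> ^ e"
        using \<delta> by (simp add: powr_minus powr_realpow divide_inverse)
      also have "\<delta> ^ e = \<delta> * \<delta> ^ (e - 1)" using e by (cases e) simp_all
      finally show ?thesis .
    qed
    ultimately show ?thesis by (simp add: power_divide)
  qed
  finally show ?thesis .
qed

lemma harm_le_ln:
  assumes "n \<ge> 1"
  shows "harm n \<le> 1 + ln (real n)"
proof -
  obtain m where m: "n = Suc m" using assms by (cases n) auto
  have "harm (Suc m) - ln (Suc m) \<le> harm (Suc 0) - ln (real (Suc 0))"
    by (rule decseqD[OF decseq_harm_diff_ln]) simp
  then show ?thesis by (simp add: m harm_def)
qed

text \<open>
  Let \<open>G D\<close> be the set of vertices of degree at least \<open>D\<close>. The sum of the degrees is the sum of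
  \<open>card (G D)\<close> over all \<open>D \<ge> 1\<close>, so \<open>card (G D) * D\<close> cannot be smaller than \<open>card U / harm n\<close> for all \<open>D\<close>.
  The neighbourhoods of the vertices in \<open>G D\<close> are then cut down to size \<open>D\<close>.
\<close>

lemma regular_part:
  fixes L :: real
  assumes U: "U \<subseteq> nsets {..<n} 2" and ne: "U \<noteq> {}" and L: "L \<ge> harm n"
  obtains B N D where "B \<subseteq> {..<n}" "B \<noteq> {}" "D \<ge> 1" "\<And>b. b \<in> B \<Longrightarrow> N b \<subseteq> {..<n}"
    "\<And>b. b \<in> B \<Longrightarrow> card (N b) = D" "\<And>b a. b \<in> B \<Longrightarrow> a \<in> N b \<Longrightarrow> {a, b} \<in> U"
    "real (card U) \<le> L * (card B * D)"
proof -
  define nb where "nb b = {a. {a, b} \<in> U}" for b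
  define G where "G D = {b \<in> {..<n}. D \<le> card (nb b)}" for D
  have nb: "nb b \<subseteq> {..<n}" for b using U by (auto simp: nb_def nsets_def)
  have fnb: "finite (nb b)" for b using nb finite_subset by blast
  have finU: "finite U" using U finite_imp_finite_nsets finite_subset by (metis finite_lessThan)
  have u: "card U > 0" using finU ne by (simp add: card_gt_0_iff)
  have "U \<subseteq> (\<lambda>(b, a). {a, b}) ` (SIGMA b:{..<n}. nb b)"
  proof
    fix e assume e: "e \<in> U"
    have "e \<in> nsets {..<n} 2" using U e by (rule subsetD)
    then obtain a b where ab: "e = {a, b}" "b < n" by (rule nsets2_E) simp
    then have "(b, a) \<in> (SIGMA b:{..<n}. nb b)" using e by (simp add: nb_def)
    then show "e \<in> (\<lambda>(b, a). {a, b}) ` (SIGMA b:{..<n}. nb b)" using ab by force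
  qed
  then have "card U \<le> card (SIGMA b:{..<n}. nb b)"
    by (rule surj_card_le[rotated]) (auto intro!: finite_SigmaI fnb)
  also have "\<dots> = (\<Sum>b<n. card (nb b))" by (rule card_SigmaI) (auto simp: fnb)
  also have "\<dots> = (\<Sum>b<n. \<Sum>D\<in>{1..n}. if D \<le> card (nb b) then 1 else 0)"
  proof (rule sum.cong)
    fix b
    have "card (nb b) \<le> n" using card_mono[OF _ nb[of b]] by simp
    then have "{D \<in> {1..n}. D \<le> card (nb b)} = {1..card (nb b)}" by auto
    then show "card (nb b) = (\<Sum>D\<in>{1..n}. if D \<le> card (nb b) then 1 else 0)"
      by (simp add: sum.If_cases Int_def)
  qed simp
  also have "\<dots> = (\<Sum>D\<in>{1..n}. \<Sum>b<n. if D \<le> card (nb b) then 1 else 0)" by (rule sum.swap)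
  also have "\<dots> = (\<Sum>D\<in>{1..n}. card (G D))"
    by (simp add: sum.If_cases Int_def G_def)
  finally have total: "card U \<le> (\<Sum>D\<in>{1..n}. card (G D))" .
  have "\<exists>D\<in>{1..n}. real (card U) \<le> L * (card (G D) * D)"
  proof (rule ccontr)
    assume "\<not> ?thesis"
    then have lt: "L * (card (G D) * D) < card U" if "D \<in> {1..n}" for D using that by force
    have n: "n \<ge> 1" using ne U by (cases n) (auto simp: nsets_def)
    have "(1::real) \<le> harm n" using n by (simp add: harm_def sum.atLeast_Suc_atMost sum_nonneg)
    then have L0: "L > 0" using L by simp
    have "real (card U) \<le> (\<Sum>D\<in>{1..n}. real (card (G D)))" using of_nat_mono[OF total] by simp
    also have "\<dots> < (\<Sum>D\<in>{1..n}. card U / L * inverse (real D))"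
    proof (rule sum_strict_mono)
      fix D assume D: "D \<in> {1..n}"
      then show "real (card (G D)) < card U / L * inverse (real D)"
        using lt[OF D] L0 by (simp add: field_simps)
    qed (use n in auto)
    also have "\<dots> = card U / L * harm n" by (simp add: harm_def sum_distrib_left)
    also have "\<dots> \<le> card U / L * L" by (rule mult_left_mono[OF L]) (use L0 in simp)
    finally show False using L0 by simp
  qed
  then obtain D where D: "D \<in> {1..n}" "real (card U) \<le> L * (card (G D) * D)" by blast
  have "\<exists>X. X \<subseteq> nb b \<and> card X = D" if "b \<in> G D" for b
    using that obtain_subset_with_card_n[of D "nb b"] by (auto simp: G_def)
  then obtain N where N: "\<And>b. b \<in> G D \<Longrightarrow> N b \<subseteq> nb b \<and> card (N b) = D" by metis
  have "G D \<noteq> {}" using D(2) u by auto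
  show ?thesis
  proof (rule that[of "G D" D N])
    show "N b \<subseteq> {..<n}" "card (N b) = D" if "b \<in> G D" for b
      using N[OF that] nb[of b] by auto
    show "{a, b} \<in> U" if "b \<in> G D" "a \<in> N b" for a b
      using N[OF that(1)] that(2) by (auto simp: nb_def)
  qed (use D \<open>G D \<noteq> {}\<close> in \<open>auto simp: G_def\<close>)
qed

text \<open>
  Only the vertices that lie on edges of \<open>F\<close> have to be embedded.
\<close>

definition edge_copies :: "'a ugraph \<Rightarrow> 'b set set set" where
  "edge_copies F = {(`) \<phi> ` edges F |\<phi>. inj_on \<phi> (\<Union>(edges F))}"

text \<open>
  A graph \<open>U\<close> together with a regular part as produced by \<open>regular_part\<close>, of edge density \<open>\<delta>\<close>. The
  assumption \<open>big\<close> makes common neighbourhoods so large that most embeddings are injective; \<open>b\<close> and \<open>q\<close>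
  are what makes the embeddings spread.
\<close>

locale dense_host = semi_bounded_graph F S T v0 r
  for F :: "'a ugraph" and S T v0 r +
  fixes n :: nat and U :: "nat set set" and B :: "nat set" and N :: "nat \<Rightarrow> nat set" and D :: nat
    and \<delta> :: real
  assumes U: "U \<subseteq> nsets {..<n} 2"
    and BA: "B \<subseteq> {..<n}" and B_ne: "B \<noteq> {}" and D_pos: "D \<ge> 1"
    and NA: "\<And>b. b \<in> B \<Longrightarrow> N b \<subseteq> {..<n}" and cardN: "\<And>b. b \<in> B \<Longrightarrow> card (N b) = D"
    and NU: "\<And>b a. b \<in> B \<Longrightarrow> a \<in> N b \<Longrightarrow> {a, b} \<in> U"
    and \<delta>: "\<delta> = real (card B) * real D / real n ^ 2"
    and r: "r \<ge> 1" and big: "\<delta> ^ r * n \<ge> 8 * real (card (verts F)) ^ 3"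
    and m: "two_density F > 0"
    and b: "real n powr (- b_min F S T) \<le> \<delta>"
    and q: "real n powr (- 1 / two_density F) \<le> \<delta>"
begin

text \<open>
  Small enough for the poor stars of all mates together to make up at most a quarter of all stars.
\<close>

definition \<epsilon> :: real where "\<epsilon> = 1 / (4 * (real (card mate_verts) + 1))"

text \<open>
  Up to \<open>\<epsilon>\<close>, the average number of links of \<open>degree F v\<close> random vertices.
\<close>

definition thr :: "'a \<Rightarrow> real" where
  "thr v = \<epsilon> * (real D / real n) ^ degree F v * real (card B)"

lemma finB: "finite B" and cardB: "1 \<le> card B" "card B \<le> n" and n: "n \<ge> 1"
proof -
  show fB: "finite B" using BA finite_subset by blast
  show c: "1 \<le> card B" using fB B_ne by (simp add: Suc_le_eq card_gt_0_iff)
  show "card B \<le> n" using card_mono[OF _ BA] by simp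
  with c show "n \<ge> 1" by linarith
qed

lemma D_le: "D \<le> n"
proof -
  obtain x where "x \<in> B" using B_ne by blast
  then show ?thesis using card_mono[OF _ NA[of x]] cardN[of x] by simp
qed

lemma \<epsilon>_pos: "\<epsilon> > 0" by (simp add: \<epsilon>_def add_nonneg_pos)

lemma \<delta>_scale: "\<delta> * n = card B * (real D / n)"
  using n by (simp add: \<delta> power2_eq_square)

lemma \<delta>_pos: "\<delta> > 0" using cardB(1) D_pos n by (simp add: \<delta>)

lemma \<delta>_le: "\<delta> \<le> real D / n"
proof -
  have "\<delta> * n \<le> n * (real D / n)" unfolding \<delta>_scale using cardB by (intro mult_right_mono) auto
  then show ?thesis using n by (simp add: field_simps)
qed

lemma \<delta>_le_1: "\<delta> \<le> 1"
proof -
  have "real D / n \<le> 1" using D_le n by simp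
  then show ?thesis using \<delta>_le by linarith
qed

lemma density_le: "d \<ge> 1 \<Longrightarrow> n * \<delta> ^ d \<le> card B * (real D / n) ^ d"
  by (rule density_power_le) (use \<delta>_pos \<delta>_le \<delta>_scale in auto)

lemma thr_ge: "v \<in> mate_verts \<Longrightarrow> thr v \<ge> \<epsilon> * (n * \<delta> ^ degree F v)"
  using mult_left_mono[OF density_le[of "degree F v"], of \<epsilon>] degree_mate[of v] \<epsilon>_pos
  by (simp add: thr_def mult_ac)

sublocale star_embeddings S mate_verts nbhd "{..<n}" B N D thr
proof
  show "thr v > 0" for v using \<epsilon>_pos D_pos n cardB by (simp add: thr_def)
qed (use finite_verts nbhd_subset finB NA cardN in auto)

lemma card_nbhd_mate: "v \<in> mate_verts \<Longrightarrow> card (nbhd v) = degree F v"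
  using card_nbhd mate_verts_T by blast

lemma parts_le: "real (card S) + 1 + real (card mate_verts) \<le> real (card (verts F))"
  using card_parts by linarith

lemma big': "\<delta> * n \<ge> 8 * real (card (verts F)) ^ 3" "v \<in> mate_verts \<Longrightarrow> n * \<delta> ^ degree F v \<ge> 8 * real (card (verts F)) ^ 3"
proof -
  have pow: "\<delta> ^ r \<le> \<delta> ^ d" if "d \<le> r" for d
    using power_decreasing[OF that, of \<delta>] \<delta>_pos \<delta>_le_1 by simp
  have "\<delta> ^ r * n \<le> \<delta> ^ 1 * n" using pow[of 1] r by (intro mult_right_mono) auto
  then show "\<delta> * n \<ge> 8 * real (card (verts F)) ^ 3" using big by simp
  assume "v \<in> mate_verts"
  then have "\<delta> ^ r * n \<le> \<delta> ^ degree F v * n" using pow degree_mate[of v] by (intro mult_right_mono) auto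
  then show "n * \<delta> ^ degree F v \<ge> 8 * real (card (verts F)) ^ 3" using big by (simp add: mult.commute)
qed

lemma total_mass:
  "(\<Sum>(b, f, g) | (b, f, g) \<in> embeddings \<and> inj_on f S \<and>
     (inj_on g mate_verts \<and> g ` mate_verts \<inter> insert b (f ` S) = {}). weight f) \<ge> card B * D ^ card S / 4"
proof (rule mass_injective_ge)
  let ?h = "real (card (verts F))" and ?s = "real (card S)" and ?t = "real (card mate_verts)"
  have h: "?s \<le> ?h" "?t + 1 \<le> ?h" "?t \<le> ?h" "1 \<le> ?h" using parts_le by linarith+
  have "4 * (?s * ?s) \<le> 8 * (?h * ?h)" using h by (intro mult_mono) auto
  also have "\<dots> \<le> 8 * ?h ^ 3"
  proof -
    have "?h * ?h * 1 \<le> ?h * ?h * ?h" using h by (intro mult_left_mono) auto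
    then show ?thesis by (simp add: power3_eq_cube)
  qed
  also have "\<dots> \<le> \<delta> * n" by (rule big')
  also have "\<dots> \<le> D" using \<delta>_le n by (simp add: field_simps)
  finally show "real D \<ge> real (4 * card S * card S)" by simp
  have "(\<Sum>v\<in>mate_verts. real (card {..<n}) ^ card (nbhd v) * thr v * real D ^ (card S - card (nbhd v)))
      = (\<Sum>v\<in>mate_verts. \<epsilon> * (card B * real D ^ card S))"
  proof (rule sum.cong)
    fix v assume v: "v \<in> mate_verts"
    have le: "card (nbhd v) \<le> card S" by (rule card_mono[OF finite_verts(2) nbhd_subset])
    have e1: "real n ^ degree F v * (real D / n) ^ degree F v = real D ^ degree F v"
      using n by (simp add: power_divide)
    have e2: "real D ^ degree F v * real D ^ (card S - degree F v) = real D ^ card S"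
      using le card_nbhd_mate[OF v] by (simp add: power_add[symmetric])
    have "real n ^ degree F v * thr v * real D ^ (card S - degree F v) = \<epsilon> * (card B *
        ((real n ^ degree F v * (real D / n) ^ degree F v) * real D ^ (card S - degree F v)))"
      unfolding thr_def by (simp only: mult_ac)
    then show "real (card {..<n}) ^ card (nbhd v) * thr v * real D ^ (card S - card (nbhd v))
        = \<epsilon> * (card B * real D ^ card S)"
      unfolding card_nbhd_mate[OF v] card_lessThan e1 e2 .
  qed simp
  also have "\<dots> = (?t * \<epsilon>) * (card B * real D ^ card S)" by simp
  also have "\<dots> \<le> 1 / 4 * (card B * real D ^ card S)"
  proof (rule mult_right_mono)
    show "?t * \<epsilon> \<le> 1 / 4" unfolding \<epsilon>_def by (simp add: divide_simps add_nonneg_pos)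
  qed simp
  finally show "(\<Sum>v\<in>mate_verts. real (card {..<n} ^ card (nbhd v)) * thr v * real (D ^ (card S - card (nbhd v))))
      \<le> real (card B * D ^ card S) / 4" by simp
  fix v assume v: "v \<in> mate_verts"
  have "2 * ?t * (?s + 1 + ?t) * (4 * (?t + 1)) = 8 * (?t * (?s + 1 + ?t) * (?t + 1))" by simp
  also have "\<dots> \<le> 8 * (?h * ?h * ?h)"
    using h parts_le by (intro mult_left_mono mult_mono) auto
  also have "\<dots> \<le> n * \<delta> ^ degree F v" using big'(2)[OF v] by (simp add: power3_eq_cube)
  finally have "2 * ?t * (?s + 1 + ?t) \<le> \<epsilon> * (n * \<delta> ^ degree F v)"
    unfolding \<epsilon>_def by (simp add: pos_le_divide_eq add_nonneg_pos)
  also have "\<dots> \<le> thr v" by (rule thr_ge[OF v])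
  finally show "real (2 * card mate_verts * (card S + 1 + card mate_verts)) \<le> thr v"
    by (simp add: algebra_simps)
qed

text \<open>
  The bounds for prescribed stars and mates are replaced, factor by factor, by their counterparts in a
  graph with \<open>n\<close> centres of degree \<open>\<delta> * n\<close> (\<open>density_le\<close>). The exponents of \<open>n\<close> and \<open>\<delta>\<close> then add up to
  \<open>card (\<Union>\<sigma>)\<close> and \<open>f_val F S T (\<Union>\<sigma>)\<close>.
\<close>

lemma prescribed_mass:
  assumes \<sigma>: "\<sigma> \<subseteq> edges F" "\<sigma> \<noteq> {}"
  shows "(\<Sum>(b, f, g) | (b, f, g) \<in> embeddings \<and>
      ((v0 \<in> \<Union>\<sigma> \<longrightarrow> b = \<psi> v0) \<and> (\<forall>s\<in>S \<inter> \<Union>\<sigma>. f s = \<psi> s)) \<and> (\<forall>v\<in>mate_verts \<inter> \<Union>\<sigma>. g v = \<psi> v). weight f)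
    \<le> (card B * real D ^ card S) * ((1 / \<epsilon>) ^ card mate_verts *
        (1 / (\<delta> * real n ^ 2) * (real n powr (- 1 / two_density F) / \<delta>) ^ (card \<sigma> - 1)))"
    (is "?mass \<le> _")
proof -
  let ?\<nu> = "\<Union>\<sigma>"
  let ?a = "card (S \<inter> ?\<nu>)" and ?e = "e_ind F ?\<nu>"
  let ?q = "real n powr (- 1 / two_density F) / \<delta>"
  obtain v1 where v1: "v1 \<in> T \<inter> ?\<nu>" "v0 \<in> ?\<nu> \<longrightarrow> v1 = v0"
    and f: "f_val F S T ?\<nu> = int (?a + (\<Sum>v\<in>T \<inter> ?\<nu> - {v1}. degree F v))"
    by (rule f_val_spanned[OF \<sigma>])
  define R where "R = T \<inter> ?\<nu> - {v1}"
  define f where "f = ?a + (\<Sum>v\<in>R. degree F v)"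
  have fv: "f_val F S T ?\<nu> = int f" unfolding f_def R_def by (rule f)
  have fin: "finite (S \<inter> ?\<nu>)" "finite (T \<inter> ?\<nu>)" using finite_verts by auto
  then have finR: "finite R" by (simp add: R_def)
  have a: "?a \<ge> 1" using fin(1) card_spanned(1)[OF \<sigma>] by (simp add: Suc_le_eq card_gt_0_iff)
  have Rm: "R \<subseteq> mate_verts" using spanned_mates[OF \<sigma>(1)] v1 by (auto simp: R_def)
  have cT: "card (T \<inter> ?\<nu>) = Suc (card R)"
    using card_Suc_Diff1[OF fin(2) v1(1)] by (simp add: R_def)
  have c\<nu>: "card ?\<nu> = 1 + ?a + card R" using card_spanned(3)[OF \<sigma>] cT by simp
  have mass: "?mass \<le> D ^ card (S - S \<inter> ?\<nu>) * (\<Prod>v\<in>R. 1 / thr v)"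
  proof (cases "v0 \<in> ?\<nu>")
    case True
    then have "R = mate_verts \<inter> ?\<nu>"
      using v1 spanned_mates[OF \<sigma>(1)] mate_verts_T by (auto simp: R_def mate_verts_def)
    then show ?thesis
      using mass_fixed_centre_le[of "S \<inter> ?\<nu>" "mate_verts \<inter> ?\<nu>" "\<psi> v0" \<psi>] True by simp
  next
    case False
    then have eq: "T \<inter> ?\<nu> = mate_verts \<inter> ?\<nu>" using spanned_mates[OF \<sigma>(1)] mate_verts_T by auto
    have "?mass \<le> D ^ card (S - S \<inter> ?\<nu>) * (\<Prod>v\<in>mate_verts \<inter> ?\<nu> - {v1}. 1 / thr v)"
      using mass_fixed_mate_le[of "S \<inter> ?\<nu>" "mate_verts \<inter> ?\<nu>" v1 \<psi>] False v1 eq by simp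
    then show ?thesis by (simp add: R_def eq)
  qed
  have D0: "real D > 0" and n0: "real n > 0" and B0: "real (card B) > 0" using D_pos n cardB by auto
  \<comment> \<open>The images of the first vertex and of the prescribed leaves.\<close>
  have star: "1 / (card B * real D ^ ?a) \<le> 1 / (real n ^ (?a + 1) * \<delta> ^ ?a)"
  proof (rule divide_left_mono)
    have "real n ^ (?a + 1) * \<delta> ^ ?a = real n ^ ?a * (n * \<delta> ^ ?a)" by simp
    also have "\<dots> \<le> real n ^ ?a * (card B * (real D / n) ^ ?a)"
      by (rule mult_left_mono[OF density_le[OF a]]) simp
    also have "\<dots> = card B * real D ^ ?a" using n0 by (simp add: power_divide)
    finally show "real n ^ (?a + 1) * \<delta> ^ ?a \<le> card B * real D ^ ?a" .
  qed (use D0 B0 n0 \<delta>_pos in auto)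
  \<comment> \<open>The images of the other prescribed vertices of \<open>T\<close>.\<close>
  have mates: "(\<Prod>v\<in>R. 1 / thr v) \<le> (\<Prod>v\<in>R. 1 / \<epsilon> * (1 / (n * \<delta> ^ degree F v)))"
  proof (rule prod_mono)
    fix v assume "v \<in> R"
    then have v: "v \<in> mate_verts" using Rm by blast
    have "1 / thr v \<le> 1 / (\<epsilon> * (n * \<delta> ^ degree F v))"
      by (rule divide_left_mono[OF thr_ge[OF v]]) (use \<epsilon>_pos n0 \<delta>_pos \<theta>[OF v] in auto)
    then show "0 \<le> 1 / thr v \<and> 1 / thr v \<le> 1 / \<epsilon> * (1 / (n * \<delta> ^ degree F v))"
      using \<theta>[OF v] by (simp add: less_imp_le)
  qed
  have "(\<Prod>v\<in>R. 1 / \<epsilon> * (1 / (n * \<delta> ^ degree F v)))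
      = (1 / \<epsilon>) ^ card R * (1 / (real n ^ card R * \<delta> ^ (\<Sum>v\<in>R. degree F v)))"
    by (simp add: prod.distrib prod_dividef power_sum power_divide)
  also have "\<dots> \<le> (1 / \<epsilon>) ^ card mate_verts * (1 / (real n ^ card R * \<delta> ^ (\<Sum>v\<in>R. degree F v)))"
  proof (rule mult_right_mono)
    have "1 / \<epsilon> \<ge> 1" by (simp add: \<epsilon>_def)
    then show "(1 / \<epsilon>) ^ card R \<le> (1 / \<epsilon>) ^ card mate_verts"
      by (intro power_increasing card_mono Rm finite_verts)
  qed (use \<delta>_pos in simp)
  finally have mates': "(\<Prod>v\<in>R. 1 / thr v)
      \<le> (1 / \<epsilon>) ^ card mate_verts * (1 / (real n ^ card R * \<delta> ^ (\<Sum>v\<in>R. degree F v)))"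
    using mates by linarith
  have Dsplit: "real D ^ card (S - S \<inter> ?\<nu>) = (card B * real D ^ card S) * (1 / (card B * real D ^ ?a))"
  proof -
    have "card S = card (S - S \<inter> ?\<nu>) + ?a"
      using card_Diff_subset[OF fin(1), of S] card_mono[OF finite_verts(2), of "S \<inter> ?\<nu>"] by simp
    then have "real D ^ card S = real D ^ card (S - S \<inter> ?\<nu>) * real D ^ ?a"
      by (metis power_add)
    then show ?thesis using D0 B0 by simp
  qed
  have nn1: "0 \<le> (\<Prod>v\<in>R. 1 / thr v)"
    using \<theta> Rm by (intro prod_nonneg) (auto simp: less_imp_le)
  have expo: "1 / (real n ^ card ?\<nu> * \<delta> ^ f) \<le> 1 / (\<delta> * real n ^ 2) * ?q ^ (?e - 1)"
  proof (rule spread_exponents[where g = "real (card ?\<nu>) - 2 - (real ?e - 1) / two_density F"])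
    show "?e \<ge> 1" using spanned_e_ind[OF \<sigma>(1)] \<sigma>(2) finite_subset[OF \<sigma>(1) finite_edges]
      by (metis One_nat_def Suc_leI card_gt_0_iff order_trans)
    show "0 \<le> real (card ?\<nu>) - 2 - (real ?e - 1) / two_density F"
      using spanned_density[OF \<sigma> m] by simp
    assume less: "?e < f"
    then have "?\<nu> \<in> B_set F S T" using spanned_in_B_set[OF \<sigma>] fv by simp
    then have "b_min F S T \<le> b_val F S T ?\<nu>" by (rule b_min_le)
    also have "b_val F S T ?\<nu> = (real (card ?\<nu>) - 2 - (real ?e - 1) / two_density F) / (real f - real ?e)"
      unfolding b_val_def fv by simp
    finally have "real n powr (- ((real (card ?\<nu>) - 2 - (real ?e - 1) / two_density F) / (real f - real ?e)))
      \<le> real n powr (- b_min F S T)" using n by (intro powr_mono) auto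
    then show "real n powr (- ((real (card ?\<nu>) - 2 - (real ?e - 1) / two_density F) / (real f - real ?e))) \<le> \<delta>"
      using b by linarith
  qed (use n \<delta>_pos \<delta>_le_1 in auto)
  have q1: "0 \<le> ?q" "?q \<le> 1" using q \<delta>_pos by auto
  \<comment> \<open>Fewer than all induced edges may be prescribed; this only helps, as \<open>?q \<le> 1\<close>.\<close>
  have qe: "?q ^ (?e - 1) \<le> ?q ^ (card \<sigma> - 1)"
    using spanned_e_ind[OF \<sigma>(1)] q1 by (intro power_decreasing) auto
  have "D ^ card (S - S \<inter> ?\<nu>) * (\<Prod>v\<in>R. 1 / thr v)
      = (card B * real D ^ card S) * ((1 / (card B * real D ^ ?a)) * (\<Prod>v\<in>R. 1 / thr v))"
    using Dsplit by simp
  also have "\<dots> \<le> (card B * real D ^ card S) * ((1 / (real n ^ (?a + 1) * \<delta> ^ ?a)) *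
      ((1 / \<epsilon>) ^ card mate_verts * (1 / (real n ^ card R * \<delta> ^ (\<Sum>v\<in>R. degree F v)))))"
    by (intro mult_left_mono mult_mono star mates') (use nn1 \<delta>_pos in auto)
  also have "(1 / (real n ^ (?a + 1) * \<delta> ^ ?a)) *
      ((1 / \<epsilon>) ^ card mate_verts * (1 / (real n ^ card R * \<delta> ^ (\<Sum>v\<in>R. degree F v))))
      = (1 / \<epsilon>) ^ card mate_verts * (1 / (real n ^ card ?\<nu> * \<delta> ^ f))"
    unfolding c\<nu> f_def by (simp add: power_add)
  also have "(card B * real D ^ card S) * ((1 / \<epsilon>) ^ card mate_verts * (1 / (real n ^ card ?\<nu> * \<delta> ^ f)))
     \<le> (card B * real D ^ card S) * ((1 / \<epsilon>) ^ card mate_verts * (1 / (\<delta> * real n ^ 2) * ?q ^ (card \<sigma> - 1)))"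
  proof (intro mult_left_mono)
    have "1 / (\<delta> * real n ^ 2) * ?q ^ (?e - 1) \<le> 1 / (\<delta> * real n ^ 2) * ?q ^ (card \<sigma> - 1)"
      by (rule mult_left_mono[OF qe]) (use \<delta>_pos in simp)
    then show "1 / (real n ^ card ?\<nu> * \<delta> ^ f) \<le> 1 / (\<delta> * real n ^ 2) * ?q ^ (card \<sigma> - 1)"
      using expo by linarith
  qed (use \<epsilon>_pos in auto)
  finally show ?thesis using mass by linarith
qed


definition assemble :: "nat \<times> ('a \<Rightarrow> nat) \<times> ('a \<Rightarrow> nat) \<Rightarrow> 'a \<Rightarrow> nat" where
  "assemble = (\<lambda>(b, f, g) x. if x = v0 then b else if x \<in> S then f x else g x)"

definition image_edges :: "nat \<times> ('a \<Rightarrow> nat) \<times> ('a \<Rightarrow> nat) \<Rightarrow> nat set set" where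
  "image_edges z = (`) (assemble z) ` edges F"

definition inj_embeddings :: "(nat \<times> ('a \<Rightarrow> nat) \<times> ('a \<Rightarrow> nat)) set" where
  "inj_embeddings = {(b, f, g). (b, f, g) \<in> embeddings \<and> inj_on f S \<and>
     (inj_on g mate_verts \<and> g ` mate_verts \<inter> insert b (f ` S) = {})}"

text \<open>
  The factor \<open>4 / (card B * D ^ card S)\<close> makes the total over all injective embeddings at least 1, by
  \<open>total_mass\<close>.
\<close>

definition normalized_weight :: "nat \<times> ('a \<Rightarrow> nat) \<times> ('a \<Rightarrow> nat) \<Rightarrow> real" where
  "normalized_weight = (\<lambda>(b, f, g). 4 / (card B * real D ^ card S) * weight f)"

definition copy_weight :: "nat set set \<Rightarrow> real" where
  "copy_weight E = (\<Sum>z | z \<in> inj_embeddings \<and> image_edges z = E. normalized_weight z)"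

lemma assemble_simps:
  "assemble (b, f, g) v0 = b"
  "s \<in> S \<Longrightarrow> assemble (b, f, g) s = f s"
  "v \<in> mate_verts \<Longrightarrow> assemble (b, f, g) v = g v"
  using v0 mate_verts_T bipartition(2) by (auto simp: assemble_def mate_verts_def)

lemma loop_free: "b \<in> B \<Longrightarrow> b \<notin> N b"
proof
  assume "b \<in> B" "b \<in> N b"
  then have "{b, b} \<in> nsets {..<n} 2" using NU U by blast
  then show False by (simp add: nsets_def)
qed

lemma embeddings_D:
  assumes "(b, f, g) \<in> embeddings"
  shows "b \<in> B" "s \<in> S \<Longrightarrow> f s \<in> N b" "v \<in> mate_verts \<Longrightarrow> g v \<in> B \<and> f ` nbhd v \<subseteq> N (g v)"
  using assms by (auto simp: embeddings_def stars_def mates_def links_def)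

lemma inj_on_assemble:
  assumes z: "z \<in> inj_embeddings"
  shows "inj_on (assemble z) (\<Union>(edges F))"
proof -
  obtain b f g where zz: "z = (b, f, g)" by (cases z)
  have z': "(b, f, g) \<in> embeddings" "inj_on f S" "inj_on g mate_verts"
    "g ` mate_verts \<inter> insert b (f ` S) = {}"
    using z by (simp_all add: zz inj_embeddings_def)
  have bf: "b \<noteq> f s" if "s \<in> S" for s
    using embeddings_D(1,2)[OF z'(1)] loop_free that by metis
  have gb: "g v \<noteq> b" "s \<in> S \<Longrightarrow> g v \<noteq> f s" if "v \<in> mate_verts" for v s
    using z'(4) that by auto
  have "inj_on (assemble z) (S \<union> insert v0 mate_verts)"
  proof (rule inj_onI)
    fix x y assume x: "x \<in> S \<union> insert v0 mate_verts" and y: "y \<in> S \<union> insert v0 mate_verts"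
      and eq: "assemble z x = assemble z y"
    consider "x \<in> S" | "x = v0" | "x \<in> mate_verts" using x by blast
    then show "x = y"
    proof cases
      case 1
      consider "y \<in> S" | "y = v0" | "y \<in> mate_verts" using y by blast
      then show ?thesis
      proof cases
        case 11: 1
        then show ?thesis using eq z'(2) 1 by (auto simp: zz assemble_simps inj_on_def)
      next
        case 2
        then show ?thesis using eq bf[OF 1] 1 by (simp add: zz assemble_simps)
      next
        case 3
        then show ?thesis using eq gb(2)[OF 3 1] 1 by (simp add: zz assemble_simps)
      qed
    next
      case 2
      consider "y \<in> S" | "y = v0" | "y \<in> mate_verts" using y by blast
      then show ?thesis
      proof cases
        case 1
        then show ?thesis using eq bf[OF 1] 2 by (simp add: zz assemble_simps)
      next
        case 22: 2
        then show ?thesis using 2 by simp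
      next
        case 3
        then show ?thesis using eq gb(1)[OF 3] 2 by (simp add: zz assemble_simps)
      qed
    next
      case 3
      consider "y \<in> S" | "y = v0" | "y \<in> mate_verts" using y by blast
      then show ?thesis
      proof cases
        case 1
        then show ?thesis using eq gb(2)[OF 3 1] 3 by (simp add: zz assemble_simps)
      next
        case 2
        then show ?thesis using eq gb(1)[OF 3] 3 by (simp add: zz assemble_simps)
      next
        case 33: 3
        then show ?thesis using eq z'(3) 3 by (auto simp: zz assemble_simps inj_on_def)
      qed
    qed
  qed
  then show ?thesis using Union_edges by (rule inj_on_subset)
qed

lemma image_edges_subset:
  assumes z: "z \<in> embeddings"
  shows "image_edges z \<subseteq> U"
proof
  obtain b f g where zz: "z = (b, f, g)" by (cases z)
  note D = embeddings_D[OF z[unfolded zz]]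
  fix e assume "e \<in> image_edges z"
  then obtain e' where e': "e' \<in> edges F" "e = assemble z ` e'" by (auto simp: image_edges_def)
  obtain s v where sv: "s \<in> S" "s \<in> nbhd v" "v \<in> insert v0 mate_verts" "e' = {s, v}"
    by (rule edge_cases[OF e'(1)])
  show "e \<in> U"
  proof (cases "v = v0")
    case True
    then have "e = {f s, b}" using e'(2) sv by (simp add: zz assemble_simps)
    then show ?thesis using NU[OF D(1) D(2)[OF sv(1)]] by simp
  next
    case False
    then have v: "v \<in> mate_verts" using sv(3) by simp
    then have "e = {f s, g v}" using e'(2) sv by (simp add: zz assemble_simps)
    moreover have "f s \<in> N (g v)" "g v \<in> B" using D(3)[OF v] sv(2) by auto
    ultimately show ?thesis using NU by simp
  qed
qed

lemma inj_embeddings_sub: "inj_embeddings \<subseteq> embeddings" and fin_inj_embeddings: "finite inj_embeddings"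
proof -
  show sub: "inj_embeddings \<subseteq> embeddings" by (auto simp: inj_embeddings_def)
  show "finite inj_embeddings" by (rule finite_subset[OF sub fin_embeddings])
qed

lemma normalized_weight_nonneg: "normalized_weight z \<ge> 0"
  using weight_nonneg by (cases z) (simp add: normalized_weight_def)

lemma card_image_edges: "z \<in> inj_embeddings \<Longrightarrow> card (image_edges z) = card (edges F)"
  unfolding image_edges_def by (rule card_image) (rule inj_on_image, rule inj_on_assemble)

lemma finU: "finite U"
  using U finite_imp_finite_nsets[of "{..<n}" 2] finite_subset by blast

lemma copy_weight_nonneg: "copy_weight E \<ge> 0"
  unfolding copy_weight_def by (rule sum_nonneg) (rule normalized_weight_nonneg)

lemma copy_weight_support:
  assumes "copy_weight E \<noteq> 0"
  shows "E \<subseteq> U \<and> card E = card (edges F)" "E \<in> edge_copies F"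
proof -
  have "{z. z \<in> inj_embeddings \<and> image_edges z = E} \<noteq> {}"
    using assms unfolding copy_weight_def by (metis sum.empty)
  then obtain z where z: "z \<in> inj_embeddings" "image_edges z = E" by blast
  have "z \<in> embeddings" using z(1) inj_embeddings_sub by blast
  from image_edges_subset[OF this] show "E \<subseteq> U \<and> card E = card (edges F)"
    using card_image_edges[OF z(1)] z(2) by simp
  show "E \<in> edge_copies F"
    using inj_on_assemble[OF z(1)] z(2) by (auto simp: edge_copies_def image_edges_def)
qed

lemma copy_weight_total: "sum copy_weight (Pow U) \<ge> 1"
proof -
  let ?H = "card B * real D ^ card S"
  have H: "?H > 0" using cardB D_pos by simp
  have img: "image_edges ` inj_embeddings \<subseteq> Pow U"
    using image_edges_subset inj_embeddings_sub by blast
  have "1 = 4 / ?H * (?H / 4)" using less_imp_neq[OF H] by (simp only: times_divide_times_eq) simp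
  also have "\<dots> \<le> 4 / ?H * (\<Sum>(b, f, g)\<in>inj_embeddings. weight f)"
    using total_mass H unfolding inj_embeddings_def by (intro mult_left_mono) auto
  also have "\<dots> = (\<Sum>z\<in>inj_embeddings. normalized_weight z)"
    unfolding sum_distrib_left normalized_weight_def by (rule sum.cong) auto
  also have "\<dots> = (\<Sum>E\<in>Pow U. \<Sum>z | z \<in> inj_embeddings \<and> image_edges z = E. normalized_weight z)"
    using sum.group[OF fin_inj_embeddings _ img, of normalized_weight] finU by simp
  also have "\<dots> = sum copy_weight (Pow U)" by (simp add: copy_weight_def)
  finally show ?thesis .
qed

lemma weighted_degree_copy_weight: "weighted_degree U copy_weight \<sigma> = (\<Sum>z | z \<in> inj_embeddings \<and> \<sigma> \<subseteq> image_edges z. normalized_weight z)"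
proof -
  let ?Z = "{z. z \<in> inj_embeddings \<and> \<sigma> \<subseteq> image_edges z}"
  let ?E = "{E. E \<subseteq> U \<and> \<sigma> \<subseteq> E}"
  have finZ: "finite ?Z" using fin_inj_embeddings by simp
  have finE: "finite ?E" using finU by simp
  have img: "image_edges ` ?Z \<subseteq> ?E"
    using image_edges_subset inj_embeddings_sub by blast
  have "(\<Sum>z\<in>?Z. normalized_weight z) = (\<Sum>E\<in>?E. \<Sum>z | z \<in> ?Z \<and> image_edges z = E. normalized_weight z)"
    by (rule sum.group[OF finZ finE img, symmetric])
  also have "\<dots> = (\<Sum>E\<in>?E. copy_weight E)"
    unfolding copy_weight_def by (intro sum.cong) auto
  finally show ?thesis by (simp add: weighted_degree_def)
qed

text \<open>
  If a copy contains \<open>\<sigma>\<close>, then some set \<open>\<sigma>'\<close> of edges of \<open>F\<close> is mapped onto \<open>\<sigma>\<close>, and this fixes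
  the images of the vertices spanned by \<open>\<sigma>'\<close> to be some map \<open>\<psi>\<close> into \<open>\<Union>\<sigma>\<close>. The number of pairs
  \<open>(\<sigma>', \<psi>)\<close> is bounded in terms of \<open>F\<close>, and \<open>prescribed_mass\<close> applies to each of them.
\<close>

lemma copy_weight_spread:
  assumes \<sigma>: "\<sigma> \<subseteq> U" "\<sigma> \<noteq> {}"
  defines "h \<equiv> card (verts F)" and "k \<equiv> card (edges F)"
  shows "weighted_degree U copy_weight \<sigma> \<le> (2 ^ k * (2 * real k) ^ h * 4 * (4 * real h) ^ h) *
     (1 / (\<delta> * real n ^ 2) * (real n powr (- 1 / two_density F) / \<delta>) ^ (card \<sigma> - 1))"
proof -
  let ?X = "1 / (\<delta> * real n ^ 2) * (real n powr (- 1 / two_density F) / \<delta>) ^ (card \<sigma> - 1)"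
  let ?P = "SIGMA \<sigma>':{\<sigma>'. \<sigma>' \<subseteq> edges F \<and> card \<sigma>' = card \<sigma>}. (\<Union>\<sigma>' \<rightarrow>\<^sub>E \<Union>\<sigma>)"
  let ?A = "\<lambda>(\<sigma>', \<psi>). {(b, f, g). (b, f, g) \<in> embeddings \<and>
      ((v0 \<in> \<Union>\<sigma>' \<longrightarrow> b = \<psi> v0) \<and> (\<forall>s\<in>S \<inter> \<Union>\<sigma>'. f s = \<psi> s)) \<and> (\<forall>v\<in>mate_verts \<inter> \<Union>\<sigma>'. g v = \<psi> v)}"
  let ?H = "card B * real D ^ card S"
  have H: "?H > 0" using cardB D_pos by simp
  have cancel: "4 / c * (c * y) = 4 * y" if "c > 0" for c y :: real using that by simp
  have k: "k \<ge> 1" using has_edge finite_edges by (simp add: k_def Suc_le_eq card_gt_0_iff)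
  have h: "h \<ge> 1" using parts_le by (simp add: h_def)
  have fin\<sigma>: "finite \<sigma>" using \<sigma>(1) finU by (rule finite_subset)
  have c\<sigma>: "card \<sigma> \<noteq> 0" using fin\<sigma> \<sigma>(2) by simp
  have edge2: "finite e \<and> card e = 2" if "e \<in> \<sigma>" for e using that \<sigma>(1) U by (auto simp: nsets_def)
  have finU\<sigma>: "finite (\<Union>\<sigma>)" using fin\<sigma> edge2 by blast
  have cU\<sigma>: "card (\<Union>\<sigma>) \<le> 2 * card \<sigma>"
  proof -
    have "card (\<Union>\<sigma>) \<le> (\<Sum>e\<in>\<sigma>. card e)" using card_UN_le[OF fin\<sigma>, of "\<lambda>e. e"] by simp
    also have "\<dots> = (\<Sum>e\<in>\<sigma>. 2)" by (rule sum.cong) (use edge2 in auto)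
    finally show ?thesis by simp
  qed
  have fin\<sigma>': "finite {\<sigma>'. \<sigma>' \<subseteq> edges F \<and> card \<sigma>' = card \<sigma>}"
    by (rule finite_subset[of _ "Pow (edges F)"]) (use finite_edges in auto)
  have fin\<nu>: "finite (\<Union>\<sigma>')" "card (\<Union>\<sigma>') \<le> h" if "\<sigma>' \<subseteq> edges F" for \<sigma>'
    using finite_subset[OF spanned_subset[OF that] finite_verts(1)]
      card_mono[OF finite_verts(1) spanned_subset[OF that]] by (auto simp: h_def)
  have finPi: "finite (\<Union>\<sigma>' \<rightarrow>\<^sub>E \<Union>\<sigma>)" if "\<sigma>' \<subseteq> edges F" for \<sigma>'
    using fin\<nu>(1)[OF that] finU\<sigma> by (intro finite_PiE) auto
  have finP: "finite ?P" using fin\<sigma>' finPi by (intro finite_SigmaI) auto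
  have finA: "finite (?A p)" for p
  proof (cases p)
    case (Pair \<sigma>' \<psi>)
    show ?thesis by (rule finite_subset[OF _ fin_embeddings]) (auto simp: Pair)
  qed
  have cover: "{z. z \<in> inj_embeddings \<and> \<sigma> \<subseteq> image_edges z} \<subseteq> (\<Union>p\<in>?P. ?A p)"
  proof
    fix z assume "z \<in> {z. z \<in> inj_embeddings \<and> \<sigma> \<subseteq> image_edges z}"
    then have z: "z \<in> inj_embeddings" and sub: "\<sigma> \<subseteq> image_edges z" by auto
    obtain b f g where zz: "z = (b, f, g)" by (cases z)
    define \<sigma>' where "\<sigma>' = {e \<in> edges F. assemble z ` e \<in> \<sigma>}"
    have \<sigma>'F: "\<sigma>' \<subseteq> edges F" by (auto simp: \<sigma>'_def)
    have im: "(`) (assemble z) ` \<sigma>' = \<sigma>" using sub by (auto simp: \<sigma>'_def image_edges_def)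
    have "inj_on ((`) (assemble z)) (edges F)" by (rule inj_on_image[OF inj_on_assemble[OF z]])
    then have "inj_on ((`) (assemble z)) \<sigma>'" using \<sigma>'F by (rule inj_on_subset)
    then have card: "card \<sigma>' = card \<sigma>" using card_image im by metis
    define \<psi> where "\<psi> = restrict (assemble z) (\<Union>\<sigma>')"
    have "\<psi> \<in> \<Union>\<sigma>' \<rightarrow>\<^sub>E \<Union>\<sigma>"
    proof (rule PiE_I)
      fix x assume x: "x \<in> \<Union>\<sigma>'"
      then obtain e where "e \<in> \<sigma>'" "x \<in> e" by blast
      then have "assemble z x \<in> assemble z ` e" "assemble z ` e \<in> \<sigma>" by (auto simp: \<sigma>'_def)
      then show "\<psi> x \<in> \<Union>\<sigma>" using x by (auto simp: \<psi>_def)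
    qed (simp add: \<psi>_def)
    then have "(\<sigma>', \<psi>) \<in> ?P" using \<sigma>'F card by simp
    moreover have "z \<in> ?A (\<sigma>', \<psi>)"
      using z inj_embeddings_sub by (auto simp: zz \<psi>_def assemble_simps)
    ultimately show "z \<in> (\<Union>p\<in>?P. ?A p)" by blast
  qed
  have each: "sum normalized_weight (?A p) \<le> 4 * (4 * real h) ^ h * ?X" if p: "p \<in> ?P" for p
  proof -
    obtain \<sigma>' \<psi> where pp: "p = (\<sigma>', \<psi>)" by (cases p)
    have \<sigma>': "\<sigma>' \<subseteq> edges F" "card \<sigma>' = card \<sigma>" using p pp by auto
    have ne: "\<sigma>' \<noteq> {}" using \<sigma>'(2) c\<sigma> by auto
    have "sum normalized_weight (?A p) = 4 / ?H * (\<Sum>(b, f, g)\<in>?A p. weight f)"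
      unfolding sum_distrib_left normalized_weight_def by (rule sum.cong) auto
    also have "\<dots> \<le> 4 / ?H * (?H * ((1 / \<epsilon>) ^ card mate_verts * ?X))"
      using prescribed_mass[OF \<sigma>'(1) ne, of \<psi>] H unfolding pp \<sigma>'(2)
      by (intro mult_left_mono) simp_all
    also have "4 / ?H * (?H * ((1 / \<epsilon>) ^ card mate_verts * ?X)) = 4 * (1 / \<epsilon>) ^ card mate_verts * ?X"
      using cancel[of ?H "(1 / \<epsilon>) ^ card mate_verts * ?X"] H by (simp only: mult.assoc)
    also have "\<dots> \<le> 4 * (4 * real h) ^ h * ?X"
    proof (intro mult_right_mono mult_left_mono)
      have "(1 / \<epsilon>) ^ card mate_verts \<le> (4 * real h) ^ card mate_verts"
        using parts_le by (intro power_mono) (auto simp: \<epsilon>_def h_def)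
      also have "\<dots> \<le> (4 * real h) ^ h"
        using parts_le h by (intro power_increasing) (auto simp: h_def)
      finally show "(1 / \<epsilon>) ^ card mate_verts \<le> (4 * real h) ^ h" .
    qed (use \<delta>_pos in auto)
    finally show ?thesis .
  qed
  have X: "?X \<ge> 0" using \<delta>_pos by simp
  have cardP: "real (card ?P) \<le> 2 ^ k * (2 * real k) ^ h"
  proof -
    have "card ?P = (\<Sum>\<sigma>'\<in>{\<sigma>'. \<sigma>' \<subseteq> edges F \<and> card \<sigma>' = card \<sigma>}. card (\<Union>\<sigma>' \<rightarrow>\<^sub>E \<Union>\<sigma>))"
      by (rule card_SigmaI) (use fin\<sigma>' finPi in auto)
    also have "\<dots> \<le> (\<Sum>\<sigma>'\<in>{\<sigma>'. \<sigma>' \<subseteq> edges F \<and> card \<sigma>' = card \<sigma>}. (2 * k) ^ h)"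
    proof (rule sum_mono)
      fix \<sigma>' assume "\<sigma>' \<in> {\<sigma>'. \<sigma>' \<subseteq> edges F \<and> card \<sigma>' = card \<sigma>}"
      then have \<sigma>': "\<sigma>' \<subseteq> edges F" "card \<sigma>' = card \<sigma>" by auto
      have "card \<sigma> \<le> k" using card_mono[OF finite_edges \<sigma>'(1)] \<sigma>'(2) by (simp add: k_def)
      then have "card (\<Union>\<sigma>) \<le> 2 * k" using cU\<sigma> by linarith
      have "card (\<Union>\<sigma>' \<rightarrow>\<^sub>E \<Union>\<sigma>) = card (\<Union>\<sigma>) ^ card (\<Union>\<sigma>')"
        using fin\<nu>(1)[OF \<sigma>'(1)] by (simp add: card_PiE)
      also have "\<dots> \<le> (2 * k) ^ card (\<Union>\<sigma>')" by (rule power_mono) (use \<open>card (\<Union>\<sigma>) \<le> 2 * k\<close> in auto)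
      also have "\<dots> \<le> (2 * k) ^ h" by (rule power_increasing) (use fin\<nu>(2)[OF \<sigma>'(1)] k in auto)
      finally show "card (\<Union>\<sigma>' \<rightarrow>\<^sub>E \<Union>\<sigma>) \<le> (2 * k) ^ h" .
    qed
    also have "\<dots> \<le> 2 ^ k * (2 * k) ^ h"
    proof -
      have "card {\<sigma>'. \<sigma>' \<subseteq> edges F \<and> card \<sigma>' = card \<sigma>} \<le> card (Pow (edges F))"
        by (rule card_mono) (use finite_edges in auto)
      then show ?thesis using finite_edges by (simp add: card_Pow k_def)
    qed
    finally have "real (card ?P) \<le> real (2 ^ k * (2 * k) ^ h)" by (rule of_nat_mono)
    then show ?thesis by simp
  qed
  have "weighted_degree U copy_weight \<sigma> \<le> sum normalized_weight (\<Union>p\<in>?P. ?A p)"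
    unfolding weighted_degree_copy_weight
    by (rule sum_mono2[OF finite_UN_I[OF finP finA] cover]) (rule normalized_weight_nonneg)
  also have "\<dots> \<le> (\<Sum>p\<in>?P. sum normalized_weight (?A p))"
    by (rule sum_UNION_le[OF finP finA normalized_weight_nonneg])
  also have "\<dots> \<le> (\<Sum>p\<in>?P. 4 * (4 * real h) ^ h * ?X)" by (rule sum_mono[OF each])
  also have "\<dots> = real (card ?P) * (4 * (4 * real h) ^ h * ?X)" by simp
  also have "\<dots> \<le> (2 ^ k * (2 * real k) ^ h) * (4 * (4 * real h) ^ h * ?X)"
    by (rule mult_right_mono[OF cardP]) (intro mult_nonneg_nonneg X, simp_all)
  finally show ?thesis by (simp only: mult.assoc)
qed

end

section \<open>Union bound over containers\<close>

abbreviation graph_of :: "nat \<Rightarrow> (nat set \<Rightarrow> bool) \<Rightarrow> nat ugraph" where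
  "graph_of n \<omega> \<equiv> \<lparr>verts = {..<n}, edges = {e \<in> nsets {..<n} 2. \<omega> e}\<rparr>"

text \<open>
  Markov's inequality for \<open>2 ^ X\<close>, where \<open>X\<close> is the number of random edges in \<open>C\<close>.
\<close>

lemma prob_many_edges_le:
  assumes p: "0 \<le> p" "p \<le> 1" and V: "finite V" and C: "C \<subseteq> V" and M: "real (card C) \<le> M"
  shows "measure_pmf.prob (Pi_pmf V False (\<lambda>_. bernoulli_pmf p)) {\<omega>. t \<le> real (card (C \<inter> {e \<in> V. \<omega> e}))}
    \<le> 2 powr (- t) * exp (p * M)"
proof -
  let ?P = "Pi_pmf V False (\<lambda>_. bernoulli_pmf p)"
  let ?f = "\<lambda>e b. if e \<in> C \<and> b then (2::real) else 1"
  let ?A = "{\<omega>. t \<le> real (card (C \<inter> {e \<in> V. \<omega> e}))}"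
  have fin: "finite (set_pmf ?P)"
    unfolding set_Pi_pmf[OF V] by (rule finite_PiE_dflt[OF V]) simp
  have pw: "(\<Prod>e\<in>V. ?f e (\<omega> e)) = 2 powr real (card (C \<inter> {e \<in> V. \<omega> e}))" for \<omega>
  proof -
    have "(\<Prod>e\<in>V. ?f e (\<omega> e)) = (\<Prod>e\<in>C \<inter> {e \<in> V. \<omega> e}. 2)"
      by (rule prod.mono_neutral_cong_right) (use V C in auto)
    then show ?thesis by (simp add: powr_realpow)
  qed
  have "measure_pmf.prob ?P ?A = measure_pmf.expectation ?P (indicator ?A)" by simp
  also have "\<dots> \<le> measure_pmf.expectation ?P (\<lambda>\<omega>. 2 powr (- t) * (\<Prod>e\<in>V. ?f e (\<omega> e)))"
  proof (rule integral_mono)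
    fix \<omega>
    show "indicator ?A \<omega> \<le> 2 powr (- t) * (\<Prod>e\<in>V. ?f e (\<omega> e))"
    proof (cases "\<omega> \<in> ?A")
      case True
      have "1 \<le> 2 powr (- t + real (card (C \<inter> {e \<in> V. \<omega> e})))"
        using True by (intro ge_one_powr_ge_zero) auto
      then show ?thesis using True unfolding pw powr_add by simp
    next
      case False
      then show ?thesis by (simp add: prod_nonneg)
    qed
  qed (auto intro: integrable_measure_pmf_finite[OF fin])
  also have "\<dots> = 2 powr (- t) * measure_pmf.expectation ?P (\<lambda>\<omega>. \<Prod>e\<in>V. ?f e (\<omega> e))" by simp
  also have "measure_pmf.expectation ?P (\<lambda>\<omega>. \<Prod>e\<in>V. ?f e (\<omega> e)) =
      (\<Prod>e\<in>V. measure_pmf.expectation (bernoulli_pmf p) (?f e))"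
    by (rule expectation_prod_Pi_pmf[OF V]) (auto intro!: integrable_measure_pmf_finite)
  also have "\<dots> = (\<Prod>e\<in>V. if e \<in> C then 1 + p else 1)"
    by (rule prod.cong) (use p in auto)
  also have "\<dots> = (1 + p) ^ card C"
  proof -
    have "V \<inter> C = C" using C by blast
    then show ?thesis using V by (simp add: prod.If_cases)
  qed
  also have "\<dots> \<le> exp p ^ card C" using p by (intro power_mono) auto
  also have "\<dots> = exp (p * card C)" by (rule exp_of_nat2_mult[symmetric])
  also have "\<dots> \<le> exp (p * M)" using p M by (simp add: mult_left_mono)
  finally show ?thesis by simp
qed

lemma prob_container_le:
  assumes p: "0 \<le> p" "p \<le> 1" and V: "finite V" and fin: "finite \<C>"
    and C: "\<And>C. C \<in> \<C> \<Longrightarrow> C \<subseteq> V \<and> real (card C) \<le> M"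
  shows "measure_pmf.prob (Pi_pmf V False (\<lambda>_. bernoulli_pmf p))
      {\<omega>. \<exists>C\<in>\<C>. t \<le> real (card (C \<inter> {e \<in> V. \<omega> e}))} \<le> card \<C> * (2 powr (- t) * exp (p * M))"
proof -
  let ?P = "Pi_pmf V False (\<lambda>_. bernoulli_pmf p)"
  let ?A = "\<lambda>C. {\<omega>. t \<le> real (card (C \<inter> {e \<in> V. \<omega> e}))}"
  have "{\<omega>. \<exists>C\<in>\<C>. t \<le> real (card (C \<inter> {e \<in> V. \<omega> e}))} = (\<Union>C\<in>\<C>. ?A C)" by auto
  then have "measure_pmf.prob ?P {\<omega>. \<exists>C\<in>\<C>. t \<le> real (card (C \<inter> {e \<in> V. \<omega> e}))}
      = measure_pmf.prob ?P (\<Union>C\<in>\<C>. ?A C)" by simp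
  also have "\<dots> \<le> (\<Sum>C\<in>\<C>. measure_pmf.prob ?P (?A C))"
    by (rule measure_pmf.finite_measure_subadditive_finite[OF fin]) auto
  also have "\<dots> \<le> (\<Sum>C\<in>\<C>. 2 powr (- t) * exp (p * M))"
    by (rule sum_mono) (rule prob_many_edges_le, use p V C in auto)
  finally show ?thesis by simp
qed

text \<open>
  The isolated vertices of \<open>F\<close> are mapped injectively to unused vertices of \<open>H\<close>.
\<close>

lemma contains_copy_of_edge_copy:
  assumes F: "simple_graph F" and H: "simple_graph H" and E: "E \<in> edge_copies F" "E \<subseteq> edges H"
    and large: "card (verts F) \<le> card (verts H)"
  shows "contains_copy H F"
proof -
  let ?W = "\<Union>(edges F)"
  obtain \<phi> where \<phi>: "inj_on \<phi> ?W" "E = (`) \<phi> ` edges F" using E(1) by (auto simp: edge_copies_def)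
  have W: "?W \<subseteq> verts F" and finF: "finite (verts F)"
    using F by (auto simp: simple_graph_def nsets_def)
  have finH: "finite (verts H)" and HV: "\<And>e. e \<in> edges H \<Longrightarrow> e \<subseteq> verts H"
    using H by (auto simp: simple_graph_def nsets_def)
  have im: "\<phi> ` e \<in> edges H" if "e \<in> edges F" for e using that \<phi>(2) E(2) by blast
  have \<phi>W: "\<phi> ` ?W \<subseteq> verts H" using im HV by blast
  have finW: "finite ?W" using W finF by (rule finite_subset)
  have "card (verts F - ?W) = card (verts F) - card ?W" by (rule card_Diff_subset[OF finW W])
  also have "\<dots> \<le> card (verts H) - card (\<phi> ` ?W)"
    using large card_image[OF \<phi>(1)] by simp
  also have "\<dots> = card (verts H - \<phi> ` ?W)"
    by (rule card_Diff_subset[symmetric]) (use finW \<phi>W in auto)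
  finally obtain g where g: "g ` (verts F - ?W) \<subseteq> verts H - \<phi> ` ?W" "inj_on g (verts F - ?W)"
    using card_le_inj[of "verts F - ?W" "verts H - \<phi> ` ?W"] finF finH by blast
  define \<eta> where "\<eta> x = (if x \<in> ?W then \<phi> x else g x)" for x
  have \<eta>W: "\<eta> ` e = \<phi> ` e" if "e \<in> edges F" for e
    by (rule image_cong) (use that in \<open>auto simp: \<eta>_def\<close>)
  have "inj_on \<eta> (?W \<union> (verts F - ?W))"
    unfolding inj_on_Un
  proof (intro conjI)
    show "inj_on \<eta> ?W" using \<phi>(1) by (simp add: \<eta>_def inj_on_def)
    show "inj_on \<eta> (verts F - ?W)" using g(2) by (simp add: \<eta>_def inj_on_def)
    have "\<eta> ` ?W = \<phi> ` ?W" "\<eta> ` (verts F - ?W) = g ` (verts F - ?W)"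
      by (auto simp: \<eta>_def image_def)
    then show "\<eta> ` (?W - (verts F - ?W)) \<inter> \<eta> ` (verts F - ?W - ?W) = {}" using g(1) by blast
  qed
  moreover have "?W \<union> (verts F - ?W) = verts F" using W by blast
  moreover have "\<eta> ` verts F \<subseteq> verts H"
  proof
    fix y assume "y \<in> \<eta> ` verts F"
    then obtain x where x: "x \<in> verts F" "y = \<eta> x" by blast
    show "y \<in> verts H"
    proof (cases "x \<in> ?W")
      case True
      then have "y = \<phi> x" using x(2) by (simp only: \<eta>_def if_True)
      then show ?thesis using imageI[OF True, of \<phi>] \<phi>W by blast
    next
      case False
      then have "y = g x" using x(2) by (simp only: \<eta>_def if_False)
      moreover have "x \<in> verts F - ?W" using x(1) False by (rule DiffI)
      ultimately show ?thesis using imageI[of x "verts F - ?W" g] g(1) by blast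
    qed
  qed
  ultimately have "inj_on \<eta> (verts F)" "\<eta> ` verts F \<subseteq> verts H" by simp_all
  moreover have "\<eta> ` e \<in> edges H" if "e \<in> edges F" for e using \<eta>W[OF that] im[OF that] by simp
  ultimately show ?thesis unfolding contains_copy_def by blast
qed

lemma extremal_number_attained:
  assumes G: "simple_graph G" and F: "edges F \<noteq> {}"
  obtains H where "subgraph H G" "\<not> contains_copy H F" "card (edges H) = extremal_number G F"
proof -
  let ?A = "{card (edges H) |H. subgraph H G \<and> \<not> contains_copy H F}"
  have finE: "finite (edges G)"
    using G finite_imp_finite_nsets[of "verts G" 2] finite_subset by (auto simp: simple_graph_def)
  have "?A \<subseteq> {..card (edges G)}" using card_mono[OF finE] by (auto simp: subgraph_def)
  then have fin: "finite ?A" by (rule finite_subset) simp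
  have "subgraph \<lparr>verts = verts G, edges = {}\<rparr> G" using G by (auto simp: subgraph_def simple_graph_def)
  moreover have "\<not> contains_copy \<lparr>verts = verts G, edges = {}\<rparr> F" using F by (auto simp: contains_copy_def)
  ultimately have ne: "?A \<noteq> {}" by blast
  have "extremal_number G F \<in> ?A" unfolding extremal_number_def by (rule Max_in[OF fin ne])
  then show ?thesis using that by auto
qed

text \<open>
  An \<open>F\<close>-free graph can contain the edges of a copy of \<open>F\<close> if it has too few vertices for the isolated
  vertices of \<open>F\<close>. Such a graph has fewer than \<open>card (verts F) ^ 2\<close> edges, which is why \<open>t\<close> is
  at least that large.
\<close>

lemma large_extremal_number_container:
  assumes F: "simple_graph F" "edges F \<noteq> {}"
    and t: "real (card (verts F) ^ 2) \<le> t" "t < real (extremal_number (graph_of n \<omega>) F)"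
    and cover: "\<And>I. I \<subseteq> nsets {..<n} 2 \<Longrightarrow> (\<And>E. E \<in> edge_copies F \<Longrightarrow> \<not> E \<subseteq> I) \<Longrightarrow> \<exists>C\<in>\<C>. I \<subseteq> C"
  shows "\<exists>C\<in>\<C>. t \<le> real (card (C \<inter> {e \<in> nsets {..<n} 2. \<omega> e}))"
proof -
  have finV: "finite (nsets {..<n} 2)" by (rule finite_imp_finite_nsets) simp
  have "simple_graph (graph_of n \<omega>)" by (auto simp: simple_graph_def)
  then obtain H where H: "subgraph H (graph_of n \<omega>)" "\<not> contains_copy H F"
    "card (edges H) = extremal_number (graph_of n \<omega>) F"
    using extremal_number_attained[OF _ F(2)] by blast
  have sH: "simple_graph H" and EH: "edges H \<subseteq> {e \<in> nsets {..<n} 2. \<omega> e}"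
    using H(1) by (auto simp: subgraph_def)
  have "card (verts F) \<le> card (verts H)"
  proof (rule ccontr)
    assume "\<not> ?thesis"
    then have lt: "card (verts H) \<le> card (verts F)" by simp
    have finH: "finite (verts H)" using sH by (simp add: simple_graph_def)
    have "card (edges H) \<le> card (nsets (verts H) 2)"
      using sH by (intro card_mono finite_imp_finite_nsets) (auto simp: simple_graph_def)
    also have "\<dots> = card (verts H) choose 2" by (rule card_nsets)
    also have "\<dots> \<le> card (verts H) ^ 2"
      by (simp add: choose_two power2_eq_square) (meson div_le_dividend diff_le_self le_trans mult_le_mono2)
    also have "\<dots> \<le> card (verts F) ^ 2" using lt by (rule power_mono) simp
    finally have "real (card (edges H)) \<le> real (card (verts F) ^ 2)" by (rule of_nat_mono)
    then show False using t H(3) by simp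
  qed
  then have "\<not> E \<subseteq> edges H" if "E \<in> edge_copies F" for E
    using contains_copy_of_edge_copy[OF F(1) sH that] H(2) by blast
  then obtain C where C: "C \<in> \<C>" "edges H \<subseteq> C"
    using cover[of "edges H"] EH by blast
  have "card (edges H) \<le> card (C \<inter> {e \<in> nsets {..<n} 2. \<omega> e})"
    by (rule card_mono) (use finV C EH in auto)
  then show ?thesis using C(1) t(2) H(3) by (intro bexI[of _ C]) auto
qed

section \<open>Containers for graphs without a copy\<close>

context semi_bounded_graph
begin

definition spread_const :: real where
  "spread_const = 2 ^ card (edges F) * (2 * real (card (edges F))) ^ card (verts F) * 4 *
     (4 * real (card (verts F))) ^ card (verts F)"

definition shrink_const :: real where
  "shrink_const = 4 * 2 ^ (card (edges F) * (card (edges F) + 1)) * spread_const"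

lemma card_edges_pos: "card (edges F) \<ge> 1"
  using has_edge finite_edges by (simp add: Suc_le_eq card_gt_0_iff)

lemma consts_ge_1: "spread_const \<ge> 1" "shrink_const \<ge> 1"
proof -
  have h: "real (card (verts F)) \<ge> 1" using card_parts by linarith
  have k: "real (card (edges F)) \<ge> 1" using card_edges_pos by simp
  have "(1::real) * 1 * 4 * 1 \<le> spread_const"
    unfolding spread_const_def using h k by (intro mult_mono one_le_power) auto
  then show s: "spread_const \<ge> 1" by simp
  have "(4::real) * 1 * 1 \<le> shrink_const"
    unfolding shrink_const_def using s by (intro mult_mono one_le_power) auto
  then show "shrink_const \<ge> 1" by simp
qed

text \<open>
  The density of the regular part of \<open>U\<close> is at least \<open>\<delta>0\<close>, so \<open>copy_weight_spread\<close> applies. It is the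
  hypothesis of \<open>container_family\<close> for \<open>\<tau> = L * n powr (2 - 1 / m) / card U\<close>, where \<open>m\<close> is the 2-density; in
  particular the length
  \<open>s\<close> of the fingerprints, which bounds \<open>\<tau> * card U\<close>, is the same for all \<open>U\<close>.
\<close>

lemma one_container_step:
  fixes n s :: nat and L \<delta>0 :: real
  assumes r: "r \<ge> 1" and m: "two_density F > 0" and n: "n \<ge> 1" and L: "L \<ge> harm n" and \<delta>0: "\<delta>0 > 0"
    and b: "real n powr (- b_min F S T) \<le> \<delta>0" and q: "real n powr (- 1 / two_density F) \<le> \<delta>0"
    and big: "8 * real (card (verts F)) ^ 3 \<le> \<delta>0 ^ r * n"
    and s: "L * real n powr (2 - 1 / two_density F) \<le> s"
    and U: "U \<subseteq> nsets {..<n} 2" "real (card U) > L * (real n ^ 2 * \<delta>0)"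
  shows "\<exists>\<C>. finite \<C> \<and> card \<C> \<le> (card U + 1) ^ (s * card (edges F)) \<and>
      (\<forall>C\<in>\<C>. C \<subseteq> U \<and> real (card C) \<le> (1 - 1 / (shrink_const * L)) * card U) \<and>
      (\<forall>I\<subseteq>U. (\<forall>E\<in>edge_copies F. \<not> E \<subseteq> I) \<longrightarrow> (\<exists>C\<in>\<C>. I \<subseteq> C))"
proof -
  let ?m0 = "real n powr (2 - 1 / two_density F)" and ?u = "real (card U)"
  have "harm n > (0::real)" using n by (simp add: harm_pos)
  then have L0: "L > 0" using L by linarith
  have n0: "real n > 0" using n by simp
  have "?u > 0" using U(2) L0 n0 \<delta>0 by (meson less_trans mult_pos_pos zero_less_power)
  then have Une: "U \<noteq> {}" by auto
  have finU: "finite U" by (rule card_ge_0_finite) (use \<open>?u > 0\<close> in simp)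
  obtain B N D where host: "B \<subseteq> {..<n}" "B \<noteq> {}" "D \<ge> 1" "\<And>b. b \<in> B \<Longrightarrow> N b \<subseteq> {..<n}"
    "\<And>b. b \<in> B \<Longrightarrow> card (N b) = D" "\<And>b a. b \<in> B \<Longrightarrow> a \<in> N b \<Longrightarrow> {a, b} \<in> U"
    and uBD: "?u \<le> L * (card B * D)"
    by (rule regular_part[OF U(1) Une L]) (rule that; assumption)
  define \<delta> where "\<delta> = real (card B) * real D / real n ^ 2"
  have uL: "?u \<le> L * (real n ^ 2 * \<delta>)" using uBD n0 by (simp add: \<delta>_def)
  then have "L * (real n ^ 2 * \<delta>0) < L * (real n ^ 2 * \<delta>)" using U(2) by linarith
  then have \<delta>\<delta>0: "\<delta>0 \<le> \<delta>" using L0 n0 by simp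
  have "\<delta>0 ^ r * n \<le> \<delta> ^ r * n" using \<delta>\<delta>0 \<delta>0 by (intro mult_right_mono power_mono) auto
  then have big': "\<delta> ^ r * n \<ge> 8 * real (card (verts F)) ^ 3" using big by linarith
  interpret H: dense_host F S T v0 r n U B N D \<delta>
    by unfold_locales (use U(1) host \<delta>_def r big' m b q \<delta>\<delta>0 in auto)
  have \<delta>pos: "\<delta> > 0" using \<delta>0 \<delta>\<delta>0 by linarith
  let ?\<tau> = "L * ?m0 / ?u"
  have d1: "1 / (\<delta> * real n ^ 2) \<le> L / ?u"
    using uL \<delta>pos n0 \<open>?u > 0\<close> by (simp add: field_simps)
  have split: "real n powr (- 1 / two_density F) = ?m0 / real n ^ 2"
  proof -
    have "?m0 = real n powr (2 + - 1 / two_density F)" by simp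
    also have "\<dots> = real n powr 2 * real n powr (- 1 / two_density F)" by (rule powr_add)
    finally show ?thesis using n0 by (simp add: powr_realpow[of _ 2, simplified])
  qed
  have d2: "real n powr (- 1 / two_density F) / \<delta> \<le> ?\<tau>"
  proof -
    have "real n powr (- 1 / two_density F) / \<delta> = ?m0 * (1 / (\<delta> * real n ^ 2))"
      unfolding split by simp
    also have "\<dots> \<le> ?m0 * (L / ?u)" by (rule mult_left_mono[OF d1]) simp
    finally show ?thesis by (simp add: mult.commute)
  qed
  have "\<exists>\<C>. finite \<C> \<and> card \<C> \<le> (card U + 1) ^ (s * card (edges F)) \<and>
    (\<forall>C\<in>\<C>. C \<subseteq> U \<and> real (card C) \<le> (1 - 1 / (4 * 2 ^ (card (edges F) * (card (edges F) + 1)) * (spread_const * L))) * card U) \<and>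
    (\<forall>I\<subseteq>U. (\<forall>E\<subseteq>I. H.copy_weight E = 0) \<longrightarrow> (\<exists>C\<in>\<C>. I \<subseteq> C))"
  proof (rule container_family[where \<tau> = ?\<tau>, OF card_edges_pos finU Une])
    show "?\<tau> > 0" using L0 n0 \<open>?u > 0\<close> by simp
    show "?\<tau> * card U \<le> s" using s \<open>?u > 0\<close> by simp
    show "spread_const * L > 0" using consts_ge_1 L0 by simp
    show "H.copy_weight E \<ge> 0" for E by (rule H.copy_weight_nonneg)
    show "E \<subseteq> U \<and> card E = card (edges F)" if "H.copy_weight E \<noteq> 0" for E
      by (rule H.copy_weight_support(1)[OF that])
    show "sum H.copy_weight (Pow U) \<ge> 1" by (rule H.copy_weight_total)
    fix \<sigma> assume \<sigma>: "\<sigma> \<subseteq> U" "\<sigma> \<noteq> {}"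
    have "weighted_degree U H.copy_weight \<sigma> \<le> spread_const *
        (1 / (\<delta> * real n ^ 2) * (real n powr (- 1 / two_density F) / \<delta>) ^ (card \<sigma> - 1))"
      unfolding spread_const_def by (rule H.copy_weight_spread[OF \<sigma>])
    also have "\<dots> \<le> spread_const * (L / ?u * ?\<tau> ^ (card \<sigma> - 1))"
      using consts_ge_1 d1 d2 L0 \<delta>pos
      by (intro mult_left_mono mult_mono power_mono) auto
    finally show "weighted_degree U H.copy_weight \<sigma> \<le> spread_const * L / card U * ?\<tau> ^ (card \<sigma> - 1)" by simp
  qed
  then obtain \<C> where \<C>: "finite \<C>" "card \<C> \<le> (card U + 1) ^ (s * card (edges F))"
    "\<forall>C\<in>\<C>. C \<subseteq> U \<and> real (card C) \<le> (1 - 1 / (4 * 2 ^ (card (edges F) * (card (edges F) + 1)) * (spread_const * L))) * card U"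
    "\<forall>I\<subseteq>U. (\<forall>E\<subseteq>I. H.copy_weight E = 0) \<longrightarrow> (\<exists>C\<in>\<C>. I \<subseteq> C)"
    by (elim exE conjE) (rule that; assumption)
  show ?thesis
  proof (intro exI[of _ \<C>] conjI allI impI)
    show "\<forall>C\<in>\<C>. C \<subseteq> U \<and> real (card C) \<le> (1 - 1 / (shrink_const * L)) * card U"
      using \<C>(3) unfolding shrink_const_def by (simp only: mult.assoc)
    fix I assume I: "I \<subseteq> U" "\<forall>E\<in>edge_copies F. \<not> E \<subseteq> I"
    show "\<exists>C\<in>\<C>. I \<subseteq> C"
    proof (rule \<C>(4)[rule_format, OF I(1)])
      fix E assume "E \<subseteq> I"
      then have "E \<notin> edge_copies F" using I(2) by blast
      then show "H.copy_weight E = 0" using H.copy_weight_support(2) by blast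
    qed
  qed (fact \<C>)+
qed

lemma containers_for_free_graphs:
  fixes n s J :: nat and L \<delta>0 :: real
  assumes r: "r \<ge> 1" and m: "two_density F > 0" and n: "n \<ge> 1" and L: "L \<ge> harm n" and L1: "L \<ge> 1"
    and \<delta>0: "\<delta>0 > 0"
    and b: "real n powr (- b_min F S T) \<le> \<delta>0" and q: "real n powr (- 1 / two_density F) \<le> \<delta>0"
    and big: "8 * real (card (verts F)) ^ 3 \<le> \<delta>0 ^ r * n"
    and s: "L * real n powr (2 - 1 / two_density F) \<le> s"
  shows "\<exists>\<C>. finite \<C> \<and> card \<C> \<le> ((n ^ 2 + 1) ^ (s * card (edges F))) ^ J \<and>
      (\<forall>C\<in>\<C>. C \<subseteq> nsets {..<n} 2 \<and> real (card C)
         \<le> max (L * (real n ^ 2 * \<delta>0)) ((1 - 1 / (shrink_const * L)) ^ J * real n ^ 2)) \<and>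
      (\<forall>I\<subseteq>nsets {..<n} 2. (\<forall>E\<in>edge_copies F. \<not> E \<subseteq> I) \<longrightarrow> (\<exists>C\<in>\<C>. I \<subseteq> C))"
proof -
  let ?V = "nsets {..<n} 2" and ?M = "L * (real n ^ 2 * \<delta>0)" and ?\<rho> = "1 - 1 / (shrink_const * L)"
  let ?Q = "(n ^ 2 + 1) ^ (s * card (edges F))"
  let ?Ind = "{I. \<forall>E\<in>edge_copies F. \<not> E \<subseteq> (I :: nat set set)}"
  have finV: "finite ?V" by (rule finite_imp_finite_nsets) simp
  have cV: "card ?V \<le> n ^ 2"
    by (simp add: choose_two power2_eq_square) (meson div_le_dividend diff_le_self le_trans mult_le_mono2)
  have "1 * 1 \<le> shrink_const * L" using consts_ge_1 L1 by (intro mult_mono) auto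
  then have \<rho>: "0 \<le> ?\<rho>" by simp
  have "\<exists>\<C>. finite \<C> \<and> card \<C> \<le> ?Q ^ J \<and>
      (\<forall>C\<in>\<C>. C \<subseteq> ?V \<and> real (card C) \<le> max ?M (?\<rho> ^ J * card ?V)) \<and>
      (\<forall>I\<in>?Ind. I \<subseteq> ?V \<longrightarrow> (\<exists>C\<in>\<C>. I \<subseteq> C))"
  proof (rule iterate_containers[OF finV \<rho>])
    fix U assume U: "U \<subseteq> ?V" "real (card U) > ?M"
    obtain \<C> where \<C>: "finite \<C>" "card \<C> \<le> (card U + 1) ^ (s * card (edges F))"
      "\<forall>C\<in>\<C>. C \<subseteq> U \<and> real (card C) \<le> ?\<rho> * card U"
      "\<forall>I\<subseteq>U. (\<forall>E\<in>edge_copies F. \<not> E \<subseteq> I) \<longrightarrow> (\<exists>C\<in>\<C>. I \<subseteq> C)"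
      using one_container_step[OF r m n L \<delta>0 b q big s U] by (elim exE conjE) (rule that; assumption)
    show "\<exists>\<C>. finite \<C> \<and> card \<C> \<le> ?Q \<and> (\<forall>C\<in>\<C>. C \<subseteq> U \<and> real (card C) \<le> ?\<rho> * card U) \<and>
        (\<forall>I\<in>?Ind. I \<subseteq> U \<longrightarrow> (\<exists>C\<in>\<C>. I \<subseteq> C))"
    proof (intro exI[of _ \<C>] conjI ballI impI)
      have "card U \<le> n ^ 2" using card_mono[OF finV U(1)] cV by linarith
      then have "(card U + 1) ^ (s * card (edges F)) \<le> ?Q" by (intro power_mono) auto
      then show "card \<C> \<le> ?Q" using \<C>(2) by linarith
      fix I assume "I \<in> ?Ind" "I \<subseteq> U"
      then show "\<exists>C\<in>\<C>. I \<subseteq> C" by (intro \<C>(4)[rule_format]) auto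
    qed (use \<C>(1,3) in auto)
  qed simp
  then obtain \<C> where \<C>: "finite \<C>" "card \<C> \<le> ?Q ^ J"
    "\<forall>C\<in>\<C>. C \<subseteq> ?V \<and> real (card C) \<le> max ?M (?\<rho> ^ J * card ?V)"
    "\<forall>I\<in>?Ind. I \<subseteq> ?V \<longrightarrow> (\<exists>C\<in>\<C>. I \<subseteq> C)" by (elim exE conjE) (rule that; assumption)
  show ?thesis
  proof (intro exI[of _ \<C>] conjI ballI allI impI)
    fix C assume C: "C \<in> \<C>"
    show "C \<subseteq> ?V" using \<C>(3) C by (blast dest: bspec)
    have "?\<rho> ^ J * card ?V \<le> ?\<rho> ^ J * real n ^ 2"
      using of_nat_mono[OF cV, where 'a = real] \<rho> by (intro mult_left_mono) auto
    then have "max ?M (?\<rho> ^ J * card ?V) \<le> max ?M (?\<rho> ^ J * real n ^ 2)" by (intro max.mono) auto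
    moreover have "real (card C) \<le> max ?M (?\<rho> ^ J * card ?V)" using bspec[OF \<C>(3) C] by (rule conjunct2)
    ultimately show "real (card C) \<le> max ?M (?\<rho> ^ J * real n ^ 2)" by linarith
  next
    fix I assume I: "I \<subseteq> ?V" "\<forall>E\<in>edge_copies F. \<not> E \<subseteq> I"
    show "\<exists>C\<in>\<C>. I \<subseteq> C" by (rule \<C>(4)[rule_format]) (use I in auto)
  qed (fact \<C>)+
qed

section \<open>The extremal number of the random graph\<close>

text \<open>
  With \<open>m\<close> the 2-density, the iteration stops at density \<open>\<delta>0 = n powr (- 1 / m) / p * l\<close>. The upper bounds on \<open>p\<close>,
  including \<open>p \<le> 1\<close>, say that \<open>\<delta>0 / l\<close> is at least \<open>n powr (- b_min F S T)\<close>, \<open>n powr (- 1 / r)\<close> and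
  \<open>n powr (- 1 / m)\<close>, and the additional factor \<open>l\<close> turns the second one into \<open>\<delta>0 ^ r * n \<ge> l\<close>.
\<close>

lemma few_containers:
  fixes n :: nat and p :: real
  defines "l \<equiv> ln (real n)" and "m0 \<equiv> real n powr (2 - 1 / two_density F)"
  assumes r: "r \<ge> 1" and m: "two_density F \<ge> 1" and n: "n \<ge> 2"
    and p: "0 \<le> p" "p \<le> 1" "real n powr (- 1 / two_density F) \<le> p"
      "p \<le> real n powr (b_min F S T - 1 / two_density F)"
      "p \<le> real n powr (1 / real r - 1 / two_density F)"
    and l: "l \<ge> 1" "l \<ge> 8 * real (card (verts F)) ^ 3"
  obtains \<C> where "finite \<C>" "real (card \<C>) \<le> exp (45 * shrink_const * card (edges F) * (m0 * l ^ 4))"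
    "\<And>C. C \<in> \<C> \<Longrightarrow> C \<subseteq> nsets {..<n} 2 \<and> real (card C) \<le> 2 * l ^ 2 * m0 / p"
    "\<And>I. I \<subseteq> nsets {..<n} 2 \<Longrightarrow> (\<And>E. E \<in> edge_copies F \<Longrightarrow> \<not> E \<subseteq> I) \<Longrightarrow> \<exists>C\<in>\<C>. I \<subseteq> C"
proof -
  let ?\<alpha> = "1 / two_density F" and ?k = "card (edges F)"
  define \<delta>0 where "\<delta>0 = real n powr (- ?\<alpha>) / p * l"
  define L where "L = 2 * l"
  define s where "s = nat \<lceil>L * m0\<rceil>"
  \<comment> \<open>So many rounds shrink \<open>n ^ 2\<close> edges to at most one.\<close>
  define J where "J = nat \<lceil>shrink_const * L * (2 * l)\<rceil>"
  have n0: "real n > 0" "real n \<ge> 1" using n by auto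
  have p0: "p > 0" by (rule less_le_trans[OF _ p(3)]) (use n0 in simp)
  have \<alpha>: "?\<alpha> \<le> 1" using m by simp
  have m0: "m0 \<ge> 1" unfolding m0_def using n0 \<alpha> by (intro ge_one_powr_ge_zero) auto
  have L1: "L \<ge> 1" and Lh: "L \<ge> harm n"
    using l harm_le_ln[of n] n by (auto simp: L_def l_def)
  \<comment> \<open>Each upper bound on \<open>p\<close> turns into a lower bound on \<open>\<delta>0\<close>.\<close>
  have base: "real n powr (- c) \<le> real n powr (- ?\<alpha>) / p" if "p \<le> real n powr (c - ?\<alpha>)" for c
  proof -
    have "real n powr (- c) * p \<le> real n powr (- c) * real n powr (c - ?\<alpha>)"
      by (rule mult_left_mono[OF that]) simp
    also have "\<dots> = real n powr (- ?\<alpha>)" by (simp add: powr_add[symmetric])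
    finally show ?thesis using p0 by (simp add: field_simps)
  qed
  have up: "real n powr (- c) \<le> \<delta>0" if "p \<le> real n powr (c - ?\<alpha>)" for c
  proof -
    have "real n powr (- ?\<alpha>) / p * 1 \<le> \<delta>0"
      unfolding \<delta>0_def using l p0 by (intro mult_left_mono) auto
    then show ?thesis using base[OF that] by simp
  qed
  have \<delta>0: "\<delta>0 > 0" unfolding \<delta>0_def using p0 n0 l by simp
  have b: "real n powr (- b_min F S T) \<le> \<delta>0" using up p(4) by simp
  have q: "real n powr (- 1 / two_density F) \<le> \<delta>0" using up[of ?\<alpha>] p(2) n0 by simp
  have big: "8 * real (card (verts F)) ^ 3 \<le> \<delta>0 ^ r * n"
  proof -
    have r0: "real r \<noteq> 0" using r by simp
    have "real n powr (- (1 / real r)) * l \<le> \<delta>0"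
      unfolding \<delta>0_def using base[of "1 / real r"] p(5) l by (intro mult_right_mono) auto
    then have "(real n powr (- (1 / real r)) * l) ^ r \<le> \<delta>0 ^ r"
      using l by (intro power_mono) auto
    moreover have "(real n powr (- (1 / real r))) ^ r = 1 / n"
    proof -
      have "(real n powr (- (1 / real r))) ^ r = real n powr (- (1 / real r) * real r)"
        using n0 by (simp add: powr_realpow[symmetric] powr_powr)
      also have "\<dots> = 1 / n" using r0 n0 by (simp add: powr_minus divide_inverse)
      finally show ?thesis .
    qed
    ultimately have "l ^ r / n \<le> \<delta>0 ^ r" by (simp add: power_mult_distrib)
    then have "l ^ r \<le> \<delta>0 ^ r * n" using n0 by (simp add: field_simps)
    moreover have "l ^ 1 \<le> l ^ r" using l r by (intro power_increasing) auto
    ultimately show ?thesis using l(2) by simp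
  qed
  have s: "L * real n powr (2 - ?\<alpha>) \<le> s" unfolding s_def m0_def[symmetric] by linarith
  have m': "two_density F > 0" and n1: "n \<ge> 1" using m n by auto
  obtain \<C> where \<C>: "finite \<C>" "card \<C> \<le> ((n ^ 2 + 1) ^ (s * ?k)) ^ J"
      "\<forall>C\<in>\<C>. C \<subseteq> nsets {..<n} 2 \<and> real (card C)
         \<le> max (L * (real n ^ 2 * \<delta>0)) ((1 - 1 / (shrink_const * L)) ^ J * real n ^ 2)"
      "\<forall>I\<subseteq>nsets {..<n} 2. (\<forall>E\<in>edge_copies F. \<not> E \<subseteq> I) \<longrightarrow> (\<exists>C\<in>\<C>. I \<subseteq> C)"
    using containers_for_free_graphs[OF r m' n1 Lh L1 \<delta>0 b q big s, of J]
    by (elim exE conjE) (rule that; assumption)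
  have K: "shrink_const \<ge> 1" by (rule consts_ge_1)
  have l2: "l ^ 2 \<ge> 1" "l ^ 2 = l * l" using l by (simp_all add: power2_eq_square one_le_power mult_ge1_I)
  have M: "L * (real n ^ 2 * \<delta>0) = 2 * l ^ 2 * m0 / p"
  proof -
    have "m0 = real n powr 2 * real n powr (- ?\<alpha>)"
      unfolding m0_def powr_add[symmetric] by simp
    then have "m0 = real n ^ 2 * real n powr (- ?\<alpha>)"
      using n0 by (simp add: powr_realpow[of _ 2, simplified])
    then show ?thesis by (simp add: L_def \<delta>0_def l2(2))
  qed
  have M1: "2 * l ^ 2 * m0 / p \<ge> 1"
  proof -
    have "1 * 1 \<le> l ^ 2 * m0" by (rule mult_mono[OF l2(1) m0]) auto
    then show ?thesis using p0 p(2) by (simp add: le_divide_eq)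
  qed
  have shrink: "(1 - 1 / (shrink_const * L)) ^ J * real n ^ 2 \<le> 1"
  proof -
    let ?c = "1 / (shrink_const * L)"
    have KL: "1 * 1 \<le> shrink_const * L" by (rule mult_mono[OF K L1]) (use K in auto)
    have "(1 - ?c) ^ J \<le> exp (- ?c) ^ J"
      using exp_ge_add_one_self[of "- ?c"] KL by (intro power_mono) auto
    also have "\<dots> = exp (- ?c * J)" by (rule exp_of_nat2_mult[symmetric])
    also have "\<dots> \<le> exp (- (2 * l))"
    proof -
      have "shrink_const * L * (2 * l) \<le> J" unfolding J_def by linarith
      then have "2 * l \<le> ?c * J" using KL by (simp add: field_simps)
      then show ?thesis by simp
    qed
    also have "\<dots> = 1 / real n ^ 2"
    proof -
      have "exp (2 * l) = exp l ^ 2" using exp_of_nat_mult[of 2 l] by simp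
      then show ?thesis using n0 by (simp add: exp_minus l_def divide_inverse)
    qed
    finally show ?thesis using n0 by (simp add: field_simps)
  qed
  have sJ: "real s \<le> 3 * l * m0" "real J \<le> 5 * shrink_const * l ^ 2"
  proof -
    have "1 * 1 \<le> l * m0" by (rule mult_mono[OF l(1) m0]) (use l in auto)
    moreover have "real s \<le> L * m0 + 1" unfolding s_def using L1 m0 by (simp add: of_nat_nat mult_nonneg_nonneg)
    ultimately show "real s \<le> 3 * l * m0" by (simp add: L_def)
    have "1 * 1 \<le> shrink_const * l ^ 2" by (rule mult_mono[OF K l2(1)]) (use K in auto)
    moreover have "real J \<le> shrink_const * L * (2 * l) + 1"
      unfolding J_def using K L1 l by (simp add: of_nat_nat mult_nonneg_nonneg)
    moreover have "shrink_const * L * (2 * l) = 4 * (shrink_const * l ^ 2)" by (simp add: L_def l2(2))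
    ultimately show "real J \<le> 5 * shrink_const * l ^ 2" by simp
  qed
  have card: "real (card \<C>) \<le> exp (45 * shrink_const * ?k * (m0 * l ^ 4))"
  proof -
    have "n ^ 2 + 1 \<le> n ^ 3"
    proof -
      have "n ^ 2 + 1 \<le> 2 * n ^ 2" using n by simp
      also have "\<dots> \<le> n * n ^ 2" using n by (intro mult_right_mono) auto
      finally show ?thesis by (simp add: power3_eq_cube power2_eq_square)
    qed
    then have "real (n ^ 2 + 1) \<le> real (n ^ 3)" by (rule of_nat_mono)
    also have "real (n ^ 3) = exp (3 * l)"
    proof -
      have "exp (3 * l) = exp l ^ 3" using exp_of_nat_mult[of 3 l] by simp
      then show ?thesis using n0 by (simp add: l_def)
    qed
    finally have n3: "real (n ^ 2 + 1) \<le> exp (3 * l)" .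
    have "real (card \<C>) \<le> real (((n ^ 2 + 1) ^ (s * ?k)) ^ J)" by (rule of_nat_mono[OF \<C>(2)])
    also have "\<dots> = real (n ^ 2 + 1) ^ (s * ?k * J)" by (simp add: power_mult)
    also have "\<dots> \<le> exp (3 * l) ^ (s * ?k * J)" by (rule power_mono[OF n3]) simp
    also have "\<dots> = exp (3 * l * real (s * ?k * J))" by (rule exp_of_nat2_mult[symmetric])
    also have "\<dots> \<le> exp (45 * shrink_const * ?k * (m0 * l ^ 4))"
    proof -
      have "real s * real J \<le> (3 * l * m0) * (5 * shrink_const * l ^ 2)"
        using sJ l m0 by (intro mult_mono) auto
      then have "(3 * l * ?k) * (real s * real J) \<le> (3 * l * ?k) * ((3 * l * m0) * (5 * shrink_const * l ^ 2))"
        using l by (intro mult_left_mono) auto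
      also have "\<dots> = 45 * shrink_const * ?k * (m0 * l ^ 4)"
        by (simp add: power2_eq_square power4_eq_xxxx)
      finally have "(3 * l * ?k) * (real s * real J) \<le> 45 * shrink_const * ?k * (m0 * l ^ 4)" .
      moreover have "3 * l * real (s * ?k * J) = (3 * l * ?k) * (real s * real J)" by simp
      ultimately show ?thesis by simp
    qed
    finally show ?thesis .
  qed
  show ?thesis
  proof (rule that[OF \<C>(1) card])
    fix C assume "C \<in> \<C>"
    then have "C \<subseteq> nsets {..<n} 2 \<and> real (card C)
         \<le> max (L * (real n ^ 2 * \<delta>0)) ((1 - 1 / (shrink_const * L)) ^ J * real n ^ 2)"
      by (rule bspec[OF \<C>(3)])
    then show "C \<subseteq> nsets {..<n} 2 \<and> real (card C) \<le> 2 * l ^ 2 * m0 / p"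
      unfolding M using shrink M1 by linarith
  next
    fix I assume "I \<subseteq> nsets {..<n} 2" "\<And>E. E \<in> edge_copies F \<Longrightarrow> \<not> E \<subseteq> I"
    then show "\<exists>C\<in>\<C>. I \<subseteq> C" by (intro \<C>(4)[rule_format])
  qed
qed

text \<open>
  The number of containers costs \<open>m0 * l ^ 4\<close> in the exponent and the expected number of random edges in a
  container only \<open>m0 * l ^ 2\<close>, up to constants, while asking for \<open>m0 * l ^ 5\<close> edges gains
  \<open>ln 2 * m0 * l ^ 5\<close>.
\<close>

lemma extremal_number_concentration:
  fixes n :: nat and p :: real
  defines "l \<equiv> ln (real n)"
  assumes r: "r \<ge> 1" and m: "two_density F \<ge> 1" and n: "n \<ge> 2"
    and p: "0 \<le> p" "p \<le> 1" "real n powr (- 1 / two_density F) \<le> p"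
      "p \<le> real n powr (b_min F S T - 1 / two_density F)"
      "p \<le> real n powr (1 / real r - 1 / two_density F)"
    and l: "l \<ge> 1" "l \<ge> 8 * real (card (verts F)) ^ 3" "l \<ge> real (card (verts F)) ^ 2"
      "ln 2 * l \<ge> 45 * shrink_const * card (edges F) + 3"
  shows "measure_pmf.prob (gnp n p)
     {G. real (extremal_number G F) \<le> real n powr (2 - 1 / two_density F) * l powr 5} \<ge> 1 - 1 / n"
proof -
  let ?m0 = "real n powr (2 - 1 / two_density F)" and ?V = "nsets {..<n} 2"
  let ?P = "Pi_pmf ?V False (\<lambda>_. bernoulli_pmf p)"
  let ?t = "?m0 * l powr 5" and ?M = "2 * l ^ 2 * ?m0 / p" and ?c = "45 * shrink_const * card (edges F)"
  obtain \<C> where \<C>: "finite \<C>" "real (card \<C>) \<le> exp (?c * (?m0 * l ^ 4))"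
    "\<And>C. C \<in> \<C> \<Longrightarrow> C \<subseteq> ?V \<and> real (card C) \<le> ?M"
    "\<And>I. I \<subseteq> ?V \<Longrightarrow> (\<And>E. E \<in> edge_copies F \<Longrightarrow> \<not> E \<subseteq> I) \<Longrightarrow> \<exists>C\<in>\<C>. I \<subseteq> C"
    using few_containers[OF r m n p l(1,2)[unfolded l_def]] unfolding l_def[symmetric] by blast
  have n0: "real n > 0" "real n \<ge> 1" using n by auto
  have p0: "p > 0" by (rule less_le_trans[OF _ p(3)]) (use n0 in simp)
  have "1 / two_density F \<le> 1" using m by simp
  then have m0: "?m0 \<ge> 1" using n0 by (intro ge_one_powr_ge_zero) auto
  have l5: "l powr 5 = l ^ 4 * l" using l(1) by (simp add: powr_realpow[of l 5, simplified] power_numeral_reduce)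
  have finV: "finite ?V" by (rule finite_imp_finite_nsets) simp
  have powr_two: "2 powr a = exp (a * ln 2)" for a :: real by (simp add: powr_def)
  let ?Bad = "{\<omega>. \<exists>C\<in>\<C>. ?t \<le> real (card (C \<inter> {e \<in> ?V. \<omega> e}))}"
  have ht: "real (card (verts F) ^ 2) \<le> ?t"
  proof -
    have "1 * l \<le> l ^ 4 * l" using l(1) by (intro mult_right_mono one_le_power) auto
    then have "1 * l \<le> ?m0 * l powr 5" unfolding l5 using m0 l(1) by (intro mult_mono) auto
    then show ?thesis using l(3) by simp
  qed
  have sub: "{\<omega>. \<not> real (extremal_number (graph_of n \<omega>) F) \<le> ?t} \<subseteq> ?Bad"
  proof clarify
    fix \<omega> assume "\<not> real (extremal_number (graph_of n \<omega>) F) \<le> ?t"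
    then have "?t < real (extremal_number (graph_of n \<omega>) F)" by simp
    then show "\<exists>C\<in>\<C>. ?t \<le> real (card (C \<inter> {e \<in> ?V. \<omega> e}))"
      by (rule large_extremal_number_container[OF simple has_edge ht]) (rule \<C>(4))
  qed
  have "measure_pmf.prob ?P {\<omega>. \<not> real (extremal_number (graph_of n \<omega>) F) \<le> ?t} \<le> measure_pmf.prob ?P ?Bad"
    by (rule measure_pmf.finite_measure_mono[OF sub]) simp
  also have "\<dots> \<le> card \<C> * (2 powr (- ?t) * exp (p * ?M))"
    by (rule prob_container_le[OF p(1,2) finV \<C>(1,3)])
  also have "\<dots> \<le> exp (?c * (?m0 * l ^ 4)) * (2 powr (- ?t) * exp (p * ?M))"
    by (rule mult_right_mono[OF \<C>(2)]) simp
  also have "2 powr (- ?t) = exp (- ?t * ln 2)" by (rule powr_two)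
  also have "exp (?c * (?m0 * l ^ 4)) * (exp (- ?t * ln 2) * exp (p * ?M))
      = exp (?c * (?m0 * l ^ 4) + (- ?t * ln 2 + p * ?M))"
    by (simp only: exp_add)
  also have "\<dots> \<le> exp (- l)"
  proof -
    have pM: "p * ?M = 2 * ?m0 * l ^ 2" using p0 by simp
    have "l ^ 2 \<le> l ^ 4" using l(1) by (intro power_increasing) auto
    then have "2 * ?m0 * l ^ 2 \<le> 2 * ?m0 * l ^ 4" by (intro mult_left_mono) auto
    then have "?c * (?m0 * l ^ 4) + (- ?t * ln 2 + p * ?M) \<le> ?m0 * l ^ 4 * (?c + 2 - ln 2 * l)"
      unfolding pM l5 by (simp add: algebra_simps)
    also have "\<dots> \<le> ?m0 * l ^ 4 * (- 1)" using l(4) by (intro mult_left_mono) auto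
    also have "\<dots> \<le> - l"
    proof -
      have "l ^ 1 \<le> l ^ 4" using l(1) by (intro power_increasing) auto
      then have "1 * l \<le> ?m0 * l ^ 4" using m0 l(1) by (intro mult_mono) auto
      then show ?thesis by simp
    qed
    finally show ?thesis by simp
  qed
  also have "\<dots> = 1 / n" using n0 by (simp add: l_def exp_minus divide_inverse)
  finally have bad: "measure_pmf.prob ?P {\<omega>. \<not> real (extremal_number (graph_of n \<omega>) F) \<le> ?t} \<le> 1 / n" .
  have "measure_pmf.prob (gnp n p) {G. real (extremal_number G F) \<le> ?t}
      = measure_pmf.prob ?P {\<omega>. real (extremal_number (graph_of n \<omega>) F) \<le> ?t}"
    unfolding gnp_def by (simp add: measure_map_pmf vimage_def)
  also have "{\<omega>. real (extremal_number (graph_of n \<omega>) F) \<le> ?t}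
      = - {\<omega>. \<not> real (extremal_number (graph_of n \<omega>) F) \<le> ?t}" by blast
  also have "measure_pmf.prob ?P \<dots> = 1 - measure_pmf.prob ?P {\<omega>. \<not> real (extremal_number (graph_of n \<omega>) F) \<le> ?t}"
    using measure_pmf.prob_compl[of "{\<omega>. \<not> real (extremal_number (graph_of n \<omega>) F) \<le> ?t}" ?P]
    by (simp add: Compl_eq_Diff_UNIV)
  finally show ?thesis using bad by linarith
qed

end

theorem theorem2p6:
  fixes F :: "'a ugraph" and S T :: "'a set" and v0 :: 'a and r :: nat
  assumes "r \<ge> 1"
    and "simple_graph F"
    and "semi_bounded r F S T v0"
    and "has_cycle F"
  shows "\<exists>C::real. C > 0 \<and>
    (\<forall>p :: nat \<Rightarrow> real.
       (\<forall>n\<ge>1. 0 \<le> p n \<and> p n \<le> 1 \<and>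
          real n powr (- 1 / two_density F) \<le> p n \<and>
          p n \<le> min (real n powr (b_min F S T - 1 / two_density F))
                     (real n powr (1 / real r - 1 / two_density F))) \<longrightarrow>
       aas (\<lambda>n. gnp n (p n))
           (\<lambda>n G. real (extremal_number G F)
                    \<le> real n powr (2 - 1 / two_density F) * ln (real n) powr C))"
proof -
  have "edges F \<noteq> {}" using assms(4) by (force simp: has_cycle_def)
  then interpret semi_bounded_graph F S T v0 r using assms(2,3) by unfold_locales
  have m: "two_density F \<ge> 1" by (rule two_density_ge_1[OF assms(2,4)])
  show ?thesis
  proof (intro exI[of _ 5] conjI allI impI)
    fix p :: "nat \<Rightarrow> real"
    assume p: "\<forall>n\<ge>1. 0 \<le> p n \<and> p n \<le> 1 \<and> real n powr (- 1 / two_density F) \<le> p n \<and>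
          p n \<le> min (real n powr (b_min F S T - 1 / two_density F))
                     (real n powr (1 / real r - 1 / two_density F))"
    let ?X = "\<lambda>n. measure_pmf.prob (gnp n (p n)) {G. real (extremal_number G F)
        \<le> real n powr (2 - 1 / two_density F) * ln (real n) powr 5}"
    define c where "c = max (max 1 (8 * real (card (verts F)) ^ 3)) (max (real (card (verts F)) ^ 2)
        ((45 * shrink_const * card (edges F) + 3) / ln 2))"
    have "filterlim (\<lambda>n. ln (real n)) at_top sequentially"
      by (rule filterlim_compose[OF ln_at_top filterlim_real_sequentially])
    then have ev: "eventually (\<lambda>n. c \<le> ln (real n)) sequentially"
      by (simp add: filterlim_at_top)
    have lower: "eventually (\<lambda>n. 1 - 1 / real n \<le> ?X n) sequentially"
      using ev eventually_ge_at_top[of 2]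
    proof eventually_elim
      case (elim n)
      have pn: "0 \<le> p n" "p n \<le> 1" "real n powr (- 1 / two_density F) \<le> p n"
          "p n \<le> real n powr (b_min F S T - 1 / two_density F)"
          "p n \<le> real n powr (1 / real r - 1 / two_density F)"
        using p elim(2) by auto
      have "(45 * shrink_const * card (edges F) + 3) / ln 2 \<le> ln (real n)"
        using elim(1) by (simp add: c_def)
      then have "ln 2 * ln (real n) \<ge> 45 * shrink_const * card (edges F) + 3"
        by (simp add: pos_divide_le_eq mult.commute)
      then show ?case
        using elim(1) by (intro extremal_number_concentration assms(1) m elim(2) pn) (simp_all add: c_def)
    qed
    have "?X \<longlonglongrightarrow> 1"
    proof (rule tendsto_sandwich[OF lower, where h = "\<lambda>_. 1"])
      show "(\<lambda>n. 1 - 1 / real n) \<longlonglongrightarrow> 1"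
        using tendsto_diff[OF tendsto_const lim_1_over_n, of 1] by simp
    qed (auto intro: always_eventually)
    then show "aas (\<lambda>n. gnp n (p n)) (\<lambda>n G. real (extremal_number G F)
        \<le> real n powr (2 - 1 / two_density F) * ln (real n) powr 5)"
      unfolding aas_def .
  qed simp
qed

end
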